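(* Let $(X,d)$ be a geodesic length space, $I\subseteq\mathbb{R}$ an open interval, $f:I\to(0,\infty)$ smooth and $Y=I\times_f X$. If $Y$ has timelike curvature bounded below (respectively above) by $K\in\mathbb{R}$, then $f$ is $K$-concave (respectively $K$-convex), i.e., $f''-Kf\le0$ (respectively $f''-Kf\ge0$) on $I$.
   Context: $Y=I\times X$ with metric $D((t,x),(t',x'))=|t-t'|+d(x,x')$; a curve $\gamma=(\alpha,\beta)$ is causal if $D$-absolutely continuous, $\alpha$ strictly monotone and $-\dot\alpha^2+(f\circ\alpha)^2v_\beta^2\le0$ a.e. ($v_\beta$ the metric derivative; timelike if $<0$ a.e.), future directed if $\dot\alpha>0$ a.e.; $L(\gamma)=\int\sqrt{\dot\alpha^2-(f\circ\alpha)^2v_\beta^2}$; $\tau(y,y')$ is the supremum of $L$ over future directed causal curves from $y$ to $y'$ ($0$ if none); $\ll,\le$ are defined by existence of future directed timelike/causal curves. Timelike curvature bounded below (above) by $K$: every point has a neighborhood $U$ with $\tau|_{U\times U}$ finite and continuous, any $x\ll y$ in $U$ joined by a causal curve in $U$ of $\tau$-length $\tau(x,y)$, and such that for every timelike geodesic triangle $(x,y,z)$ in $U$ ($x\ll y\ll z$, $\tau(x,z)<\infty$, sides realized by maximal causal curves, satisfying the size bounds needed for a comparison triangle in the two-dimensional Lorentzian model space $\mathbb{L}^2(K)$ of constant curvature $K$), and points $p,q$ on its sides with corresponding points $p',q'$ on the comparison triangle, $\tau(p,q)\le\tau_{\mathbb{L}^2(K)}(p',q')$ (respectively $\ge$)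.
   Formalization: The space X is additionally assumed to have at least two points; for a one-point X all timelike triangles are degenerate, both curvature bounds hold for every K, and the claim fails (e.g. f = 1, K = -1, bounded below). *)

theory Defs
  imports "HOL-Analysis.Analysis"
begin

definition geodesic_length_space :: "'a::metric_space set \<Rightarrow> bool" where
  "geodesic_length_space X \<longleftrightarrow>
     (\<forall>x\<in>X. \<forall>y\<in>X. \<exists>\<gamma>::real \<Rightarrow> 'a. \<gamma> 0 = x \<and> \<gamma> 1 = y \<and> \<gamma> ` {0..1} \<subseteq> X \<and>
        (\<forall>s\<in>{0..1}. \<forall>t\<in>{0..1}. dist (\<gamma> s) (\<gamma> t) = \<bar>s - t\<bar> * dist x y))"

definition smooth_on :: "real set \<Rightarrow> (real \<Rightarrow> real) \<Rightarrow> bool" where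
  "smooth_on I f \<longleftrightarrow> (\<forall>n. \<forall>t\<in>I. ((deriv ^^ n) f) field_differentiable (at t))"

definition wdist :: "real \<times> 'a::metric_space \<Rightarrow> real \<times> 'a \<Rightarrow> real" where
  "wdist p q = \<bar>fst p - fst q\<bar> + dist (snd p) (snd q)"

definition abs_cont_wrt :: "('b \<Rightarrow> 'b \<Rightarrow> real) \<Rightarrow> real \<Rightarrow> real \<Rightarrow> (real \<Rightarrow> 'b) \<Rightarrow> bool" where
  "abs_cont_wrt dd a b g \<longleftrightarrow>
     (\<forall>\<epsilon>>0. \<exists>\<delta>>0. \<forall>(n::nat) (l::nat \<Rightarrow> real) (r::nat \<Rightarrow> real).
        (\<forall>i<n. a \<le> l i \<and> l i \<le> r i \<and> r i \<le> b) \<and>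
        (\<forall>i<n. \<forall>j<n. i \<noteq> j \<longrightarrow> r i \<le> l j \<or> r j \<le> l i) \<and>
        (\<Sum>i<n. r i - l i) < \<delta>
        \<longrightarrow> (\<Sum>i<n. dd (g (l i)) (g (r i))) < \<epsilon>)"

definition curve_derivs :: "(real \<Rightarrow> real \<times> 'a::metric_space) \<Rightarrow> real \<Rightarrow> real \<Rightarrow> real \<Rightarrow> bool" where
  "curve_derivs \<gamma> s da v \<longleftrightarrow>
     ((\<lambda>r. fst (\<gamma> r)) has_real_derivative da) (at s) \<and>
     ((\<lambda>h. dist (snd (\<gamma> (s + h))) (snd (\<gamma> s)) / \<bar>h\<bar>) \<longlongrightarrow> v) (at 0)"

definition mderiv :: "(real \<Rightarrow> real \<times> 'a::metric_space) \<Rightarrow> real \<Rightarrow> real" where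
  "mderiv \<gamma> s = Lim (at 0) (\<lambda>h. dist (snd (\<gamma> (s + h))) (snd (\<gamma> s)) / \<bar>h\<bar>)"

definition causal_curve ::
  "real set \<Rightarrow> 'a::metric_space set \<Rightarrow> (real \<Rightarrow> real) \<Rightarrow> real \<Rightarrow> real \<Rightarrow> (real \<Rightarrow> real \<times> 'a) \<Rightarrow> bool" where
  "causal_curve I X f a b \<gamma> \<longleftrightarrow>
     a < b \<and> \<gamma> ` {a..b} \<subseteq> I \<times> X \<and> abs_cont_wrt wdist a b \<gamma> \<and>
     ((\<forall>s\<in>{a..b}. \<forall>s'\<in>{a..b}. s < s' \<longrightarrow> fst (\<gamma> s) < fst (\<gamma> s')) \<or>
      (\<forall>s\<in>{a..b}. \<forall>s'\<in>{a..b}. s < s' \<longrightarrow> fst (\<gamma> s) > fst (\<gamma> s'))) \<and>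
     (AE s in lborel. s \<in> {a..b} \<longrightarrow>
        (\<exists>da v. curve_derivs \<gamma> s da v \<and> - (da\<^sup>2) + (f (fst (\<gamma> s)))\<^sup>2 * v\<^sup>2 \<le> 0))"

definition timelike_curve ::
  "real set \<Rightarrow> 'a::metric_space set \<Rightarrow> (real \<Rightarrow> real) \<Rightarrow> real \<Rightarrow> real \<Rightarrow> (real \<Rightarrow> real \<times> 'a) \<Rightarrow> bool" where
  "timelike_curve I X f a b \<gamma> \<longleftrightarrow> causal_curve I X f a b \<gamma> \<and>
     (AE s in lborel. s \<in> {a..b} \<longrightarrow>
        (\<exists>da v. curve_derivs \<gamma> s da v \<and> - (da\<^sup>2) + (f (fst (\<gamma> s)))\<^sup>2 * v\<^sup>2 < 0))"

definition future_directed :: "real \<Rightarrow> real \<Rightarrow> (real \<Rightarrow> real \<times> 'a::metric_space) \<Rightarrow> bool" where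
  "future_directed a b \<gamma> \<longleftrightarrow>
     (AE s in lborel. s \<in> {a..b} \<longrightarrow> (\<exists>da. ((\<lambda>r. fst (\<gamma> r)) has_real_derivative da) (at s) \<and> da > 0))"

definition fd_causal where
  "fd_causal I X f a b \<gamma> \<longleftrightarrow> causal_curve I X f a b \<gamma> \<and> future_directed a b \<gamma>"

definition fd_timelike where
  "fd_timelike I X f a b \<gamma> \<longleftrightarrow> timelike_curve I X f a b \<gamma> \<and> future_directed a b \<gamma>"

definition curve_length :: "(real \<Rightarrow> real) \<Rightarrow> real \<Rightarrow> real \<Rightarrow> (real \<Rightarrow> real \<times> 'a::metric_space) \<Rightarrow> real" where
  "curve_length f a b \<gamma> =
     integral {a..b} (\<lambda>s. sqrt ((deriv (\<lambda>r. fst (\<gamma> r)) s)\<^sup>2 - (f (fst (\<gamma> s)))\<^sup>2 * (mderiv \<gamma> s)\<^sup>2))"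

definition tau :: "real set \<Rightarrow> 'a::metric_space set \<Rightarrow> (real \<Rightarrow> real) \<Rightarrow> real \<times> 'a \<Rightarrow> real \<times> 'a \<Rightarrow> ereal" where
  "tau I X f y y' =
     (let C = {ereal (curve_length f a b \<gamma>) | a b \<gamma>. fd_causal I X f a b \<gamma> \<and> \<gamma> a = y \<and> \<gamma> b = y'}
      in if C = {} then 0 else Sup C)"

definition chron :: "real set \<Rightarrow> 'a::metric_space set \<Rightarrow> (real \<Rightarrow> real) \<Rightarrow> real \<times> 'a \<Rightarrow> real \<times> 'a \<Rightarrow> bool" where
  "chron I X f y y' \<longleftrightarrow> (\<exists>a b \<gamma>. fd_timelike I X f a b \<gamma> \<and> \<gamma> a = y \<and> \<gamma> b = y')"

definition causal_rel :: "real set \<Rightarrow> 'a::metric_space set \<Rightarrow> (real \<Rightarrow> real) \<Rightarrow> real \<times> 'a \<Rightarrow> real \<times> 'a \<Rightarrow> bool" where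
  "causal_rel I X f y y' \<longleftrightarrow> (\<exists>a b \<gamma>. fd_causal I X f a b \<gamma> \<and> \<gamma> a = y \<and> \<gamma> b = y')"

text \<open>Global coordinates (t,x) on R^2 for the simply connected two-dimensional Lorentzian
  space form of constant curvature K:
   K > 0: -dt^2 + cosh^2(sqrt K t) dx^2   (universal cover of de Sitter space),
   K = 0: -dt^2 + dx^2                    (Minkowski plane),
   K < 0: -cosh^2(sqrt(-K) x) dt^2 + dx^2 (universal cover of anti-de Sitter space).
  The time orientation is given by the timelike vector field d/dt.\<close>
definition model_g :: "real \<Rightarrow> real \<times> real \<Rightarrow> real \<times> real \<Rightarrow> real" where
  "model_g K p w =
     (if K > 0 then - (fst w)\<^sup>2 + (cosh (sqrt K * fst p))\<^sup>2 * (snd w)\<^sup>2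
      else if K = 0 then - (fst w)\<^sup>2 + (snd w)\<^sup>2
      else - (cosh (sqrt (- K) * snd p))\<^sup>2 * (fst w)\<^sup>2 + (snd w)\<^sup>2)"

definition model_fd_causal :: "real \<Rightarrow> real \<Rightarrow> real \<Rightarrow> (real \<Rightarrow> real \<times> real) \<Rightarrow> bool" where
  "model_fd_causal K a b \<sigma> \<longleftrightarrow>
     a < b \<and> \<sigma> piecewise_C1_differentiable_on {a..b} \<and>
     (\<exists>S. finite S \<and> (\<forall>s\<in>{a<..<b} - S. \<sigma> differentiable (at s) \<and>
         model_g K (\<sigma> s) (vector_derivative \<sigma> (at s)) \<le> 0 \<and>
         fst (vector_derivative \<sigma> (at s)) > 0))"

definition model_len :: "real \<Rightarrow> real \<Rightarrow> real \<Rightarrow> (real \<Rightarrow> real \<times> real) \<Rightarrow> real" where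
  "model_len K a b \<sigma> = integral {a..b} (\<lambda>s. sqrt (- model_g K (\<sigma> s) (vector_derivative \<sigma> (at s))))"

definition tau_model :: "real \<Rightarrow> real \<times> real \<Rightarrow> real \<times> real \<Rightarrow> ereal" where
  "tau_model K p q =
     (let C = {ereal (model_len K a b \<sigma>) | a b \<sigma>. model_fd_causal K a b \<sigma> \<and> \<sigma> a = p \<and> \<sigma> b = q}
      in if C = {} then 0 else Sup C)"

definition model_corr :: "real \<Rightarrow> real \<times> real \<Rightarrow> real \<times> real \<Rightarrow> ereal \<Rightarrow> real \<times> real \<Rightarrow> bool" where
  "model_corr K x' y' t p' \<longleftrightarrow>
     (\<exists>c d \<sigma>. model_fd_causal K c d \<sigma> \<and> \<sigma> c = x' \<and> \<sigma> d = y' \<and>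
        ereal (model_len K c d \<sigma>) = tau_model K x' y' \<and> p' \<in> \<sigma> ` {c..d}) \<and>
     tau_model K x' p' = t"

text \<open>Size bound ensuring realizability of a comparison triangle in L^2(K).\<close>
definition size_ok :: "real \<Rightarrow> ereal \<Rightarrow> bool" where
  "size_ok K c \<longleftrightarrow> K \<ge> 0 \<or> c < ereal (pi / sqrt (- K))"

definition max_curve_in where
  "max_curve_in I X f U p q a b \<gamma> \<longleftrightarrow>
     fd_causal I X f a b \<gamma> \<and> \<gamma> a = p \<and> \<gamma> b = q \<and> \<gamma> ` {a..b} \<subseteq> U \<and>
     ereal (curve_length f a b \<gamma>) = tau I X f p q"

definition timelike_curv_bound ::
  "real set \<Rightarrow> 'a::metric_space set \<Rightarrow> (real \<Rightarrow> real) \<Rightarrow> real \<Rightarrow> (ereal \<Rightarrow> ereal \<Rightarrow> bool) \<Rightarrow> bool" where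
  "timelike_curv_bound I X f K rel \<longleftrightarrow>
   (\<forall>y\<in>I \<times> X. \<exists>U. openin (top_of_set (I \<times> X)) U \<and> y \<in> U \<and>
      (\<forall>p\<in>U. \<forall>q\<in>U. tau I X f p q < \<infinity>) \<and>
      continuous_on (U \<times> U) (\<lambda>pq. tau I X f (fst pq) (snd pq)) \<and>
      (\<forall>p\<in>U. \<forall>q\<in>U. chron I X f p q \<longrightarrow> (\<exists>a b \<gamma>. max_curve_in I X f U p q a b \<gamma>)) \<and>
      (\<forall>x y z a1 b1 \<gamma>1 a2 b2 \<gamma>2 a3 b3 \<gamma>3 x' y' z' p q p' q'.
         x \<in> U \<and> y \<in> U \<and> z \<in> U \<and> chron I X f x y \<and> chron I X f y z \<and>
         tau I X f x z < \<infinity> \<and> size_ok K (tau I X f x z) \<and>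
         max_curve_in I X f U x y a1 b1 \<gamma>1 \<and> max_curve_in I X f U y z a2 b2 \<gamma>2 \<and>
         max_curve_in I X f U x z a3 b3 \<gamma>3 \<and>
         tau_model K x' y' = tau I X f x y \<and> tau_model K y' z' = tau I X f y z \<and>
         tau_model K x' z' = tau I X f x z \<and>
         ((p \<in> \<gamma>1 ` {a1..b1} \<and> model_corr K x' y' (tau I X f x p) p') \<or>
          (p \<in> \<gamma>2 ` {a2..b2} \<and> model_corr K y' z' (tau I X f y p) p') \<or>
          (p \<in> \<gamma>3 ` {a3..b3} \<and> model_corr K x' z' (tau I X f x p) p')) \<and>
         ((q \<in> \<gamma>1 ` {a1..b1} \<and> model_corr K x' y' (tau I X f x q) q') \<or>
          (q \<in> \<gamma>2 ` {a2..b2} \<and> model_corr K y' z' (tau I X f y q) q') \<or>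
          (q \<in> \<gamma>3 ` {a3..b3} \<and> model_corr K x' z' (tau I X f x q) q'))
         \<longrightarrow> rel (tau I X f p q) (tau_model K p' q')))"

definition timelike_curv_below where
  "timelike_curv_below I X f K \<longleftrightarrow> timelike_curv_bound I X f K (\<le>)"

definition timelike_curv_above where
  "timelike_curv_above I X f K \<longleftrightarrow> timelike_curv_bound I X f K (\<ge>)"

end

theory Submission
  imports Defs
begin

text \<open>Consider the triangle with vertical side \<open>[t\<^sub>0 - 2 h, t\<^sub>0 + 2 h] \<times> {x\<^sub>0}\<close> and apex \<open>(t\<^sub>0, x\<^sub>1)\<close>, where
  \<open>\<ell> = d(x\<^sub>0, x\<^sub>1)\<close> tends to \<open>0\<close>. The time separation of points over \<open>u < v\<close> at distance \<open>\<ell>\<close> is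
  \<open>v - u - \<ell>\<^sup>2 / (2 A) + O(\<ell>\<^sup>4)\<close> with \<open>A\<close> the integral of \<open>f\<^sup>-\<^sup>2\<close> over \<open>[u, v]\<close>. In the model, the modified
  distance \<open>md\<close> from the apex solves \<open>y'' - K y = 1\<close> along the long side, so it is determined by its
  values at the end points. At order \<open>\<ell>\<^sup>2\<close> the comparison for the apex and the point at height \<open>t\<^sub>0 - h\<close>
  therefore bounds \<open>\<phi>(x) = sn x / \<integral> f\<^sup>-\<^sup>2\<close> (integral from \<open>t\<^sub>0\<close> to \<open>t\<^sub>0 + x\<close>) at \<open>-h\<close> by its interpolation
  from \<open>-2 h\<close> and \<open>2 h\<close> with solutions of \<open>y'' = K y\<close>. As \<open>h\<close> tends to \<open>0\<close> this gives the sign of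
  \<open>\<phi>'' - K \<phi> = (2/3) f (f'' - K f)\<close> at \<open>0\<close>.\<close>

section \<open>Comparison functions\<close>

text \<open>The function \<open>\<phi>\<close> appears because \<open>md\<close> has derivative
  \<open>sn\<close>: a drop \<open>\<ell>\<^sup>2 / (2 A)\<close> of a time separation near
  \<open>x\<close> lowers \<open>md\<close> by \<open>(sn x / A) * \<ell>\<^sup>2 / 2\<close> to
  leading order. The comparison point cannot be the midpoint of the long side, since it must precede
  the apex chronologically; hence the height \<open>t\<^sub>0 - h\<close> and an asymmetric
  interpolation, with weights 3/4 and 1/4 when K = 0. The distance to the apex tends to 0 with h
  fixed, and only then is the inequality divided by \<open>h\<^sup>3\<close>. The obstacle is that
  both time separations are suprema over curves. Upper bounds come from calibration: a function
  whose derivative along every causal velocity dominates the length element bounds the length by its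
  increment. In the warped product the curves are merely absolutely continuous, so this needs an
  integration argument with one-sided estimates. Lower bounds come from explicit curves. The
  functions \<open>sn\<close> and \<open>cs\<close> solve y'' = K y, so positive K gives hyperbolic
  functions, as is usual along timelike lines.\<close>

definition sn :: "real \<Rightarrow> real \<Rightarrow> real" where
  "sn K x = (if K > 0 then sinh (sqrt K * x) / sqrt K else if K = 0 then x
     else sin (sqrt (- K) * x) / sqrt (- K))"

definition cs :: "real \<Rightarrow> real \<Rightarrow> real" where
  "cs K x = (if K > 0 then cosh (sqrt K * x) else if K = 0 then 1 else cos (sqrt (- K) * x))"

text \<open>The modified distance of comparison geometry: the solution of \<open>y'' - K y = 1\<close> with \<open>y(0) = y'(0) = 0\<close>.\<close>
definition md :: "real \<Rightarrow> real \<Rightarrow> real" where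
  "md K x = (if K = 0 then x\<^sup>2 / 2 else (cs K x - 1) / K)"

lemma DERIV_sn: "(sn K has_real_derivative cs K x) (at x)"
proof -
  consider "K > 0" | "K = 0" | "K < 0" by linarith
  then show ?thesis
  proof cases
    case 1
    then have "sn K = (\<lambda>x. sinh (sqrt K * x) / sqrt K)" by (auto simp: sn_def)
    moreover have "((\<lambda>x. sinh (k * x) / k) has_real_derivative cosh (k * x)) (at x)" if "k \<noteq> 0" for k
      using that by (auto intro!: derivative_eq_intros)
    ultimately show ?thesis using 1 by (simp add: cs_def)
  next
    case 2
    then have "sn K = (\<lambda>x. x)" by (auto simp: sn_def)
    then show ?thesis using 2 by (auto simp: cs_def)
  next
    case 3
    then have "sn K = (\<lambda>x. sin (sqrt (- K) * x) / sqrt (- K))" by (auto simp: sn_def)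
    moreover have "((\<lambda>x. sin (k * x) / k) has_real_derivative cos (k * x)) (at x)" if "k \<noteq> 0" for k
      using that by (auto intro!: derivative_eq_intros)
    ultimately show ?thesis using 3 by (simp add: cs_def)
  qed
qed

lemma DERIV_cs: "(cs K has_real_derivative K * sn K x) (at x)"
proof -
  consider "K > 0" | "K = 0" | "K < 0" by linarith
  then show ?thesis
  proof cases
    case 1
    then have *: "cs K = (\<lambda>x. cosh (sqrt K * x))" by (auto simp: cs_def)
    have "K = sqrt K * sqrt K" using 1 by simp
    then have "K * sn K x = sinh (sqrt K * x) * sqrt K" using 1 by (simp add: sn_def field_simps)
    then show ?thesis unfolding * by (auto intro!: derivative_eq_intros)
  next
    case 2
    then have "cs K = (\<lambda>x. 1)" by (auto simp: cs_def)
    then show ?thesis using 2 by auto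
  next
    case 3
    then have *: "cs K = (\<lambda>x. cos (sqrt (- K) * x))" by (auto simp: cs_def)
    define k where "k = sqrt (- K)"
    have "k > 0" "K = - (k * k)" using 3 by (auto simp: k_def)
    then have "K * sn K x = - (sin (k * x) * k)" using 3 by (simp add: sn_def flip: k_def)
    then show ?thesis unfolding * k_def by (auto intro!: derivative_eq_intros)
  qed
qed

lemma DERIV_md: "(md K has_real_derivative sn K x) (at x)"
proof (cases "K = 0")
  case True
  then have "md K = (\<lambda>x. x\<^sup>2 / 2)" by (auto simp: md_def)
  then show ?thesis using True by (auto simp: sn_def intro!: derivative_eq_intros)
next
  case False
  then have *: "md K = (\<lambda>x. (cs K x - 1) / K)" by (auto simp: md_def)
  show ?thesis unfolding * using False
    by (auto intro!: derivative_eq_intros DERIV_cs)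
qed

lemma sn_0 [simp]: "sn K 0 = 0" and cs_0 [simp]: "cs K 0 = 1" and md_0 [simp]: "md K 0 = 0"
  by (auto simp: sn_def cs_def md_def)

lemma sn_minus: "sn K (- x) = - sn K x"
  by (simp add: sn_def)

lemma sn_pos:
  assumes "x > 0" "K < 0 \<Longrightarrow> sqrt (- K) * x < pi"
  shows "sn K x > 0"
  using assms by (auto simp: sn_def intro!: divide_pos_pos sin_gt_zero)

text \<open>The derivative \<open>sn\<close> is positive up to its first zero, which for K < 0 is pi
  / sqrt (- K). Inequalities between time separations thereby become inequalities between values of
  \<open>md\<close>, where the model is explicit.\<close>

lemma md_strict_mono:
  assumes "0 \<le> x" "x < y" "K < 0 \<Longrightarrow> sqrt (- K) * y < pi"
  shows "md K x < md K y"
proof (rule DERIV_pos_imp_increasing_open[OF \<open>x < y\<close>])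
  fix t assume t: "x < t" "t < y"
  have "sn K t > 0"
  proof (rule sn_pos)
    assume "K < 0"
    have "sqrt (- K) * t \<le> sqrt (- K) * y"
      by (rule mult_left_mono) (use t \<open>K < 0\<close> in auto)
    also have "\<dots> < pi" using assms(3) \<open>K < 0\<close> .
    finally show "sqrt (- K) * t < pi" .
  qed (use assms t in simp)
  then show "\<exists>d. (md K has_real_derivative d) (at t) \<and> d > 0" using DERIV_md by blast
next
  show "continuous_on {x..y} (md K)"
    using DERIV_md by (meson DERIV_continuous_on has_field_derivative_at_within)
qed

section \<open>Cubic expansions and the interpolation defect\<close>

lemma taylor3_limit:
  fixes g0 g1 g2 g3 :: "real \<Rightarrow> real"
  assumes "r > 0"
    and D0: "\<And>t. \<bar>t - c\<bar> < r \<Longrightarrow> (g0 has_real_derivative g1 t) (at t)"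
    and D1: "\<And>t. \<bar>t - c\<bar> < r \<Longrightarrow> (g1 has_real_derivative g2 t) (at t)"
    and D2: "\<And>t. \<bar>t - c\<bar> < r \<Longrightarrow> (g2 has_real_derivative g3 t) (at t)"
    and cont: "isCont g3 c"
  shows "((\<lambda>x. (g0 (c + x) - g0 c - g1 c * x - g2 c / 2 * x\<^sup>2) / x^3) \<longlongrightarrow> g3 c / 6) (at 0)"
proof (rule LIM_I)
  fix e :: real assume "e > 0"
  then obtain d where d: "d > 0" "\<And>t. \<bar>t - c\<bar> < d \<Longrightarrow> \<bar>g3 t - g3 c\<bar> < e"
    using cont unfolding continuous_at_eps_delta dist_real_def by blast
  show "\<exists>s>0. \<forall>x. x \<noteq> 0 \<and> norm (x - 0) < s \<longrightarrow>
      norm ((g0 (c + x) - g0 c - g1 c * x - g2 c / 2 * x\<^sup>2) / x^3 - g3 c / 6) < e"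
  proof (intro exI[of _ "min d r"] conjI allI impI)
    fix x :: real assume x: "x \<noteq> 0 \<and> norm (x - 0) < min d r"
    \<comment> \<open>The four functions form one family indexed by the order of differentiation, as
      \<open>Taylor\<close> expects. The Lagrange remainder is \<open>g3\<close> at a point between
      c and c + x, so continuity of \<open>g3\<close> at c alone gives the limit.\<close>
    define diff where "diff = (\<lambda>n::nat. if n = 0 then g0 else if n = 1 then g1 else if n = 2 then g2 else g3)"
    have "\<exists>t. (if c + x < c then c + x < t \<and> t < c else c < t \<and> t < c + x) \<and>
      g0 (c + x) = (\<Sum>m<3. (diff m c / fact m) * (c + x - c)^m) + (diff 3 t / fact 3) * (c + x - c)^3"
    proof (rule Taylor[where a = "c - \<bar>x\<bar>" and b = "c + \<bar>x\<bar>"])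
      show "\<forall>(m::nat) t. m < 3 \<and> c - \<bar>x\<bar> \<le> t \<and> t \<le> c + \<bar>x\<bar> \<longrightarrow> (diff m has_real_derivative diff (Suc m) t) (at t)"
      proof (intro allI impI)
        fix m :: nat and t assume mt: "m < 3 \<and> c - \<bar>x\<bar> \<le> t \<and> t \<le> c + \<bar>x\<bar>"
        then have "\<bar>t - c\<bar> < r" using x by auto
        moreover have "m = 0 \<or> m = 1 \<or> m = 2" using mt by auto
        ultimately show "(diff m has_real_derivative diff (Suc m) t) (at t)"
          using D0 D1 D2 by (auto simp: diff_def)
      qed
    qed (use x in \<open>auto simp: diff_def\<close>)
    then obtain t where t: "(if c + x < c then c + x < t \<and> t < c else c < t \<and> t < c + x)"
      "g0 (c + x) = g0 c + g1 c * x + g2 c / 2 * x\<^sup>2 + g3 t / 6 * x^3"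
      by (auto simp: diff_def eval_nat_numeral)
    have "(g0 (c + x) - g0 c - g1 c * x - g2 c / 2 * x\<^sup>2) / x^3 = g3 t / 6"
      unfolding t(2) using x by simp
    then have "(g0 (c + x) - g0 c - g1 c * x - g2 c / 2 * x\<^sup>2) / x^3 - g3 c / 6 = (g3 t - g3 c) / 6"
      by (simp only: diff_divide_distrib)
    moreover have "\<bar>t - c\<bar> < d" using t(1) x by (auto split: if_splits)
    then have "\<bar>g3 t - g3 c\<bar> < e" by (rule d)
    ultimately show "norm ((g0 (c + x) - g0 c - g1 c * x - g2 c / 2 * x\<^sup>2) / x^3 - g3 c / 6) < e"
      by (simp only:) simp
  qed (use d \<open>r > 0\<close> in auto)
qed

text \<open>This cubic coefficient is the place where K enters the limit of the interpolation
  defect.\<close>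

lemma sn_cubic: "((\<lambda>x. (sn K x - x) / x^3) \<longlongrightarrow> K / 6) (at 0)"
proof -
  have "((\<lambda>x. (sn K (0 + x) - sn K 0 - cs K 0 * x - (K * sn K 0) / 2 * x\<^sup>2) / x^3) \<longlongrightarrow> (K * cs K 0) / 6) (at 0)"
  proof (rule taylor3_limit[where r = 1 and ?g1.0 = "cs K" and ?g2.0 = "\<lambda>t. K * sn K t" and ?g3.0 = "\<lambda>t. K * cs K t"])
    show "isCont (\<lambda>t. K * cs K t) 0" using DERIV_isCont[OF DERIV_cs] by (intro continuous_intros)
  qed (auto intro!: DERIV_sn DERIV_cs derivative_eq_intros)
  then show ?thesis by simp
qed

text \<open>Up to the factor \<open>h\<^sup>3\<close>, the expression is \<open>sn (4 h)\<close> times the interpolation defect of \<open>\<phi>\<close>; the \<open>\<phi>\<close> of the proof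
  extends \<open>sn x / (H (t\<^sub>0 + x) - H t\<^sub>0)\<close> smoothly to \<open>0\<close>.\<close>
lemma interpolation_defect_limit:
  fixes H f f1 f2 :: "real \<Rightarrow> real"
  assumes "r > 0"
    and H: "\<And>t. \<bar>t - t0\<bar> < r \<Longrightarrow> (H has_real_derivative 1 / (f t)\<^sup>2) (at t)"
    and f: "\<And>t. \<bar>t - t0\<bar> < r \<Longrightarrow> (f has_real_derivative f1 t) (at t)"
    and f1: "\<And>t. \<bar>t - t0\<bar> < r \<Longrightarrow> (f1 has_real_derivative f2 t) (at t)"
    and f2: "isCont f2 t0" and fpos: "\<And>t. \<bar>t - t0\<bar> < r \<Longrightarrow> f t > 0"
  shows "((\<lambda>h. (sn K (4*h) * sn K h / (H t0 - H (t0 - h)) - sn K (3*h) * sn K (2*h) / (H t0 - H (t0 - 2*h))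
      - sn K h * sn K (2*h) / (H (t0 + 2*h) - H t0)) / h^3) \<longlongrightarrow> - 4 * f t0 * (f2 t0 - K * f t0)) (at_right 0)"
proof -
  \<comment> \<open>The Taylor coefficients H', H''/2 and H'''/6 at \<open>t0\<close>, computed from
    H' = 1 / f^2.\<close>
  define u where "u = 1 / (f t0)\<^sup>2"
  define u1 where "u1 = - (f1 t0) / (f t0)^3"
  define u2 where "u2 = - f2 t0 / (3 * (f t0)^3) + (f1 t0)\<^sup>2 / (f t0)^4"
  have ft: "f t0 > 0" using fpos[of t0] \<open>r > 0\<close> by simp
  have u0: "u > 0" using ft by (simp add: u_def)
  define R where "R = (\<lambda>x. (H (t0 + x) - H t0 - u * x - u1 * x\<^sup>2) / x^3)"
  have R: "(R \<longlongrightarrow> u2) (at 0)"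
  proof -
    have "((\<lambda>x. (H (t0 + x) - H t0 - 1 / (f t0)\<^sup>2 * x - (- 2 * f1 t0 / (f t0)^3) / 2 * x\<^sup>2) / x^3) \<longlongrightarrow>
        (- 2 * f2 t0 / (f t0)^3 + 6 * (f1 t0)\<^sup>2 / (f t0)^4) / 6) (at 0)"
    proof (rule taylor3_limit[where r = r and ?g1.0 = "\<lambda>t. 1 / (f t)\<^sup>2" and ?g2.0 = "\<lambda>t. - 2 * f1 t / (f t)^3"
          and ?g3.0 = "\<lambda>t. - 2 * f2 t / (f t)^3 + 6 * (f1 t)\<^sup>2 / (f t)^4"])
      fix t assume t: "\<bar>t - t0\<bar> < r"
      have "f t \<noteq> 0" using fpos[OF t] by simp
      then show "((\<lambda>t. 1 / (f t)\<^sup>2) has_real_derivative - 2 * f1 t / (f t)^3) (at t)"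
        by (auto intro!: derivative_eq_intros f[OF t] simp: field_simps eval_nat_numeral)
      show "((\<lambda>t. - 2 * f1 t / (f t)^3) has_real_derivative - 2 * f2 t / (f t)^3 + 6 * (f1 t)\<^sup>2 / (f t)^4) (at t)"
        using \<open>f t \<noteq> 0\<close>
        by (auto intro!: derivative_eq_intros f[OF t] f1[OF t] simp: field_simps eval_nat_numeral)
    next
      have "isCont f t0" "isCont f1 t0" using f[of t0] f1[of t0] \<open>r > 0\<close> by (auto intro: DERIV_isCont)
      then show "isCont (\<lambda>t. - 2 * f2 t / (f t)^3 + 6 * (f1 t)\<^sup>2 / (f t)^4) t0"
        using f2 ft by (intro continuous_intros) auto
    qed (use H \<open>r > 0\<close> in auto)
    moreover have "(- 2 * f1 t0 / (f t0)^3) / 2 = u1" by (simp add: u1_def)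
    moreover have "(- 2 * f2 t0 / (f t0)^3 + 6 * (f1 t0)\<^sup>2 / (f t0)^4) / 6 = u2"
      by (simp add: u2_def add_divide_distrib)
    ultimately show ?thesis unfolding R_def u_def by (simp only:)
  qed
  define \<kappa> where "\<kappa> = (\<lambda>x. (sn K x - x) / x^3)"
  have \<kappa>: "(\<kappa> \<longlongrightarrow> K / 6) (at 0)" unfolding \<kappa>_def by (rule sn_cubic)
  define \<phi> where "\<phi> = (\<lambda>x. (1 + x\<^sup>2 * \<kappa> x) / (u + u1 * x + R x * x\<^sup>2))"
  have den: "((\<lambda>x. u + u1 * x + R x * x\<^sup>2) \<longlongrightarrow> u) (at 0)"
    by (auto intro!: tendsto_eq_intros R)
  have "((\<lambda>x. 1 + x\<^sup>2 * \<kappa> x) \<longlongrightarrow> 1) (at 0)"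
    by (auto intro!: tendsto_eq_intros \<kappa>)
  then have \<phi>lim: "(\<phi> \<longlongrightarrow> 1 / u) (at 0)"
    unfolding \<phi>_def using den u0 by (intro tendsto_divide) auto
  \<comment> \<open>The Taylor coefficients of \<open>\<phi>\<close>, found by matching powers of x
    in \<open>\<phi>\<close> times its denominator = 1 + x^2 \<open>\<kappa> x\<close>.\<close>
  define p0 where "p0 = 1 / u"
  define p1 where "p1 = - u1 / u\<^sup>2"
  define p2 where "p2 = (K / 6 - u2 / u + u1\<^sup>2 / u\<^sup>2) / u"
  define \<rho> where "\<rho> = (\<lambda>x. (\<phi> x - p0 - p1 * x) / x\<^sup>2)"
  have \<rho>: "(\<rho> \<longlongrightarrow> p2) (at 0)"
  proof -
    have ev: "eventually (\<lambda>x. u + u1 * x + R x * x\<^sup>2 > 0) (at 0)"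
      using den u0 by (rule order_tendstoD)
    have l: "((\<lambda>x. (\<kappa> x - p0 * R x - p1 * u1 - p1 * R x * x) / (u + u1 * x + R x * x\<^sup>2)) \<longlongrightarrow>
        (K / 6 - p0 * u2 - p1 * u1 - p1 * u2 * 0) / u) (at 0)"
      using u0 by (intro tendsto_intros \<kappa> R den) auto
    have "(K / 6 - p0 * u2 - p1 * u1 - p1 * u2 * 0) / u = p2"
      by (simp add: p0_def p1_def p2_def power2_eq_square)
    moreover have "eventually (\<lambda>x. (\<kappa> x - p0 * R x - p1 * u1 - p1 * R x * x) / (u + u1 * x + R x * x\<^sup>2) = \<rho> x) (at 0)"
      using ev eventually_neq_at_within[of 0]
    proof eventually_elim
      case (elim x)
      define q where "q = u + u1 * x + R x * x\<^sup>2"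
      have q: "q > 0" using elim by (simp add: q_def)
      have a: "p0 * u = 1" "p0 * u1 + p1 * u = 0" using u0 by (simp_all add: p0_def p1_def power2_eq_square)
      have "(p0 + p1 * x) * q = p0 * u + (p0 * u1 + p1 * u) * x + (p0 * R x + p1 * u1 + p1 * R x * x) * x\<^sup>2"
        by (simp add: q_def algebra_simps power2_eq_square)
      then have "(p0 + p1 * x) * q = 1 + (p0 * R x + p1 * u1 + p1 * R x * x) * x\<^sup>2" using a by simp
      then have "1 + x\<^sup>2 * \<kappa> x - (p0 + p1 * x) * q = (\<kappa> x - p0 * R x - p1 * u1 - p1 * R x * x) * x\<^sup>2"
        by (simp add: algebra_simps)
      moreover have "\<phi> x - p0 - p1 * x = (1 + x\<^sup>2 * \<kappa> x - (p0 + p1 * x) * q) / q"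
        using q by (simp add: \<phi>_def q_def[symmetric] diff_divide_distrib)
      ultimately show ?case using elim by (simp add: \<rho>_def q_def[symmetric])
    qed
    ultimately show ?thesis using Lim_transform_eventually[OF l] by simp
  qed
  have scale: "((\<lambda>h. g (c * h)) \<longlongrightarrow> L) (at_right 0)" if "(g \<longlongrightarrow> L) (at 0)" "c \<noteq> 0" for g :: "real \<Rightarrow> real" and c L
  proof (rule tendsto_compose_at[where f = "\<lambda>h. c * h" and y = 0, unfolded o_def])
    show "((\<lambda>h. c * h) \<longlongrightarrow> 0) (at_right 0)"
      using tendsto_mult[OF tendsto_const[of c] tendsto_ident_at[of 0 "{0<..}"]] by simp
    show "eventually (\<lambda>h. c * h = 0 \<longrightarrow> g 0 = L) (at_right 0)"
      using eventually_at_right_less[of 0] by eventually_elim (use that in auto)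
  qed (rule that)
  \<comment> \<open>The numbers 64, 27 and 1 are the cubes from sn (4h), sn (3h) and sn h; 4, 12 and
    4 are the linear weights 4, 3, 1 times the squares of the nodes -1, -2, 2.\<close>
  have lim: "((\<lambda>h. 4 * \<rho> ((-1) * h) - 12 * \<rho> ((-2) * h) - 4 * \<rho> (2 * h)
      + 64 * \<kappa> (4 * h) * \<phi> ((-1) * h) - 27 * \<kappa> (3 * h) * \<phi> ((-2) * h) - \<kappa> (1 * h) * \<phi> (2 * h)) \<longlongrightarrow>
      4 * p2 - 12 * p2 - 4 * p2 + 64 * (K / 6) * (1 / u) - 27 * (K / 6) * (1 / u) - (K / 6) * (1 / u)) (at_right 0)"
    by (intro tendsto_intros scale \<rho> \<kappa> \<phi>lim) auto
  have "4 * p2 - 12 * p2 - 4 * p2 + 64 * (K / 6) * (1 / u) - 27 * (K / 6) * (1 / u) - (K / 6) * (1 / u)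
      = - 4 * f t0 * (f2 t0 - K * f t0)"
  proof -
    have iu: "1 / u = (f t0)\<^sup>2" by (simp add: u_def)
    \<comment> \<open>The square of f' contributed by \<open>u2\<close> cancels against the one from
      \<open>u1\<close>, so only f'' and K survive.\<close>
    have "p2 = (K / 6 - u2 * (f t0)\<^sup>2 + (u1 * (f t0)\<^sup>2)\<^sup>2) * (f t0)\<^sup>2"
      by (simp add: p2_def u_def power_divide power_mult_distrib)
    also have "u2 * (f t0)\<^sup>2 = - f2 t0 / (3 * f t0) + (f1 t0)\<^sup>2 / (f t0)\<^sup>2"
      using ft by (simp add: u2_def field_simps eval_nat_numeral)
    also have "u1 * (f t0)\<^sup>2 = - f1 t0 / f t0"
      using ft by (simp add: u1_def field_simps eval_nat_numeral)
    finally have "p2 = (K / 6 + f2 t0 / (3 * f t0)) * (f t0)\<^sup>2"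
      by (simp add: power_divide)
    then have p2: "p2 = K / 6 * (f t0)\<^sup>2 + f2 t0 * f t0 / 3"
      using ft by (simp add: distrib_right power2_eq_square)
    show ?thesis unfolding iu p2 by (simp add: algebra_simps power2_eq_square)
  qed
  moreover have "eventually (\<lambda>h. 4 * \<rho> ((-1) * h) - 12 * \<rho> ((-2) * h) - 4 * \<rho> (2 * h)
      + 64 * \<kappa> (4 * h) * \<phi> ((-1) * h) - 27 * \<kappa> (3 * h) * \<phi> ((-2) * h) - \<kappa> (1 * h) * \<phi> (2 * h) =
      (sn K (4*h) * sn K h / (H t0 - H (t0 - h)) - sn K (3*h) * sn K (2*h) / (H t0 - H (t0 - 2*h))
      - sn K h * sn K (2*h) / (H (t0 + 2*h) - H t0)) / h^3) (at_right 0)"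
    using eventually_at_right_less[of 0]
  proof eventually_elim
    case (elim h)
    have snx: "sn K x = x * (1 + x\<^sup>2 * \<kappa> x)" if "x \<noteq> 0" for x
    proof -
      have "x^3 * \<kappa> x = sn K x - x" using that by (simp add: \<kappa>_def)
      then show ?thesis by (simp add: algebra_simps eval_nat_numeral)
    qed
    have Hx: "H (t0 + x) - H t0 = x * (u + u1 * x + R x * x\<^sup>2)" if "x \<noteq> 0" for x
    proof -
      have "R x * x^3 = H (t0 + x) - H t0 - u * x - u1 * x\<^sup>2" using that by (simp add: R_def)
      then show ?thesis by (simp add: algebra_simps eval_nat_numeral)
    qed
    have \<phi>x: "sn K x / (H (t0 + x) - H t0) = \<phi> x" if "x \<noteq> 0" for x
      unfolding snx[OF that] Hx[OF that] \<phi>_def using that by simp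
    have \<phi>\<rho>: "\<phi> x = p0 + p1 * x + \<rho> x * x\<^sup>2" if "x \<noteq> 0" for x
      using that by (simp add: \<rho>_def)
    have "sn K (4*h) * sn K h / (H t0 - H (t0 - h)) = sn K (4*h) * \<phi> ((-1) * h)"
      using \<phi>x[of "- h"] elim sn_minus[of K h] by (simp add: minus_divide_left[symmetric] divide_minus_right minus_diff_eq[of "H t0", symmetric]
        times_divide_eq_right[symmetric] del: minus_diff_eq times_divide_eq_right)
    moreover have "sn K (3*h) * sn K (2*h) / (H t0 - H (t0 - 2*h)) = sn K (3*h) * \<phi> ((-2) * h)"
      using \<phi>x[of "- (2*h)"] elim sn_minus[of K "2*h"] by (simp add: minus_divide_left[symmetric] divide_minus_right minus_diff_eq[of "H t0", symmetric]
        times_divide_eq_right[symmetric] del: minus_diff_eq times_divide_eq_right)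
    moreover have "sn K h * sn K (2*h) / (H (t0 + 2*h) - H t0) = sn K h * \<phi> (2 * h)"
      using \<phi>x[of "2*h"] elim by (simp add: times_divide_eq_right[symmetric] del: times_divide_eq_right)
    ultimately have "(sn K (4*h) * sn K h / (H t0 - H (t0 - h)) - sn K (3*h) * sn K (2*h) / (H t0 - H (t0 - 2*h))
      - sn K h * sn K (2*h) / (H (t0 + 2*h) - H t0)) =
      sn K (4*h) * \<phi> ((-1) * h) - sn K (3*h) * \<phi> ((-2) * h) - sn K h * \<phi> (2 * h)" by simp
    also have "\<dots> = (4*h) * \<phi> ((-1) * h) - (3*h) * \<phi> ((-2) * h) - h * \<phi> (2 * h) +
        h^3 * (64 * \<kappa> (4 * h) * \<phi> ((-1) * h) - 27 * \<kappa> (3 * h) * \<phi> ((-2) * h) - \<kappa> (1 * h) * \<phi> (2 * h))"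
      using elim snx[of "4*h"] snx[of "3*h"] snx[of h] by (simp add: algebra_simps eval_nat_numeral)
    \<comment> \<open>The weights 4, -3, -1 at the nodes -1, -2, 2 annihilate constants (4 - 3 - 1 =
      0) and linear functions (-4 + 6 - 2 = 0), so only the second-order remainders
      \<open>\<rho>\<close> are left.\<close>
    also have "(4*h) * \<phi> ((-1) * h) - (3*h) * \<phi> ((-2) * h) - h * \<phi> (2 * h) =
        h^3 * (4 * \<rho> ((-1) * h) - 12 * \<rho> ((-2) * h) - 4 * \<rho> (2 * h))"
    proof -
      have e: "\<phi> ((-1) * h) = p0 + p1 * ((-1) * h) + \<rho> ((-1) * h) * ((-1) * h)\<^sup>2"
        "\<phi> ((-2) * h) = p0 + p1 * ((-2) * h) + \<rho> ((-2) * h) * ((-2) * h)\<^sup>2"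
        "\<phi> (2 * h) = p0 + p1 * (2 * h) + \<rho> (2 * h) * (2 * h)\<^sup>2"
        by (rule \<phi>\<rho>, use elim in simp)+
      show ?thesis unfolding e by (simp add: algebra_simps eval_nat_numeral)
    qed
    finally show ?case using elim by (simp add: add_divide_distrib diff_divide_distrib)
  qed
  ultimately show ?thesis using Lim_transform_eventually[OF lim] by simp
qed

section \<open>Absolutely continuous curves\<close>

lemma sum_lengths_le_measure:
  fixes l r :: "'i \<Rightarrow> real"
  assumes "finite J" and lr: "\<And>i. i \<in> J \<Longrightarrow> l i < r i"
    and dis: "pairwise (\<lambda>i j. disjnt {l i<..<r i} {l j<..<r j}) J"
    and sub: "\<And>i. i \<in> J \<Longrightarrow> {l i<..<r i} \<subseteq> T" and T: "T \<in> lmeasurable"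
  shows "(\<Sum>i\<in>J. r i - l i) \<le> measure lebesgue T"
proof -
  have "(\<Sum>i\<in>J. r i - l i) = (\<Sum>i\<in>J. measure lebesgue {l i<..<r i})"
    using lr by (intro sum.cong) (auto simp: less_imp_le)
  also have "\<dots> = measure lebesgue (\<Union>i\<in>J. {l i<..<r i})"
    using assms by (intro measure_UNION'[symmetric]) auto
  also have "\<dots> \<le> measure lebesgue T"
    using sub T \<open>finite J\<close> by (intro measure_mono_fmeasurable) auto
  finally show ?thesis .
qed

lemma tagged_division_real_interval:
  assumes "p tagged_division_of {a..b::real}" "(x, K) \<in> p"
  shows "K = {Inf K..Sup K}" "a \<le> Inf K" "Inf K \<le> x" "x \<le> Sup K" "Sup K \<le> b"
proof -
  obtain c d where K: "K = {c..d}" "x \<in> K" "K \<subseteq> {a..b}"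
    using tagged_division_ofD[OF assms(1)] assms(2) by (metis cbox_interval)
  then show "K = {Inf K..Sup K}" "a \<le> Inf K" "Inf K \<le> x" "x \<le> Sup K" "Sup K \<le> b"
    by auto
qed

text \<open>The gauge is chosen inside a small open neighbourhood of the exceptional null set, so that the
  tags in that set contribute little by absolute continuity; at the other tags the straddle
  inequality applies.\<close>
lemma abs_cont_increment_ge_integral:
  fixes g w :: "real \<Rightarrow> real"
  assumes "a < b" and ac: "abs_cont_wrt dist a b g" and null: "negligible N"
    and straddle: "\<And>t e. t \<in> {a..b} - N \<Longrightarrow> e > 0 \<Longrightarrow>
      \<exists>d>0. \<forall>l r. a \<le> l \<and> l \<le> t \<and> t \<le> r \<and> r \<le> b \<and> r - l < d \<longrightarrow> g r - g l \<ge> (w t - e) * (r - l)"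
    and int: "w integrable_on {a..b}"
  shows "integral {a..b} w \<le> g b - g a"
proof (rule field_le_epsilon)
  fix e :: real assume "e > 0"
  \<comment> \<open>The errors are e1 for the Riemann sum, e1 for the intervals tagged in N and e1 *
    (b - a) for the straddle inequalities; together they stay below e.\<close>
  define e1 where "e1 = e / (3 + (b - a))"
  have e1: "e1 > 0" "e1 * (3 + (b - a)) = e" using \<open>e > 0\<close> \<open>a < b\<close> by (auto simp: e1_def)
  \<comment> \<open>With value 0 on N, tags in N contribute nothing to the Riemann sum, and only the
    increment of g over their intervals has to be controlled.\<close>
  define w' where "w' = (\<lambda>t. if t \<in> N then 0 else w t)"
  have w': "(w' has_integral integral {a..b} w) {a..b}"
    by (rule has_integral_spike[OF null _ integrable_integral[OF int]]) (auto simp: w'_def)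
  obtain G where G: "gauge G" "\<And>p. p tagged_division_of {a..b} \<Longrightarrow> G fine p \<Longrightarrow>
      norm (sum (\<lambda>(x,k). measure lborel k *\<^sub>R w' x) p - integral {a..b} w) < e1"
    using w'[unfolded has_integral_real] e1 by meson
  obtain d0 where d0: "d0 > 0" and ac0: "\<forall>(n::nat) l r. (\<forall>i<n. a \<le> l i \<and> l i \<le> r i \<and> r i \<le> b) \<and>
        (\<forall>i<n. \<forall>j<n. i \<noteq> j \<longrightarrow> r i \<le> l j \<or> r j \<le> l i) \<and>
        (\<Sum>i<n. r i - l i) < d0 \<longrightarrow> (\<Sum>i<n. dist (g (l i)) (g (r i))) < e1"
    using ac[unfolded abs_cont_wrt_def, rule_format, OF e1(1)] by blast
  have Nn: "N \<in> null_sets lebesgue" using null by (simp add: negligible_iff_null_sets)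
  then obtain T where T: "open T" "N \<subseteq> T" "T - N \<in> lmeasurable" "emeasure lebesgue (T - N) < ennreal d0"
    using sets_lebesgue_outer_open[of N d0] d0 by blast
  have Tm: "T \<in> lmeasurable"
  proof -
    have "T = (T - N) \<union> N" using T by auto
    moreover have "N \<in> lmeasurable" using Nn by (simp add: null negligible_imp_measurable)
    ultimately show ?thesis using T(3) by (metis fmeasurable.Un)
  qed
  have Tmeas: "measure lebesgue T < d0"
  proof -
    have "measure lebesgue T = measure lebesgue (T - N)"
      using Tm Nn by (simp add: fmeasurableD measure_Diff_null_set)
    then show ?thesis using T(3,4) d0
      by (simp add: emeasure_eq_measure2 ennreal_less_iff)
  qed
  have "\<forall>t. \<exists>d>0. t \<in> {a..b} - N \<longrightarrow> (\<forall>l r. a \<le> l \<and> l \<le> t \<and> t \<le> r \<and> r \<le> b \<and> r - l < d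
      \<longrightarrow> g r - g l \<ge> (w t - e1) * (r - l))"
    using straddle e1(1) by (metis zero_less_one)
  then obtain D where D: "\<And>t. D t > 0" "\<And>t l r. t \<in> {a..b} - N \<Longrightarrow> a \<le> l \<Longrightarrow> l \<le> t \<Longrightarrow> t \<le> r \<Longrightarrow> r \<le> b
      \<Longrightarrow> r - l < D t \<Longrightarrow> g r - g l \<ge> (w t - e1) * (r - l)"
    by metis
  define G' where "G' = (\<lambda>t. G t \<inter> (if t \<in> N then T else ball t (D t / 2)))"
  have "gauge G'" using G(1) T D by (auto simp: gauge_def G'_def)
  then obtain p where p: "p tagged_division_of {a..b}" "G' fine p"
    using fine_division_exists_real by blast
  have "G fine p" using p(2) by (auto simp: fine_def G'_def)
  have fin: "finite p" using p(1) by blast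
  note iv = tagged_division_real_interval[OF p(1)]
  have cont: "measure lborel K = Sup K - Inf K" if "(x,K) \<in> p" for x K
    proof -
    have "Inf K \<le> Sup K" using iv[OF that] by linarith
    then have "measure lborel {Inf K..Sup K} = Sup K - Inf K" by (rule measure_lborel_Icc)
    then show ?thesis using iv(1)[OF that] by metis
  qed
  \<comment> \<open>Degenerate intervals are left out: their increments vanish, and disjoint
    interiors order two intervals only when both are nondegenerate.\<close>
  define q where "q = {(x,K) \<in> p. x \<in> N \<and> Inf K < Sup K}"
  have finq: "finite q" using fin by (auto simp: q_def intro: finite_subset)
  have disj: "Sup K \<le> Inf K' \<or> Sup K' \<le> Inf K"
    if "(x,K) \<in> q" "(x',K') \<in> q" "(x,K) \<noteq> (x',K')" for x K x' K'
  proof -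
    have *: "interior K \<inter> interior K' = {}"
      using tagged_division_ofD(5)[OF p(1), of x K x' K'] that by (auto simp: q_def)
    have "interior K = {Inf K<..<Sup K}" "interior K' = {Inf K'<..<Sup K'}"
      using iv(1)[of x K] iv(1)[of x' K'] that interior_atLeastAtMost_real unfolding q_def
      by (metis (no_types, lifting) CollectD case_prodD)+
    with * have e: "{max (Inf K) (Inf K')<..<min (Sup K) (Sup K')} = {}" by auto
    have "\<not> max (Inf K) (Inf K') < min (Sup K) (Sup K')"
      using e dense by (metis empty_iff greaterThanLessThan_iff)
    then show ?thesis using that by (auto simp: q_def)
  qed
  have sumq: "(\<Sum>(x,K)\<in>q. Sup K - Inf K) < d0"
  proof -
    have "(\<Sum>xK\<in>q. Sup (snd xK) - Inf (snd xK)) \<le> measure lebesgue T"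
    proof (rule sum_lengths_le_measure[OF finq _ _ _ Tm])
      show "pairwise (\<lambda>i j. disjnt {Inf (snd i)<..<Sup (snd i)} {Inf (snd j)<..<Sup (snd j)}) q"
        unfolding pairwise_def using disj by (fastforce simp: disjnt_def)
      show "{Inf (snd i)<..<Sup (snd i)} \<subseteq> T" if "i \<in> q" for i
      proof -
        obtain x K where i: "i = (x,K)" by force
        then have "K \<subseteq> G' x" "x \<in> N" using that p(2) by (auto simp: q_def fine_def)
        then have "K \<subseteq> T" by (auto simp: G'_def)
        moreover have "K = {Inf K..Sup K}" using iv(1)[of x K] that i by (auto simp: q_def)
        ultimately show ?thesis using i
          by (metis greaterThanLessThan_subseteq_atLeastAtMost_iff order.refl order.trans snd_conv)
      qed
    qed (auto simp: q_def)
    then show ?thesis using Tmeas by (simp add: case_prod_unfold)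
  qed
  have smallq: "(\<Sum>(x,K)\<in>q. dist (g (Inf K)) (g (Sup K))) < e1"
  proof -
    \<comment> \<open>Absolute continuity is stated for families indexed by an initial segment of
      the naturals, so \<open>q\<close> is enumerated.\<close>
    obtain h where h: "bij_betw h {..<card q} q"
      using ex_bij_betw_nat_finite[OF finq] by (auto simp: atLeast0LessThan)
    have hq: "h i \<in> q" if "i < card q" for i using h that by (auto simp: bij_betw_def)
    have "(\<Sum>i<card q. dist (g (Inf (snd (h i)))) (g (Sup (snd (h i))))) < e1"
    proof (rule ac0[THEN spec[of _ "card q"], THEN spec[of _ "\<lambda>i. Inf (snd (h i))"],
          THEN spec[of _ "\<lambda>i. Sup (snd (h i))"], THEN mp], intro conjI)
      show "\<forall>i<card q. a \<le> Inf (snd (h i)) \<and> Inf (snd (h i)) \<le> Sup (snd (h i)) \<and> Sup (snd (h i)) \<le> b"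
      proof (intro allI impI)
        fix i assume "i < card q"
        then have "h i \<in> q" by (rule hq)
        then have "(fst (h i), snd (h i)) \<in> p" by (auto simp: q_def)
        from iv[OF this] show "a \<le> Inf (snd (h i)) \<and> Inf (snd (h i)) \<le> Sup (snd (h i)) \<and> Sup (snd (h i)) \<le> b"
          by linarith
      qed
      show "\<forall>i<card q. \<forall>j<card q. i \<noteq> j \<longrightarrow>
          Sup (snd (h i)) \<le> Inf (snd (h j)) \<or> Sup (snd (h j)) \<le> Inf (snd (h i))"
      proof (intro allI impI)
        fix i j assume ij: "i < card q" "j < card q" "i \<noteq> j"
        then have "h i \<noteq> h j" using h by (auto simp: bij_betw_def inj_on_def)
        then show "Sup (snd (h i)) \<le> Inf (snd (h j)) \<or> Sup (snd (h j)) \<le> Inf (snd (h i))"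
          using disj[of "fst (h i)" "snd (h i)" "fst (h j)" "snd (h j)"] hq ij by auto
      qed
      have "(\<Sum>i<card q. Sup (snd (h i)) - Inf (snd (h i))) = (\<Sum>xK\<in>q. Sup (snd xK) - Inf (snd xK))"
        by (rule sum.reindex_bij_betw[OF h, of "\<lambda>xK. Sup (snd xK) - Inf (snd xK)"])
      then show "(\<Sum>i<card q. Sup (snd (h i)) - Inf (snd (h i))) < d0"
        using sumq by (simp add: case_prod_unfold)
    qed
    also have "(\<Sum>i<card q. dist (g (Inf (snd (h i)))) (g (Sup (snd (h i))))) =
        (\<Sum>xK\<in>q. dist (g (Inf (snd xK))) (g (Sup (snd xK))))"
      by (rule sum.reindex_bij_betw[OF h, of "\<lambda>xK. dist (g (Inf (snd xK))) (g (Sup (snd xK)))"])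
    finally show ?thesis by (simp add: case_prod_unfold)
  qed
  have incr: "g (Sup K) - g (Inf K) \<ge> measure lborel K *\<^sub>R w' x - e1 * measure lborel K
      - (if (x,K) \<in> q then dist (g (Inf K)) (g (Sup K)) else 0)" if xK: "(x,K) \<in> p" for x K
  proof (cases "x \<in> N")
    case True
    have le: "Inf K \<le> Sup K" using iv[OF xK] by linarith
    have "e1 * (Sup K - Inf K) \<ge> 0" using le e1 by simp
    then show ?thesis
      using le cont[OF xK] xK True
      by (cases "Inf K = Sup K") (auto simp: w'_def q_def dist_real_def)
  next
    case False
    have "K \<subseteq> ball x (D x / 2)" using xK p(2) False by (force simp: fine_def G'_def)
    moreover have "Inf K \<in> K" "Sup K \<in> K" using iv[OF xK] by (metis atLeastAtMost_iff order.refl order.trans)+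
    ultimately have "Inf K \<in> ball x (D x / 2)" "Sup K \<in> ball x (D x / 2)" by blast+
    then have "\<bar>x - Inf K\<bar> * 2 < D x" "\<bar>x - Sup K\<bar> * 2 < D x" by (auto simp: dist_real_def)
    then have "(x - Inf K) * 2 < D x" "(Sup K - x) * 2 < D x" using iv[OF xK] by auto
    then have "Sup K - Inf K < D x" by argo
    then have "g (Sup K) - g (Inf K) \<ge> (w x - e1) * (Sup K - Inf K)"
      using iv[OF xK] False by (intro D) auto
    then show ?thesis unfolding cont[OF xK, symmetric] using False by (auto simp: w'_def q_def algebra_simps)
  qed
  have sumc: "(\<Sum>(x,K)\<in>p. measure lborel K) = b - a"
    using additive_content_tagged_division[of p a b] p(1) \<open>a < b\<close> by (simp add: case_prod_unfold)
  have "g b - g a = (\<Sum>(x,K)\<in>p. g (Sup K) - g (Inf K))"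
    using additive_tagged_division_1[of a b p g] p(1) \<open>a < b\<close> by simp
  also have "\<dots> \<ge> (\<Sum>(x,K)\<in>p. measure lborel K *\<^sub>R w' x - e1 * measure lborel K
      - (if (x,K) \<in> q then dist (g (Inf K)) (g (Sup K)) else 0))"
    using incr by (intro sum_mono) auto
  also have "(\<Sum>(x,K)\<in>p. measure lborel K *\<^sub>R w' x - e1 * measure lborel K
      - (if (x,K) \<in> q then dist (g (Inf K)) (g (Sup K)) else 0)) =
      (\<Sum>(x,K)\<in>p. measure lborel K *\<^sub>R w' x) - e1 * (\<Sum>(x,K)\<in>p. measure lborel K)
      - (\<Sum>xK\<in>p. if xK \<in> q then dist (g (Inf (snd xK))) (g (Sup (snd xK))) else 0)"
    by (simp add: case_prod_unfold sum_subtractf sum_distrib_left)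
  also have "(\<Sum>xK\<in>p. if xK \<in> q then dist (g (Inf (snd xK))) (g (Sup (snd xK))) else 0) =
      (\<Sum>(x,K)\<in>q. dist (g (Inf K)) (g (Sup K)))"
    using fin by (subst sum.If_cases) (auto simp: case_prod_unfold q_def intro!: sum.cong)
  finally have "g b - g a \<ge> (\<Sum>(x,K)\<in>p. measure lborel K *\<^sub>R w' x) - e1 * (b - a)
      - (\<Sum>(x,K)\<in>q. dist (g (Inf K)) (g (Sup K)))"
    unfolding sumc .
  then have "g b - g a \<ge> (\<Sum>(x,K)\<in>p. measure lborel K *\<^sub>R w' x) - e1 * (b - a) - e1"
    using smallq by linarith
  moreover have "norm ((\<Sum>(x,K)\<in>p. measure lborel K *\<^sub>R w' x) - integral {a..b} w) < e1"
    by (rule G(2)[OF p(1) \<open>G fine p\<close>])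
  then have "integral {a..b} w \<le> (\<Sum>(x,K)\<in>p. measure lborel K *\<^sub>R w' x) + e1" by (simp add: abs_real_def split: if_splits)
  ultimately show "integral {a..b} w \<le> g b - g a + e"
    using e1 by (simp add: algebra_simps)
qed

section \<open>Time separation in the warped product\<close>

text \<open>Both endpoints are compared with t; since t lies between them, the two errors add up to
  a multiple of r - l.\<close>

lemma derivative_straddle:
  fixes g :: "real \<Rightarrow> real"
  assumes "(g has_real_derivative D) (at t)" "e > 0"
  shows "\<exists>d>0. \<forall>l r. l \<le> t \<and> t \<le> r \<and> r - l < d \<longrightarrow> \<bar>g r - g l - D * (r - l)\<bar> \<le> e * (r - l)"
proof -
  obtain d where d: "d > 0" "\<And>y. \<bar>y - t\<bar> < d \<Longrightarrow> \<bar>g y - g t - D * (y - t)\<bar> \<le> e * \<bar>y - t\<bar>"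
    using assms unfolding has_field_derivative_def has_derivative_at_alt real_norm_def by blast
  show ?thesis
  proof (intro exI[of _ d] conjI allI impI d(1))
    fix l r assume lr: "l \<le> t \<and> t \<le> r \<and> r - l < d"
    have "\<bar>g r - g t - D * (r - t)\<bar> \<le> e * (r - t)" "\<bar>g l - g t - D * (l - t)\<bar> \<le> e * (t - l)"
      using d(2)[of r] d(2)[of l] lr by auto
    moreover have "g r - g l - D * (r - l) = (g r - g t - D * (r - t)) - (g l - g t - D * (l - t))"
      "e * (r - l) = e * (r - t) + e * (t - l)"
      by (auto simp: algebra_simps)
    ultimately show "\<bar>g r - g l - D * (r - l)\<bar> \<le> e * (r - l)" by linarith
  qed
qed

text \<open>The triangle inequality through \<open>\<beta> t\<close> gives an upper bound only. A
  matching lower bound can fail, as the curve may turn back at t; this is why the integration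
  argument is one-sided.\<close>

lemma metric_derivative_straddle:
  fixes \<beta> :: "real \<Rightarrow> 'a::metric_space"
  assumes "((\<lambda>h. dist (\<beta> (t + h)) (\<beta> t) / \<bar>h\<bar>) \<longlongrightarrow> v) (at 0)" "e > 0"
  shows "\<exists>d>0. \<forall>l r. l \<le> t \<and> t \<le> r \<and> r - l < d \<longrightarrow> dist (\<beta> l) (\<beta> r) \<le> (v + e) * (r - l)"
proof -
  have "eventually (\<lambda>h. dist (\<beta> (t + h)) (\<beta> t) / \<bar>h\<bar> < v + e) (at 0)"
    using assms by (intro order_tendstoD) auto
  then obtain d where d: "d > 0" "\<And>h. h \<noteq> 0 \<Longrightarrow> \<bar>h\<bar> < d \<Longrightarrow> dist (\<beta> (t + h)) (\<beta> t) / \<bar>h\<bar> < v + e"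
    by (auto simp: eventually_at dist_real_def)
  have near: "dist (\<beta> (t + h)) (\<beta> t) \<le> (v + e) * \<bar>h\<bar>" if "\<bar>h\<bar> < d" for h
    using d(2)[of h] that by (cases "h = 0") (auto simp: divide_less_eq)
  show ?thesis
  proof (intro exI[of _ d] conjI allI impI d(1))
    fix l r assume lr: "l \<le> t \<and> t \<le> r \<and> r - l < d"
    have "dist (\<beta> l) (\<beta> r) \<le> dist (\<beta> l) (\<beta> t) + dist (\<beta> r) (\<beta> t)"
      by (metis dist_commute dist_triangle)
    also have "\<dots> \<le> (v + e) * (t - l) + (v + e) * (r - t)"
      using near[of "l - t"] near[of "r - t"] lr by auto
    finally show "dist (\<beta> l) (\<beta> r) \<le> (v + e) * (r - l)" by (simp add: algebra_simps)
  qed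
qed

text \<open>Passes absolute continuity from a curve to real functions built from it. Dividing by M +
  1 instead of M covers the case M = 0.\<close>

lemma abs_cont_wrt_lipschitz:
  assumes ac: "abs_cont_wrt dd a b \<gamma>" and "M \<ge> 0"
    and lip: "\<And>l r. a \<le> l \<Longrightarrow> l \<le> r \<Longrightarrow> r \<le> b \<Longrightarrow> dd' (g l) (g r) \<le> M * dd (\<gamma> l) (\<gamma> r)"
  shows "abs_cont_wrt dd' a b g"
  unfolding abs_cont_wrt_def
proof (intro allI impI)
  fix e :: real assume "e > 0"
  then have "e / (M + 1) > 0" using \<open>M \<ge> 0\<close> by simp
  then obtain d where d: "d > 0" and dd: "\<forall>(n::nat) l r. (\<forall>i<n. a \<le> l i \<and> l i \<le> r i \<and> r i \<le> b) \<and>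
        (\<forall>i<n. \<forall>j<n. i \<noteq> j \<longrightarrow> r i \<le> l j \<or> r j \<le> l i) \<and>
        (\<Sum>i<n. r i - l i) < d \<longrightarrow> (\<Sum>i<n. dd (\<gamma> (l i)) (\<gamma> (r i))) < e / (M + 1)"
    using ac[unfolded abs_cont_wrt_def] by blast
  show "\<exists>\<delta>>0. \<forall>(n::nat) l r. (\<forall>i<n. a \<le> l i \<and> l i \<le> r i \<and> r i \<le> b) \<and>
        (\<forall>i<n. \<forall>j<n. i \<noteq> j \<longrightarrow> r i \<le> l j \<or> r j \<le> l i) \<and>
        (\<Sum>i<n. r i - l i) < \<delta> \<longrightarrow> (\<Sum>i<n. dd' (g (l i)) (g (r i))) < e"
  proof (intro exI[of _ d] conjI d allI impI)
    fix n :: nat and l r :: "nat \<Rightarrow> real"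
    assume A: "(\<forall>i<n. a \<le> l i \<and> l i \<le> r i \<and> r i \<le> b) \<and>
        (\<forall>i<n. \<forall>j<n. i \<noteq> j \<longrightarrow> r i \<le> l j \<or> r j \<le> l i) \<and> (\<Sum>i<n. r i - l i) < d"
    have "(\<Sum>i<n. dd' (g (l i)) (g (r i))) \<le> (\<Sum>i<n. M * dd (\<gamma> (l i)) (\<gamma> (r i)))"
      using A by (intro sum_mono lip) auto
    also have "\<dots> = M * (\<Sum>i<n. dd (\<gamma> (l i)) (\<gamma> (r i)))" by (simp add: sum_distrib_left)
    also have "\<dots> \<le> M * (e / (M + 1))"
      using dd A \<open>M \<ge> 0\<close> by (intro mult_left_mono) (auto intro: less_imp_le)
    also have "\<dots> < e" using \<open>M \<ge> 0\<close> \<open>e > 0\<close> by (simp add: field_simps)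
    finally show "(\<Sum>i<n. dd' (g (l i)) (g (r i))) < e" .
  qed
qed

lemma lipschitz_abs_cont:
  assumes lip: "\<And>l r. a \<le> l \<Longrightarrow> l \<le> r \<Longrightarrow> r \<le> b \<Longrightarrow> dd (g l) (g r) \<le> M * (r - l)" and "M \<ge> 0"
  shows "abs_cont_wrt dd a b g"
\<comment> \<open>For the signed difference y - x the identity is absolutely continuous with
  \<open>\<delta>\<close> = \<open>\<epsilon>\<close>, since \<open>dd\<close> may be any
  real-valued function.\<close>
proof (rule abs_cont_wrt_lipschitz[where M = M and \<gamma> = "\<lambda>t. t" and dd = "\<lambda>x y. y - x"])
  show "abs_cont_wrt (\<lambda>x y::real. y - x) a b (\<lambda>t. t)"
    unfolding abs_cont_wrt_def by blast
qed (use assms in auto)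

text \<open>The pointwise calibration inequality. With u = \<open>\<phi>\<close> v / p, the root is
  at most p (1 - u^2 / 2), and the right-hand side exceeds this by the completed square p/2 (u -
  \<open>\<mu>\<close> / \<open>\<phi>\<close>)^2. The bound is linear in v, hence stable under the
  one-sided control of the spatial part.\<close>

lemma sqrt_diff_squares_le:
  fixes p v \<phi> \<mu> :: real
  assumes "p > 0" "\<phi> > 0" "- (p\<^sup>2) + \<phi>\<^sup>2 * v\<^sup>2 \<le> 0"
  shows "sqrt (p\<^sup>2 - \<phi>\<^sup>2 * v\<^sup>2) \<le> p - \<mu> * v + \<mu>\<^sup>2 / 2 * (p / \<phi>\<^sup>2)"
proof -
  define u where "u = \<phi> * v / p"
  have uv: "\<phi> * v = u * p" using assms by (simp add: u_def)
  have e: "\<phi>\<^sup>2 * v\<^sup>2 = u\<^sup>2 * p\<^sup>2" using uv by (metis power_mult_distrib)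
  have "sqrt (p\<^sup>2 - \<phi>\<^sup>2 * v\<^sup>2) \<le> p * (1 - u\<^sup>2 / 2)"
  proof (rule real_le_lsqrt)
    have "u\<^sup>2 * p\<^sup>2 \<le> 1 * p\<^sup>2" using assms e by simp
    then have "u\<^sup>2 \<le> 1" using assms(1) by (metis mult_right_le_imp_le zero_less_power)
    then show "0 \<le> p * (1 - u\<^sup>2 / 2)" using assms by (intro mult_nonneg_nonneg) auto
    have "(p * (1 - u\<^sup>2 / 2))\<^sup>2 - (p\<^sup>2 - u\<^sup>2 * p\<^sup>2) = (p * u\<^sup>2 / 2)\<^sup>2"
      by (simp add: power2_eq_square algebra_simps)
    then show "p\<^sup>2 - \<phi>\<^sup>2 * v\<^sup>2 \<le> (p * (1 - u\<^sup>2 / 2))\<^sup>2"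
      using e by (smt (verit) zero_le_power2)
  qed
  moreover have "p - \<mu> * v + \<mu>\<^sup>2 / 2 * (p / \<phi>\<^sup>2) - p * (1 - u\<^sup>2 / 2) = p / 2 * (u - \<mu> / \<phi>)\<^sup>2"
  proof -
    have "v = u * p / \<phi>" using uv assms by (simp add: field_simps)
    then have "\<mu> * v = \<mu> / \<phi> * u * p" "\<mu>\<^sup>2 / 2 * (p / \<phi>\<^sup>2) = (\<mu> / \<phi>)\<^sup>2 * p / 2"
      by (simp_all add: power_divide)
    then show ?thesis by (simp only: power2_diff) (simp add: algebra_simps power2_eq_square)
  qed
  moreover have "p / 2 * (u - \<mu> / \<phi>)\<^sup>2 \<ge> 0" using assms by simp
  ultimately show ?thesis by linarith
qed

lemma primitive_inverse_square_lipschitz: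
  fixes f H :: "real \<Rightarrow> real"
  assumes "\<And>t. t \<in> {s1..s2} \<Longrightarrow> f t > 0" "continuous_on {s1..s2} f" "s1 \<le> s2"
    and H: "\<And>t. t \<in> {s1..s2} \<Longrightarrow> (H has_real_derivative 1 / (f t)\<^sup>2) (at t)"
  obtains M where "M > 0" "\<And>t. t \<in> {s1..s2} \<Longrightarrow> 1 / (f t)\<^sup>2 \<le> M"
    "\<And>u v. u \<in> {s1..s2} \<Longrightarrow> v \<in> {s1..s2} \<Longrightarrow> \<bar>H u - H v\<bar> \<le> M * \<bar>u - v\<bar>"
proof -
  obtain m where m: "m \<in> {s1..s2}" "\<And>t. t \<in> {s1..s2} \<Longrightarrow> f m \<le> f t"
    using continuous_attains_inf[of "{s1..s2}" f] assms(2,3) by (metis atLeastAtMost_iff compact_Icc empty_iff order.refl)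
  have pos: "f m > 0" using m(1) assms(1) by blast
  have b: "1 / (f t)\<^sup>2 \<le> 1 / (f m)\<^sup>2" if "t \<in> {s1..s2}" for t
    using m(2)[OF that] pos by (intro divide_left_mono power_mono) auto
  show ?thesis
  proof (rule that[of "1 / (f m)\<^sup>2"])
    fix u v assume uv: "u \<in> {s1..s2}" "v \<in> {s1..s2}"
    have "norm (H u - H v) \<le> 1 / (f m)\<^sup>2 * norm (u - v)"
    proof (rule field_differentiable_bound[where S = "{s1..s2}" and f' = "\<lambda>t. 1 / (f t)\<^sup>2"])
      show "(H has_field_derivative 1 / (f z)\<^sup>2) (at z within {s1..s2})" if "z \<in> {s1..s2}" for z
        using H[OF that] by (rule has_field_derivative_at_within)
    qed (use uv b in auto)
    then show "\<bar>H u - H v\<bar> \<le> 1 / (f m)\<^sup>2 * \<bar>u - v\<bar>" by simp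
  qed (use pos b in auto)
qed

lemma primitive_inverse_square_increasing:
  fixes f H :: "real \<Rightarrow> real"
  assumes "\<And>t. t \<in> {s1..s2} \<Longrightarrow> f t > 0" "s1 < s2"
    and H: "\<And>t. t \<in> {s1..s2} \<Longrightarrow> (H has_real_derivative 1 / (f t)\<^sup>2) (at t)"
  shows "H s1 < H s2"
proof (rule DERIV_pos_imp_increasing[OF \<open>s1 < s2\<close>])
  fix t assume "s1 \<le> t" "t \<le> s2"
  then have "(H has_real_derivative 1 / (f t)\<^sup>2) (at t)" "1 / (f t)\<^sup>2 > 0"
    using H[of t] assms(1)[of t] by auto
  then show "\<exists>y. (H has_real_derivative y) (at t) \<and> 0 < y" by blast
qed

lemma AE_lborel_negligible:
  assumes "AE s in lborel. P (s::real)"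
  shows "negligible {s. \<not> P s}"
proof -
  obtain N where "{s. \<not> P s} \<subseteq> N" "N \<in> null_sets lborel"
    using assms unfolding eventually_ae_filter by (auto)
  then show ?thesis
    by (meson negligible_iff_null_sets negligible_subset null_sets_completionI)
qed

text \<open>The constant \<open>lam\<close> in the proof is the Lagrange multiplier of minimising \<open>\<integral> f\<^sup>2 v\<^sup>2\<close> under \<open>\<integral> v = \<ell>\<close>.\<close>
lemma curve_length_le:
  fixes c :: "real \<Rightarrow> real \<times> 'a::metric_space"
  assumes fdc: "fd_causal I X f a b c" and ends: "fst (c a) = s1" "fst (c b) = s2" and "s1 < s2"
    and fpos: "\<And>t. t \<in> {s1..s2} \<Longrightarrow> f t > 0" and fcont: "continuous_on {s1..s2} f"
    and H: "\<And>t. t \<in> {s1..s2} \<Longrightarrow> (H has_real_derivative 1 / (f t)\<^sup>2) (at t)"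
    and l: "l = dist (snd (c a)) (snd (c b))"
    and nonneg: "0 \<le> s2 - s1 - l\<^sup>2 / (2 * (H s2 - H s1))"
  shows "curve_length f a b c \<le> s2 - s1 - l\<^sup>2 / (2 * (H s2 - H s1))"
proof -
  define A where "A = H s2 - H s1"
  define lam where "lam = l / A"
  have A: "A > 0" using primitive_inverse_square_increasing[of s1 s2 f H] fpos H \<open>s1 < s2\<close> by (simp add: A_def)
  have "lam \<ge> 0" using A by (simp add: lam_def l)
  have cc: "a < b" "abs_cont_wrt wdist a b c" and AE1: "AE s in lborel. s \<in> {a..b} \<longrightarrow>
        (\<exists>da v. curve_derivs c s da v \<and> - (da\<^sup>2) + (f (fst (c s)))\<^sup>2 * v\<^sup>2 \<le> 0)"
    and mono0: "(\<forall>s\<in>{a..b}. \<forall>s'\<in>{a..b}. s < s' \<longrightarrow> fst (c s) < fst (c s')) \<or>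
      (\<forall>s\<in>{a..b}. \<forall>s'\<in>{a..b}. s < s' \<longrightarrow> fst (c s) > fst (c s'))"
    and AE2: "AE s in lborel. s \<in> {a..b} \<longrightarrow>
        (\<exists>da. ((\<lambda>r. fst (c r)) has_real_derivative da) (at s) \<and> da > 0)"
    using fdc by (auto simp: fd_causal_def causal_curve_def future_directed_def)
  \<comment> \<open>A causal curve may be decreasing in time by definition; the order of the end
    heights excludes this.\<close>
  have mono: "fst (c s) < fst (c s')" if "s \<in> {a..b}" "s' \<in> {a..b}" "s < s'" for s s'
  proof -
    have "\<not> (\<forall>s\<in>{a..b}. \<forall>s'\<in>{a..b}. s < s' \<longrightarrow> fst (c s) > fst (c s'))"
      using ends \<open>s1 < s2\<close> cc(1) by (intro notI) (drule bspec[of _ _ a], force, drule bspec[of _ _ b], auto)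
    then show ?thesis using mono0 that by blast
  qed
  have range: "fst (c s) \<in> {s1..s2}" if "s \<in> {a..b}" for s
    using mono[of a s] mono[of s b] that ends cc(1)
    by (cases "s = a"; cases "s = b") auto
  obtain M where M: "M > 0" "\<And>u v. u \<in> {s1..s2} \<Longrightarrow> v \<in> {s1..s2} \<Longrightarrow> \<bar>H u - H v\<bar> \<le> M * \<bar>u - v\<bar>"
    using primitive_inverse_square_lipschitz[of s1 s2 f H] fpos fcont H \<open>s1 < s2\<close> by (metis less_imp_le)
  \<comment> \<open>The calibration: \<open>g1\<close> collects the terms of the pointwise
    inequality that depend on time only, and \<open>h\<close>, the distance from the initial point,
    replaces the integral of the metric derivative, whose increments it never exceeds.\<close>
  define g1 where "g1 = (\<lambda>s. fst (c s) + lam\<^sup>2 / 2 * H (fst (c s)))"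
  define h where "h = (\<lambda>s. dist (snd (c s)) (snd (c a)))"
  define g where "g = (\<lambda>s. g1 s - lam * h s)"
  define w where "w = (\<lambda>s. sqrt ((deriv (\<lambda>r. fst (c r)) s)\<^sup>2 - (f (fst (c s)))\<^sup>2 * (mderiv c s)\<^sup>2))"
  define N where "N = {s. \<not> (s \<in> {a..b} \<longrightarrow>
        (\<exists>da v. curve_derivs c s da v \<and> - (da\<^sup>2) + (f (fst (c s)))\<^sup>2 * v\<^sup>2 \<le> 0))}
     \<union> {s. \<not> (s \<in> {a..b} \<longrightarrow> (\<exists>da. ((\<lambda>r. fst (c r)) has_real_derivative da) (at s) \<and> da > 0))}"
  \<comment> \<open>The value \<open>lam\<close> = l / A minimises \<open>lam\<close>^2 A / 2 -
    \<open>lam\<close> l, with minimum - l^2 / (2 A).\<close>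
  have gdiff: "g b - g a = s2 - s1 - l\<^sup>2 / (2 * A)"
  proof -
    have "g b - g a = s2 - s1 + lam\<^sup>2 / 2 * A - lam * l"
      using ends by (simp add: g_def g1_def h_def l A_def dist_commute right_diff_distrib)
    moreover have "l = lam * A" using A by (simp add: lam_def)
    ultimately show ?thesis using A by (simp add: power2_eq_square)
  qed
  have acg: "abs_cont_wrt dist a b g"
  proof (rule abs_cont_wrt_lipschitz[OF cc(2), where M = "1 + lam\<^sup>2 / 2 * M + lam"])
    fix r t assume rt: "a \<le> r" "r \<le> t" "t \<le> b"
    let ?x = "\<bar>fst (c r) - fst (c t)\<bar>" and ?y = "dist (snd (c r)) (snd (c t))"
    have "\<bar>H (fst (c r)) - H (fst (c t))\<bar> \<le> M * ?x"
      using range rt by (intro M(2)) auto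
    then have 1: "\<bar>lam\<^sup>2 / 2 * (H (fst (c r)) - H (fst (c t)))\<bar> \<le> lam\<^sup>2 / 2 * (M * ?x)"
      unfolding abs_mult by (intro mult_mono) auto
    have "\<bar>h r - h t\<bar> \<le> ?y"
      unfolding h_def by (metis abs_dist_diff_le dist_commute)
    then have 2: "\<bar>lam * (h r - h t)\<bar> \<le> lam * ?y"
      using \<open>lam \<ge> 0\<close> unfolding abs_mult by (intro mult_mono) auto
    have "dist (g r) (g t) = \<bar>(fst (c r) - fst (c t)) + lam\<^sup>2 / 2 * (H (fst (c r)) - H (fst (c t)))
        - lam * (h r - h t)\<bar>"
      by (simp add: g_def g1_def dist_real_def algebra_simps diff_divide_distrib)
    also have "\<dots> \<le> ?x + lam\<^sup>2 / 2 * (M * ?x) + lam * ?y" using 1 2 by linarith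
    also have "\<dots> \<le> (1 + lam\<^sup>2 / 2 * M + lam) * (?x + ?y)"
    proof -
      have "0 \<le> ?y + lam\<^sup>2 / 2 * M * ?y + lam * ?x" using \<open>lam \<ge> 0\<close> M(1) by simp
      then show ?thesis by (simp add: algebra_simps)
    qed
    finally show "dist (g r) (g t) \<le> (1 + lam\<^sup>2 / 2 * M + lam) * wdist (c r) (c t)"
      by (simp add: wdist_def)
  qed (use \<open>lam \<ge> 0\<close> M in auto)
  have N: "negligible N" unfolding N_def
    using AE_lborel_negligible[OF AE1] AE_lborel_negligible[OF AE2] by (rule negligible_Un)
  have str: "\<exists>d>0. \<forall>l r. a \<le> l \<and> l \<le> t \<and> t \<le> r \<and> r \<le> b \<and> r - l < d \<longrightarrow> g r - g l \<ge> (w t - e) * (r - l)"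
    if t: "t \<in> {a..b} - N" and "e > 0" for t e
  proof -
    obtain da v where dv: "curve_derivs c t da v" "- (da\<^sup>2) + (f (fst (c t)))\<^sup>2 * v\<^sup>2 \<le> 0"
      using t by (auto simp: N_def)
    then have der: "((\<lambda>r. fst (c r)) has_real_derivative da) (at t)"
      and mder: "((\<lambda>h. dist (snd (c (t + h))) (snd (c t)) / \<bar>h\<bar>) \<longlongrightarrow> v) (at 0)"
      by (auto simp: curve_derivs_def)
    obtain da' where "((\<lambda>r. fst (c r)) has_real_derivative da') (at t)" "da' > 0"
      using t by (auto simp: N_def)
    then have da: "da > 0" using der DERIV_unique by blast
    have [simp]: "deriv (\<lambda>r. fst (c r)) t = da" "mderiv c t = v"
      using der mder by (auto intro!: DERIV_imp_deriv tendsto_Lim simp: mderiv_def)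
    have ft: "f (fst (c t)) > 0" using range[of t] t fpos by auto
    let ?D = "da + lam\<^sup>2 / 2 * (1 / (f (fst (c t)))\<^sup>2 * da)"
    have "(g1 has_real_derivative ?D) (at t)"
      unfolding g1_def using der DERIV_chain2[OF H der] range[of t] t
      by (auto intro!: derivative_eq_intros)
    from derivative_straddle[OF this, of "e / 2"] obtain d1 where d1: "d1 > 0"
      "\<And>l r. l \<le> t \<Longrightarrow> t \<le> r \<Longrightarrow> r - l < d1 \<Longrightarrow> \<bar>g1 r - g1 l - ?D * (r - l)\<bar> \<le> e / 2 * (r - l)"
      using \<open>e > 0\<close> by auto
    \<comment> \<open>The denominator \<open>lam\<close> + 1 keeps \<open>lam\<close> *
      \<open>e2\<close> at most e / 2 even for \<open>lam\<close> = 0.\<close>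
    define e2 where "e2 = e / (2 * (lam + 1))"
    have "e2 > 0" using \<open>e > 0\<close> \<open>lam \<ge> 0\<close> by (simp add: e2_def)
    have e2: "lam * e2 \<le> e / 2" using \<open>e > 0\<close> \<open>lam \<ge> 0\<close> by (simp add: e2_def field_simps)
    from metric_derivative_straddle[OF mder \<open>e2 > 0\<close>] obtain d2 where d2: "d2 > 0"
      "\<And>l r. l \<le> t \<Longrightarrow> t \<le> r \<Longrightarrow> r - l < d2 \<Longrightarrow> dist (snd (c l)) (snd (c r)) \<le> (v + e2) * (r - l)"
      by auto
    have wt: "w t \<le> ?D - lam * v"
      using sqrt_diff_squares_le[OF da ft dv(2), of lam] by (simp add: w_def)
    show ?thesis
    proof (intro exI[of _ "min d1 d2"] conjI allI impI)
      fix l r assume lr: "a \<le> l \<and> l \<le> t \<and> t \<le> r \<and> r \<le> b \<and> r - l < min d1 d2"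
      have "h r - h l \<le> dist (snd (c l)) (snd (c r))"
        unfolding h_def using dist_triangle[of "snd (c r)" "snd (c a)" "snd (c l)"] by (simp add: dist_commute)
      also have "\<dots> \<le> (v + e2) * (r - l)" using d2(2) lr by simp
      finally have "lam * (h r - h l) \<le> lam * ((v + e2) * (r - l))"
        using \<open>lam \<ge> 0\<close> by (rule mult_left_mono)
      moreover have "lam * e2 * (r - l) \<le> e / 2 * (r - l)" using e2 lr by (intro mult_right_mono) auto
      moreover have "g1 r - g1 l \<ge> ?D * (r - l) - e / 2 * (r - l)"
      proof -
        have "\<bar>g1 r - g1 l - ?D * (r - l)\<bar> \<le> e / 2 * (r - l)" using lr by (intro d1(2)) auto
        then show ?thesis by argo
      qed
      moreover have "w t * (r - l) \<le> (?D - lam * v) * (r - l)" using wt lr by (intro mult_right_mono) auto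
      moreover have "\<And>D x y z. x \<ge> D * (r - l) - e / 2 * (r - l) \<Longrightarrow> lam * y \<le> lam * ((v + e2) * (r - l)) \<Longrightarrow>
          lam * e2 * (r - l) \<le> e / 2 * (r - l) \<Longrightarrow> z * (r - l) \<le> (D - lam * v) * (r - l) \<Longrightarrow>
          x - lam * y \<ge> (z - e) * (r - l)"
        by (simp add: algebra_simps diff_divide_distrib)
      ultimately have "(g1 r - g1 l) - lam * (h r - h l) \<ge> (w t - e) * (r - l)" by blast
      then show "g r - g l \<ge> (w t - e) * (r - l)"
        by (simp add: g_def algebra_simps)
    qed (use d1 d2 in auto)
  qed
  show ?thesis
  proof (cases "w integrable_on {a..b}")
    case True
    have "integral {a..b} w \<le> g b - g a"
      by (rule abs_cont_increment_ge_integral[OF cc(1) acg N str True])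
    then show ?thesis using gdiff by (simp add: curve_length_def w_def A_def)
  next
    \<comment> \<open>A non-integrable integrand has integral 0 by convention, so the bound then
      rests on \<open>nonneg\<close>.\<close>
    case False
    then have "curve_length f a b c = 0"
      unfolding curve_length_def w_def[symmetric] by (rule not_integrable_integral)
    then show ?thesis using nonneg by simp
  qed
qed

text \<open>Minimising \<open>\<integral> f\<^sup>2 v\<^sup>2\<close> for given \<open>\<integral> v\<close> makes \<open>v\<close> proportional to \<open>1 / f\<^sup>2\<close>, whence the choice of \<open>c\<close>.\<close>
lemma warped_competitor:
  fixes \<beta> :: "real \<Rightarrow> 'a::metric_space"
  assumes "s1 < s2" and I: "{s1..s2} \<subseteq> I"
    and fpos: "\<And>t. t \<in> {s1..s2} \<Longrightarrow> f t > 0" and fcont: "continuous_on {s1..s2} f"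
    and H: "\<And>t. t \<in> {s1..s2} \<Longrightarrow> (H has_real_derivative 1 / (f t)\<^sup>2) (at t)"
    and geo: "\<beta> ` {0..1} \<subseteq> X"
      "\<And>s t. s \<in> {0..1} \<Longrightarrow> t \<in> {0..1} \<Longrightarrow> dist (\<beta> s) (\<beta> t) = \<bar>s - t\<bar> * l"
    and "l \<ge> 0" and small: "\<And>t. t \<in> {s1..s2} \<Longrightarrow> l < (H s2 - H s1) * f t"
  defines "c \<equiv> \<lambda>t. (t, \<beta> ((H t - H s1) / (H s2 - H s1)))"
  shows "fd_timelike I X f s1 s2 c"
    and "m \<ge> 0 \<Longrightarrow> (\<And>t. t \<in> {s1..s2} \<Longrightarrow> 1 / (f t)\<^sup>2 \<le> m) \<Longrightarrow>
      curve_length f s1 s2 c \<ge>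
      s2 - s1 - l\<^sup>2 / (2 * (H s2 - H s1)) - (s2 - s1) * m\<^sup>2 / (2 * (H s2 - H s1)^4) * l^4"
proof -
  define A where "A = H s2 - H s1"
  have A: "A > 0" using primitive_inverse_square_increasing[of s1 s2 f H] fpos H \<open>s1 < s2\<close> by (simp add: A_def)
  \<comment> \<open>The primitive H normalised to run from 0 to 1. As \<open>\<beta>\<close> has
    constant speed l, the metric derivative of the competitor is exactly l / (A f^2).\<close>
  define \<theta> where "\<theta> = (\<lambda>t. (H t - H s1) / A)"
  have c: "c = (\<lambda>t. (t, \<beta> (\<theta> t)))" by (simp add: c_def \<theta>_def A_def)
  have Hmono: "H u \<le> H v" if "s1 \<le> u" "u \<le> v" "v \<le> s2" for u v
  proof (rule DERIV_nonneg_imp_nondecreasing[OF that(2)])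
    fix x assume "u \<le> x" "x \<le> v"
    then show "\<exists>y. (H has_real_derivative y) (at x) \<and> 0 \<le> y"
      using H[of x] that by (intro exI[of _ "1 / (f x)\<^sup>2"]) auto
  qed
  have \<theta>: "\<theta> t \<in> {0..1}" if "t \<in> {s1..s2}" for t
    using Hmono[of s1 t] Hmono[of t s2] that A by (auto simp: \<theta>_def A_def field_simps)
  obtain M where M: "M > 0" "\<And>u v. u \<in> {s1..s2} \<Longrightarrow> v \<in> {s1..s2} \<Longrightarrow> \<bar>H u - H v\<bar> \<le> M * \<bar>u - v\<bar>"
    using primitive_inverse_square_lipschitz[of s1 s2 f H] fpos fcont H \<open>s1 < s2\<close> by (metis less_imp_le)
  have d\<theta>: "dist (\<beta> (\<theta> u)) (\<beta> (\<theta> v)) = \<bar>H u - H v\<bar> / A * l" if "u \<in> {s1..s2}" "v \<in> {s1..s2}" for u v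
  proof -
    have "\<theta> u - \<theta> v = (H u - H v) / A" by (simp add: \<theta>_def diff_divide_distrib)
    then show ?thesis using geo(2)[OF \<theta>[OF that(1)] \<theta>[OF that(2)]] A by (simp add: abs_divide)
  qed
  have ac: "abs_cont_wrt wdist s1 s2 c"
  proof (rule lipschitz_abs_cont[where M = "1 + M * (l / A)"])
    fix u v assume uv: "s1 \<le> u" "u \<le> v" "v \<le> s2"
    have "\<bar>H u - H v\<bar> * (l / A) \<le> (M * \<bar>u - v\<bar>) * (l / A)"
      using M(2)[of u v] uv A \<open>l \<ge> 0\<close> by (intro mult_right_mono) auto
    moreover have "wdist (c u) (c v) = (v - u) + \<bar>H u - H v\<bar> * (l / A)"
      using uv by (simp add: c wdist_def d\<theta>)
    moreover have "\<bar>u - v\<bar> = v - u" using uv by simp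
    ultimately have "wdist (c u) (c v) \<le> (v - u) + (M * (v - u)) * (l / A)" by simp
    also have "\<dots> = (1 + M * (l / A)) * (v - u)" by argo
    finally show "wdist (c u) (c v) \<le> (1 + M * (l / A)) * (v - u)" .
  qed (use M A \<open>l \<ge> 0\<close> in auto)
  have der: "curve_derivs c t 1 (l / (A * (f t)\<^sup>2))" if t: "t \<in> {s1<..<s2}" for t
    unfolding curve_derivs_def
  proof
    show "((\<lambda>r. fst (c r)) has_real_derivative 1) (at t)" by (simp add: c)
    have "((\<lambda>h. (H (t + h) - H t) / h) \<longlongrightarrow> 1 / (f t)\<^sup>2) (at 0)"
      using H[of t] t by (simp add: DERIV_def)
    then have "((\<lambda>h. \<bar>(H (t + h) - H t) / h\<bar> * (l / A)) \<longlongrightarrow> \<bar>1 / (f t)\<^sup>2\<bar> * (l / A)) (at 0)"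
      by (intro tendsto_mult tendsto_rabs tendsto_const)
    then have lim: "((\<lambda>h. \<bar>(H (t + h) - H t) / h\<bar> * (l / A)) \<longlongrightarrow> l / (A * (f t)\<^sup>2)) (at 0)"
      by (simp add: mult.commute)
    have "eventually (\<lambda>h. h \<in> {s1 - t<..<s2 - t}) (at (0::real))"
      using t by (intro eventually_at_in_open') auto
    then have "eventually (\<lambda>h. \<bar>(H (t + h) - H t) / h\<bar> * (l / A) =
        dist (snd (c (t + h))) (snd (c t)) / \<bar>h\<bar>) (at 0)"
    proof eventually_elim
      case (elim h)
      then show ?case using t by (simp add: c d\<theta> abs_divide)
    qed
    from Lim_transform_eventually[OF lim this]
    show "((\<lambda>h. dist (snd (c (t + h))) (snd (c t)) / \<bar>h\<bar>) \<longlongrightarrow> l / (A * (f t)\<^sup>2)) (at 0)" .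
  qed
  have speed: "(f t)\<^sup>2 * (l / (A * (f t)\<^sup>2))\<^sup>2 = (l / (A * f t))\<^sup>2" if "t \<in> {s1..s2}" for t
    using fpos[OF that] A by (simp add: power_divide power_mult_distrib power2_eq_square)
  \<comment> \<open>This is the ratio of warped spatial speed to time speed; \<open>small\<close>
    keeps it below 1 and so makes the curve timelike.\<close>
  have speed1: "l / (A * f t) \<ge> 0" "l / (A * f t) < 1" if "t \<in> {s1..s2}" for t
    using small[OF that] fpos[OF that] A \<open>l \<ge> 0\<close> by (auto simp: A_def)
  have ends: "AE s in lborel. s \<noteq> s1 \<and> s \<noteq> s2"
    using AE_lborel_singleton[of s1] AE_lborel_singleton[of s2] by eventually_elim auto
  have lt: "- (1\<^sup>2) + (f (fst (c s)))\<^sup>2 * (l / (A * (f s)\<^sup>2))\<^sup>2 < 0" if "s \<in> {s1..s2}" for s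
  proof -
    have "(l / (A * f s))\<^sup>2 < 1" using speed1[OF that] by (simp add: power_less_one_iff)
    then show ?thesis using speed[OF that] by (simp add: c)
  qed
  have tl: "AE s in lborel. s \<in> {s1..s2} \<longrightarrow>
        (\<exists>da v. curve_derivs c s da v \<and> - (da\<^sup>2) + (f (fst (c s)))\<^sup>2 * v\<^sup>2 < 0)"
    using ends
  proof eventually_elim
    case (elim s)
    show ?case
    proof
      assume "s \<in> {s1..s2}"
      then show "\<exists>da v. curve_derivs c s da v \<and> - (da\<^sup>2) + (f (fst (c s)))\<^sup>2 * v\<^sup>2 < 0"
        using der[of s] lt[of s] elim by (intro exI[of _ 1] exI[of _ "l / (A * (f s)\<^sup>2)"]) auto
    qed
  qed
  have "AE s in lborel. s \<in> {s1..s2} \<longrightarrow>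
        (\<exists>da v. curve_derivs c s da v \<and> - (da\<^sup>2) + (f (fst (c s)))\<^sup>2 * v\<^sup>2 \<le> 0)"
    using tl by eventually_elim (meson less_imp_le)
  moreover have "c ` {s1..s2} \<subseteq> I \<times> X" using I \<theta> geo(1) by (auto simp: c)
  moreover have "future_directed s1 s2 c" unfolding future_directed_def
    by (intro AE_I2 impI exI[of _ 1]) (simp add: c)
  ultimately show "fd_timelike I X f s1 s2 c"
    using tl ac \<open>s1 < s2\<close> by (simp add: fd_timelike_def timelike_curve_def causal_curve_def c)
  assume m: "m \<ge> 0" "\<And>t. t \<in> {s1..s2} \<Longrightarrow> 1 / (f t)\<^sup>2 \<le> m"
  define w where "w = (\<lambda>t. sqrt (1 - (l / (A * f t))\<^sup>2))"
  have wcont: "continuous_on {s1..s2} w"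
    unfolding w_def using fcont fpos A by (intro continuous_intros) (auto simp: less_imp_neq[symmetric])
  have wint: "(w has_integral integral {s1..s2} w) {s1..s2}"
    by (rule integrable_integral[OF integrable_continuous_real[OF wcont]])
  have "((\<lambda>s. sqrt ((deriv (\<lambda>r. fst (c r)) s)\<^sup>2 - (f (fst (c s)))\<^sup>2 * (mderiv c s)\<^sup>2)) has_integral
      integral {s1..s2} w) {s1..s2}"
  proof (rule has_integral_spike[OF _ _ wint])
    show "negligible {s1, s2}" by simp
    fix t assume t: "t \<in> {s1..s2} - {s1, s2}"
    then have d: "curve_derivs c t 1 (l / (A * (f t)\<^sup>2))" by (intro der) auto
    have "deriv (\<lambda>r. fst (c r)) t = 1" using d by (auto simp: curve_derivs_def intro: DERIV_imp_deriv)
    moreover have "mderiv c t = l / (A * (f t)\<^sup>2)"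
      using d by (auto simp: curve_derivs_def mderiv_def intro!: tendsto_Lim)
    ultimately show "sqrt ((deriv (\<lambda>r. fst (c r)) t)\<^sup>2 - (f (fst (c t)))\<^sup>2 * (mderiv c t)\<^sup>2) = w t"
      using speed[of t] t by (simp add: w_def c)
  qed
  then have len: "curve_length f s1 s2 c = integral {s1..s2} w"
    unfolding curve_length_def by (rule integral_unique)
  \<comment> \<open>With x = l^2 / (A f)^2, at most l^2 m / A^2, this bounds the quadratic error x^2
    / 2 uniformly.\<close>
  define e where "e = m\<^sup>2 / (2 * A^4) * l^4"
  have lower: "w t \<ge> 1 - l\<^sup>2 / (2 * A\<^sup>2) * (1 / (f t)\<^sup>2) - e" if t: "t \<in> {s1..s2}" for t
  proof -
    define x where "x = (l / (A * f t))\<^sup>2"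
    have x: "0 \<le> x" "x < 1" using speed1[OF t] by (auto simp: x_def power_less_one_iff)
    have xl: "x = l\<^sup>2 / A\<^sup>2 * (1 / (f t)\<^sup>2)" by (simp add: x_def power_divide power_mult_distrib)
    have "x\<^sup>2 / 2 \<le> e"
    proof -
      have "x\<^sup>2 \<le> (l\<^sup>2 / A\<^sup>2 * m)\<^sup>2" using m(2)[OF t] x(1) unfolding xl
        by (intro power_mono mult_left_mono) auto
      also have "\<dots> = 2 * e" using A by (simp add: e_def field_simps eval_nat_numeral)
      finally show ?thesis by simp
    qed
    \<comment> \<open>The first-order Taylor polynomial of the root with enough slack to lie below
      it on [0, 1]: the difference of the squares factors with visibly nonnegative factors.\<close>
    moreover have "1 - x / 2 - x\<^sup>2 / 2 \<le> sqrt (1 - x)"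
    proof (rule real_le_rsqrt)
      have "(1 - x) - (1 - x / 2 - x\<^sup>2 / 2)\<^sup>2 = (1 - x) * x\<^sup>2 * (3 + x) / 4"
        by (simp add: power2_eq_square field_simps)
      moreover have "(1 - x) * x\<^sup>2 * (3 + x) / 4 \<ge> 0" using x by simp
      ultimately show "(1 - x / 2 - x\<^sup>2 / 2)\<^sup>2 \<le> 1 - x" by linarith
    qed
    moreover have "w t = sqrt (1 - x)" by (simp add: w_def x_def)
    moreover have "x / 2 = l\<^sup>2 / (2 * A\<^sup>2) * (1 / (f t)\<^sup>2)" by (simp add: xl)
    ultimately show ?thesis by linarith
  qed
  \<comment> \<open>H is a primitive of 1 / f^2, so the lower bound integrates exactly, and its main
    part reproduces the calibrated upper bound.\<close>
  have "((\<lambda>t. 1 - l\<^sup>2 / (2 * A\<^sup>2) * (1 / (f t)\<^sup>2) - e) has_integral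
      (s2 - l\<^sup>2 / (2 * A\<^sup>2) * H s2 - e * s2) - (s1 - l\<^sup>2 / (2 * A\<^sup>2) * H s1 - e * s1)) {s1..s2}"
  proof (rule fundamental_theorem_of_calculus)
    fix x assume "x \<in> {s1..s2}"
    define k where "k = l\<^sup>2 / (2 * A\<^sup>2)"
    from H[OF \<open>x \<in> {s1..s2}\<close>] have "((\<lambda>t. t - k * H t - e * t) has_real_derivative
        1 - k * (1 / (f x)\<^sup>2) - e) (at x)"
      by (auto intro!: derivative_eq_intros)
    then have "((\<lambda>t. t - l\<^sup>2 / (2 * A\<^sup>2) * H t - e * t) has_real_derivative
        1 - l\<^sup>2 / (2 * A\<^sup>2) * (1 / (f x)\<^sup>2) - e) (at x)"
      by (simp only: k_def)
    then show "((\<lambda>t. t - l\<^sup>2 / (2 * A\<^sup>2) * H t - e * t) has_vector_derivative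
        1 - l\<^sup>2 / (2 * A\<^sup>2) * (1 / (f x)\<^sup>2) - e) (at x within {s1..s2})"
      by (simp add: has_field_derivative_at_within has_real_derivative_iff_has_vector_derivative[symmetric])
  qed (use \<open>s1 < s2\<close> in simp)
  from has_integral_le[OF this wint lower]
  have "(s2 - l\<^sup>2 / (2 * A\<^sup>2) * H s2 - e * s2) - (s1 - l\<^sup>2 / (2 * A\<^sup>2) * H s1 - e * s1) \<le> integral {s1..s2} w"
    by simp
  moreover have "(s2 - l\<^sup>2 / (2 * A\<^sup>2) * H s2 - e * s2) - (s1 - l\<^sup>2 / (2 * A\<^sup>2) * H s1 - e * s1)
      = s2 - s1 - l\<^sup>2 / (2 * A\<^sup>2) * A - (s2 - s1) * e"
    by (simp add: A_def algebra_simps diff_divide_distrib)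
  moreover have "l\<^sup>2 / (2 * A\<^sup>2) * A = l\<^sup>2 / (2 * A)" using A by (simp add: power2_eq_square)
  ultimately show "curve_length f s1 s2 c \<ge>
      s2 - s1 - l\<^sup>2 / (2 * (H s2 - H s1)) - (s2 - s1) * m\<^sup>2 / (2 * (H s2 - H s1)^4) * l^4"
    by (simp add: len e_def A_def)
qed

section \<open>Bounds and expansion of the time separation\<close>

lemma tau_le:
  assumes "s1 < s2" and fpos: "\<And>t. t \<in> {s1..s2} \<Longrightarrow> f t > 0" and fcont: "continuous_on {s1..s2} f"
    and H: "\<And>t. t \<in> {s1..s2} \<Longrightarrow> (H has_real_derivative 1 / (f t)\<^sup>2) (at t)"
    and nonneg: "0 \<le> s2 - s1 - (dist x x')\<^sup>2 / (2 * (H s2 - H s1))"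
  shows "tau I X f (s1, x) (s2, x') \<le> ereal (s2 - s1 - (dist x x')\<^sup>2 / (2 * (H s2 - H s1)))"
proof -
  have "ereal (curve_length f a b c) \<le> ereal (s2 - s1 - (dist x x')\<^sup>2 / (2 * (H s2 - H s1)))"
    if "fd_causal I X f a b c" "c a = (s1, x)" "c b = (s2, x')" for a b c
    using curve_length_le[of I X f a b c s1 s2 H "dist x x'"] that assms by simp
  \<comment> \<open>Nonnegativity is used once more here: \<open>tau\<close> is 0 when no causal
    curve joins the points.\<close>
  then show ?thesis using nonneg by (auto simp: tau_def Let_def intro!: Sup_least)
qed

lemma tau_ge:
  assumes "fd_causal I X f a b c"
  shows "ereal (curve_length f a b c) \<le> tau I X f (c a) (c b)"
  using assms by (auto simp: tau_def Let_def intro!: Sup_upper)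

text \<open>The calibrated upper bound and the length of the explicit competitor differ by a quartic
  term. The constants depend only on the height interval, so the points may move while their
  distance tends to 0.\<close>

lemma tau_expansion:
  assumes "geodesic_length_space X" "s1 < s2" and I: "{s1..s2} \<subseteq> I"
    and fpos: "\<And>t. t \<in> {s1..s2} \<Longrightarrow> f t > 0" and fcont: "continuous_on {s1..s2} f"
    and H: "\<And>t. t \<in> {s1..s2} \<Longrightarrow> (H has_real_derivative 1 / (f t)\<^sup>2) (at t)"
  obtains C l0 where "l0 > 0" "C \<ge> 0"
    "\<And>x x'. x \<in> X \<Longrightarrow> x' \<in> X \<Longrightarrow> dist x x' < l0 \<Longrightarrow> chron I X f (s1, x) (s2, x') \<and>
      (\<exists>T. tau I X f (s1, x) (s2, x') = ereal T \<and>
        s2 - s1 - (dist x x')\<^sup>2 / (2 * (H s2 - H s1)) - C * (dist x x')^4 \<le> T \<and>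
        T \<le> s2 - s1 - (dist x x')\<^sup>2 / (2 * (H s2 - H s1)))"
proof -
  define A where "A = H s2 - H s1"
  have A: "A > 0" using primitive_inverse_square_increasing[of s1 s2 f H] fpos H \<open>s1 < s2\<close> by (simp add: A_def)
  obtain m where m: "m > 0" "\<And>t. t \<in> {s1..s2} \<Longrightarrow> 1 / (f t)\<^sup>2 \<le> m"
    using primitive_inverse_square_lipschitz[of s1 s2 f H] fpos fcont H \<open>s1 < s2\<close> by (metis less_imp_le)
  obtain \<mu> where \<mu>: "\<mu> \<in> {s1..s2}" "\<And>t. t \<in> {s1..s2} \<Longrightarrow> f \<mu> \<le> f t"
    using continuous_attains_inf[of "{s1..s2}" f] fcont \<open>s1 < s2\<close>
    by (metis atLeastAtMost_iff compact_Icc empty_iff less_imp_le order.refl)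
  have \<mu>pos: "f \<mu> > 0" using \<mu>(1) fpos by blast
  \<comment> \<open>The first entry makes the competitor timelike, the second keeps the calibrated
    upper bound nonnegative.\<close>
  define l0 where "l0 = min (A * f \<mu>) (sqrt (2 * A * (s2 - s1)))"
  have "l0 > 0" using A \<mu>pos \<open>s1 < s2\<close> by (simp add: l0_def)
  define C where "C = (s2 - s1) * m\<^sup>2 / (2 * A^4)"
  have "C \<ge> 0" using \<open>s1 < s2\<close> by (simp add: C_def)
  show ?thesis
  proof (rule that[OF \<open>l0 > 0\<close> \<open>C \<ge> 0\<close>])
    fix x x' assume x: "x \<in> X" "x' \<in> X" and lt: "dist x x' < l0"
    define l where "l = dist x x'"
    have l: "0 \<le> l" "l < l0" using lt by (auto simp: l_def)
    have small: "l < (H s2 - H s1) * f t" if "t \<in> {s1..s2}" for t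
    proof -
      have "l < A * f \<mu>" using l by (simp add: l0_def)
      also have "\<dots> \<le> A * f t" using \<mu>(2)[OF that] A by simp
      finally show ?thesis by (simp add: A_def)
    qed
    have "l\<^sup>2 < 2 * A * (s2 - s1)"
    proof -
      have "l < sqrt (2 * A * (s2 - s1))" using l by (simp add: l0_def)
      then have "l\<^sup>2 < (sqrt (2 * A * (s2 - s1)))\<^sup>2" using l by (intro power_strict_mono) auto
      then show ?thesis using A \<open>s1 < s2\<close> by simp
    qed
    then have "l\<^sup>2 / (2 * A) < s2 - s1" using A by (simp add: divide_less_eq mult.commute mult.left_commute)
    then have nonneg: "0 \<le> s2 - s1 - l\<^sup>2 / (2 * A)" by simp
    obtain \<beta> :: "real \<Rightarrow> 'a" where \<beta>: "\<beta> 0 = x" "\<beta> 1 = x'" "\<beta> ` {0..1} \<subseteq> X"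
      "\<forall>s\<in>{0..1}. \<forall>t\<in>{0..1}. dist (\<beta> s) (\<beta> t) = \<bar>s - t\<bar> * dist x x'"
      using assms(1) x unfolding geodesic_length_space_def by blast
    define c where "c = (\<lambda>t. (t, \<beta> ((H t - H s1) / (H s2 - H s1))))"
    have geo: "dist (\<beta> s) (\<beta> t) = \<bar>s - t\<bar> * l" if "s \<in> {0..1}" "t \<in> {0..1}" for s t
      using \<beta>(4) that by (auto simp: l_def)
    have tl: "fd_timelike I X f s1 s2 c"
      unfolding c_def by (rule warped_competitor(1)[OF \<open>s1 < s2\<close> I fpos fcont H \<beta>(3) geo l(1) small])
    have len: "curve_length f s1 s2 c \<ge> s2 - s1 - l\<^sup>2 / (2 * (H s2 - H s1)) - C * l^4"
      unfolding c_def C_def A_def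
      by (rule warped_competitor(2)[OF \<open>s1 < s2\<close> I fpos fcont H \<beta>(3) geo l(1) small less_imp_le[OF m(1)] m(2)])
    have ends: "c s1 = (s1, x)" "c s2 = (s2, x')" using A \<beta> by (auto simp: c_def A_def)
    have "fd_causal I X f s1 s2 c"
      using tl by (auto simp: fd_timelike_def fd_causal_def timelike_curve_def)
    from tau_ge[OF this] have ge: "ereal (s2 - s1 - l\<^sup>2 / (2 * (H s2 - H s1)) - C * l^4) \<le> tau I X f (s1, x) (s2, x')"
      using len ends by (metis ereal_less_eq(3) order.trans)
    have le: "tau I X f (s1, x) (s2, x') \<le> ereal (s2 - s1 - l\<^sup>2 / (2 * (H s2 - H s1)))"
      using tau_le[OF \<open>s1 < s2\<close> fpos fcont H, of x x' I X] nonneg by (simp add: l_def A_def)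
    have "chron I X f (s1, x) (s2, x')" using tl ends unfolding chron_def by blast
    moreover obtain T where "tau I X f (s1, x) (s2, x') = ereal T"
      using ge le by (cases "tau I X f (s1, x) (s2, x')") auto
    ultimately show "chron I X f (s1, x) (s2, x') \<and>
      (\<exists>T. tau I X f (s1, x) (s2, x') = ereal T \<and>
        s2 - s1 - (dist x x')\<^sup>2 / (2 * (H s2 - H s1)) - C * (dist x x')^4 \<le> T \<and>
        T \<le> s2 - s1 - (dist x x')\<^sup>2 / (2 * (H s2 - H s1)))"
      using ge le by (auto simp: l_def)
  qed
qed

text \<open>The case l = 0 of the two estimates, with constant \<open>\<beta>\<close>: both error
  terms vanish and the bounds coincide.\<close>

lemma vertical_maximal:
  assumes "s1 < s2" and I: "{s1..s2} \<subseteq> I" and x: "x \<in> X"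
    and fpos: "\<And>t. t \<in> {s1..s2} \<Longrightarrow> f t > 0" and fcont: "continuous_on {s1..s2} f"
    and H: "\<And>t. t \<in> {s1..s2} \<Longrightarrow> (H has_real_derivative 1 / (f t)\<^sup>2) (at t)"
  shows "fd_causal I X f s1 s2 (\<lambda>t. (t, x))" "curve_length f s1 s2 (\<lambda>t. (t, x)) = s2 - s1"
    "tau I X f (s1, x) (s2, x) = ereal (s2 - s1)"
proof -
  have A: "H s2 - H s1 > 0" using primitive_inverse_square_increasing[of s1 s2 f H] fpos H \<open>s1 < s2\<close> by simp
  obtain m where m: "m > 0" "\<And>t. t \<in> {s1..s2} \<Longrightarrow> 1 / (f t)\<^sup>2 \<le> m"
    using primitive_inverse_square_lipschitz[of s1 s2 f H] fpos fcont H \<open>s1 < s2\<close> by (metis less_imp_le)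
  have small: "0 < (H s2 - H s1) * f t" if "t \<in> {s1..s2}" for t
    using A fpos[OF that] by simp
  show fc: "fd_causal I X f s1 s2 (\<lambda>t. (t, x))"
    using warped_competitor(1)[OF \<open>s1 < s2\<close> I fpos fcont H, of "\<lambda>_. x" X 0] x small
    by (auto simp: fd_timelike_def fd_causal_def timelike_curve_def)
  have "s2 - s1 \<le> curve_length f s1 s2 (\<lambda>t. (t, x))"
    using warped_competitor(2)[OF \<open>s1 < s2\<close> I fpos fcont H, of "\<lambda>_. x" X 0 m] x small m
    by (auto simp: image_subset_iff)
  moreover have "curve_length f s1 s2 (\<lambda>t. (t, x)) \<le> s2 - s1"
    using curve_length_le[OF fc, of s1 s2 H 0] \<open>s1 < s2\<close> fpos fcont H by simp
  ultimately show len: "curve_length f s1 s2 (\<lambda>t. (t, x)) = s2 - s1" by simp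
  have "tau I X f (s1, x) (s2, x) \<le> ereal (s2 - s1)"
    using tau_le[OF \<open>s1 < s2\<close> fpos fcont H, of x x I X] \<open>s1 < s2\<close> by simp
  then show "tau I X f (s1, x) (s2, x) = ereal (s2 - s1)"
    using tau_ge[OF fc] len by (simp add: antisym)
qed

section \<open>Causal curves in the model spaces\<close>

lemma integral_le_increment:
  fixes G w :: "real \<Rightarrow> real"
  assumes "a < b" "finite S" "continuous_on {a..b} G"
    and G: "\<And>s. s \<in> {a<..<b} - S \<Longrightarrow> \<exists>d. (G has_real_derivative d) (at s) \<and> w s \<le> d"
    and w: "w integrable_on {a..b}"
  shows "integral {a..b} w \<le> G b - G a"
proof -
  have der: "(G has_real_derivative deriv G s) (at s) \<and> w s \<le> deriv G s" if "s \<in> {a<..<b} - S" for s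
    using G[OF that] DERIV_imp_deriv by blast
  have i1: "(deriv G has_integral G b - G a) {a..b}"
    using assms der by (intro fundamental_theorem_of_calculus_interior_strong[OF \<open>finite S\<close>])
      (auto simp: has_real_derivative_iff_has_vector_derivative[symmetric])
  \<comment> \<open>On the finite exceptional set and at the endpoints the integrand is replaced by
    the derivative of G, so that the comparison holds at every point.\<close>
  have i2: "((\<lambda>s. if s \<in> S \<union> {a, b} then deriv G s else w s) has_integral integral {a..b} w) {a..b}"
    by (rule has_integral_spike_finite[OF _ _ integrable_integral[OF w], of "S \<union> {a, b}"]) (use assms in auto)
  show ?thesis by (rule has_integral_le[OF i2 i1]) (use der in auto)
qed

lemma derivative_nonneg_mono:
  fixes G :: "real \<Rightarrow> real"
  assumes "a \<le> b" "finite S" "continuous_on {a..b} G"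
    and "\<And>s. s \<in> {a<..<b} - S \<Longrightarrow> \<exists>d. (G has_real_derivative d) (at s) \<and> 0 \<le> d"
  shows "G a \<le> G b"
  using integral_le_increment[of a b S G "\<lambda>_. 0"] assms by (cases "a = b") auto

lemma vector_derivative_components:
  fixes c :: "real \<Rightarrow> real \<times> real"
  assumes "c differentiable (at s)"
  shows "((\<lambda>s. fst (c s)) has_real_derivative fst (vector_derivative c (at s))) (at s)"
    and "((\<lambda>s. snd (c s)) has_real_derivative snd (vector_derivative c (at s))) (at s)"
proof -
  have "(c has_vector_derivative vector_derivative c (at s)) (at s)"
    using assms by (simp add: vector_derivative_works)
  then have d: "(c has_derivative (\<lambda>x. x *\<^sub>R vector_derivative c (at s))) (at s)"
    by (simp add: has_vector_derivative_def)
  from has_derivative_fst[OF d] has_derivative_snd[OF d]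
  show "((\<lambda>s. fst (c s)) has_real_derivative fst (vector_derivative c (at s))) (at s)"
    "((\<lambda>s. snd (c s)) has_real_derivative snd (vector_derivative c (at s))) (at s)"
    by (simp_all add: has_real_derivative_iff_has_vector_derivative has_vector_derivative_def)
qed

lemma model_fd_causalD:
  assumes "model_fd_causal K a b c"
  obtains S where "finite S" "a < b" "continuous_on {a..b} c"
    "\<And>s. s \<in> {a<..<b} - S \<Longrightarrow>
      ((\<lambda>s. fst (c s)) has_real_derivative fst (vector_derivative c (at s))) (at s) \<and>
      ((\<lambda>s. snd (c s)) has_real_derivative snd (vector_derivative c (at s))) (at s) \<and>
      model_g K (c s) (vector_derivative c (at s)) \<le> 0 \<and> fst (vector_derivative c (at s)) > 0"
proof -
  obtain S where "finite S" "a < b" "c piecewise_C1_differentiable_on {a..b}"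
    "\<forall>s\<in>{a<..<b} - S. c differentiable (at s) \<and>
         model_g K (c s) (vector_derivative c (at s)) \<le> 0 \<and> fst (vector_derivative c (at s)) > 0"
    using assms unfolding model_fd_causal_def by blast
  then show ?thesis
    by (intro that[of S]) (auto simp: piecewise_C1_differentiable_on_def intro!: vector_derivative_components)
qed

lemma model_time_mono:
  assumes c: "model_fd_causal K a b c" and "a \<le> u" "u \<le> v" "v \<le> b"
  shows "fst (c u) \<le> fst (c v)"
proof -
  obtain S where S: "finite S" "continuous_on {a..b} c"
    "\<And>s. s \<in> {a<..<b} - S \<Longrightarrow>
      ((\<lambda>s. fst (c s)) has_real_derivative fst (vector_derivative c (at s))) (at s) \<and>
      fst (vector_derivative c (at s)) > 0"
    using model_fd_causalD[OF c] by metis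
  show ?thesis
  proof (rule derivative_nonneg_mono[OF \<open>u \<le> v\<close> S(1), where G = "\<lambda>s. fst (c s)"])
    show "continuous_on {u..v} (\<lambda>s. fst (c s))"
      using assms by (intro continuous_intros continuous_on_subset[OF S(2)]) auto
    show "\<exists>d. ((\<lambda>s. fst (c s)) has_real_derivative d) (at s) \<and> 0 \<le> d" if "s \<in> {u<..<v} - S" for s
      using S(3)[of s] that assms by (auto intro: less_imp_le)
  qed
qed

text \<open>The calibration principle in the model: the derivative of \<open>\<Phi>\<close>
  dominates the length element at each causal velocity. If the length element is not integrable, the
  length is 0 by convention, and monotonicity of \<open>\<Phi>\<close> along the curve
  suffices.\<close>

lemma model_len_le:
  assumes c: "model_fd_causal K a b c"
    and cont: "continuous_on {a..b} c \<Longrightarrow> continuous_on {a..b} (\<lambda>s. \<Phi> (c s))"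
    and steep: "\<And>s t' x'. s \<in> {a<..<b} \<Longrightarrow> ((\<lambda>s. fst (c s)) has_real_derivative t') (at s) \<Longrightarrow>
      ((\<lambda>s. snd (c s)) has_real_derivative x') (at s) \<Longrightarrow> model_g K (c s) (t', x') \<le> 0 \<Longrightarrow> t' > 0 \<Longrightarrow>
      \<exists>d. ((\<lambda>s. \<Phi> (c s)) has_real_derivative d) (at s) \<and> sqrt (- model_g K (c s) (t', x')) \<le> d"
  shows "model_len K a b c \<le> \<Phi> (c b) - \<Phi> (c a)"
proof -
  obtain S where S: "finite S" "a < b" "continuous_on {a..b} c"
    "\<And>s. s \<in> {a<..<b} - S \<Longrightarrow>
      ((\<lambda>s. fst (c s)) has_real_derivative fst (vector_derivative c (at s))) (at s) \<and>
      ((\<lambda>s. snd (c s)) has_real_derivative snd (vector_derivative c (at s))) (at s) \<and>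
      model_g K (c s) (vector_derivative c (at s)) \<le> 0 \<and> fst (vector_derivative c (at s)) > 0"
    using model_fd_causalD[OF c] by metis
  define w where "w = (\<lambda>s. sqrt (- model_g K (c s) (vector_derivative c (at s))))"
  have der: "\<exists>d. ((\<lambda>s. \<Phi> (c s)) has_real_derivative d) (at s) \<and> w s \<le> d \<and> 0 \<le> d" if "s \<in> {a<..<b} - S" for s
  proof -
    have "w s \<ge> 0" using S(4)[OF that] by (simp add: w_def)
    then show ?thesis
      using steep[of s "fst (vector_derivative c (at s))" "snd (vector_derivative c (at s))"] S(4)[OF that] that
      unfolding w_def prod.collapse by (meson DiffD1 order.trans)
  qed
  show ?thesis
  proof (cases "w integrable_on {a..b}")
    case True
    from integral_le_increment[OF S(2,1) cont[OF S(3)] _ this] der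
    show ?thesis by (fastforce simp: model_len_def w_def)
  next
    case False
    then have "model_len K a b c = 0"
      unfolding model_len_def w_def[symmetric] by (rule not_integrable_integral)
    moreover have "\<Phi> (c a) \<le> \<Phi> (c b)"
      by (rule derivative_nonneg_mono[OF _ S(1) cont[OF S(3)]]) (use der S(2) in \<open>auto simp: less_imp_le\<close>)
    ultimately show ?thesis by simp
  qed
qed

lemma tau_model_eqI:
  assumes "\<And>a b c. model_fd_causal K a b c \<Longrightarrow> c a = p \<Longrightarrow> c b = q \<Longrightarrow> model_len K a b c \<le> D"
    and "model_fd_causal K a b c" "c a = p" "c b = q" "model_len K a b c = D"
  shows "tau_model K p q = ereal D"
proof -
  let ?C = "{ereal (model_len K a b c) | a b c. model_fd_causal K a b c \<and> c a = p \<and> c b = q}"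
  have D: "ereal D \<in> ?C" using assms(2-5) by blast
  have "Sup ?C = ereal D"
    by (rule Sup_eqI) (use assms(1) D in auto)
  then show ?thesis using D by (auto simp: tau_model_def Let_def)
qed

lemma model_unit_curve:
  assumes "D > 0"
    and t: "\<And>s. s \<in> {0..D} \<Longrightarrow> (t has_real_derivative t' s) (at s)"
    and x: "\<And>s. s \<in> {0..D} \<Longrightarrow> (x has_real_derivative x' s) (at s)"
    and cont: "continuous_on {0..D} t'" "continuous_on {0..D} x'"
    and unit: "\<And>s. s \<in> {0..D} \<Longrightarrow> model_g K (t s, x s) (t' s, x' s) = -1"
    and pos: "\<And>s. s \<in> {0..D} \<Longrightarrow> t' s > 0"
  shows "model_fd_causal K 0 D (\<lambda>s. (t s, x s))" "model_len K 0 D (\<lambda>s. (t s, x s)) = D"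
proof -
  have d: "((\<lambda>s. (t s, x s)) has_vector_derivative (t' s, x' s)) (at s)" if "s \<in> {0..D}" for s
    using t[OF that] x[OF that]
    by (intro has_vector_derivative_Pair) (simp_all add: has_real_derivative_iff_has_vector_derivative)
  have vd: "vector_derivative (\<lambda>s. (t s, x s)) (at s) = (t' s, x' s)" if "s \<in> {0..D}" for s
    using d[OF that] by (rule vector_derivative_at)
  have "(\<lambda>s. (t s, x s)) C1_differentiable_on {0..D}"
    unfolding C1_differentiable_on_def using d cont
    by (intro exI[of _ "\<lambda>s. (t' s, x' s)"]) (auto intro!: continuous_on_Pair)
  then have "(\<lambda>s. (t s, x s)) piecewise_C1_differentiable_on {0..D}"
    by (rule C1_differentiable_imp_piecewise)
  moreover have "\<forall>s\<in>{0<..<D} - {}. (\<lambda>s. (t s, x s)) differentiable (at s) \<and>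
         model_g K (t s, x s) (vector_derivative (\<lambda>s. (t s, x s)) (at s)) \<le> 0 \<and>
         fst (vector_derivative (\<lambda>s. (t s, x s)) (at s)) > 0"
  proof
    fix s assume "s \<in> {0<..<D} - {}"
    then have s: "s \<in> {0..D}" by simp
    show "(\<lambda>s. (t s, x s)) differentiable (at s) \<and>
         model_g K (t s, x s) (vector_derivative (\<lambda>s. (t s, x s)) (at s)) \<le> 0 \<and>
         fst (vector_derivative (\<lambda>s. (t s, x s)) (at s)) > 0"
      unfolding vd[OF s] using differentiableI_vector[OF d[OF s]] unit[OF s] pos[OF s] by simp
  qed
  ultimately show "model_fd_causal K 0 D (\<lambda>s. (t s, x s))"
    unfolding model_fd_causal_def using \<open>D > 0\<close> by blast
  have "model_len K 0 D (\<lambda>s. (t s, x s)) = integral {0..D} (\<lambda>s. 1)"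
    unfolding model_len_def using vd unit by (intro integral_cong) auto
  then show "model_len K 0 D (\<lambda>s. (t s, x s)) = D" using \<open>D > 0\<close> by simp
qed

text \<open>On the axis x = 0 all three metrics restrict to -dt^2. The long side of the comparison
  triangle is placed there for this reason.\<close>

lemma vertical_model_curve:
  assumes "C > 0"
  shows "model_fd_causal K 0 C (\<lambda>s. (s, 0))" "model_len K 0 C (\<lambda>s. (s, 0)) = C"
  using assms by (auto intro!: model_unit_curve[where t = "\<lambda>s. s" and x = "\<lambda>_. 0" and t' = "\<lambda>_. 1" and x' = "\<lambda>_. 0"]
      simp: model_g_def)

text \<open>The excess of the squares is the square (a x - n t)^2. Applied to a timelike gradient
  and a causal velocity, this gives the steepness of the time functions in all three models.\<close>

lemma reverse_cauchy_schwarz: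
  fixes a n t x :: real
  assumes "\<bar>n\<bar> \<le> a" "\<bar>x\<bar> \<le> t"
  shows "sqrt (a\<^sup>2 - n\<^sup>2) * sqrt (t\<^sup>2 - x\<^sup>2) \<le> a * t - n * x"
proof -
  have "n * x \<le> \<bar>n\<bar> * \<bar>x\<bar>" by (metis abs_ge_self abs_mult)
  also have "\<dots> \<le> a * t" using assms by (intro mult_mono) auto
  finally have "0 \<le> a * t - n * x" by simp
  moreover have "(a * t - n * x)\<^sup>2 - (a\<^sup>2 - n\<^sup>2) * (t\<^sup>2 - x\<^sup>2) = (a * x - n * t)\<^sup>2"
    by (simp add: power2_eq_square algebra_simps)
  then have "(a\<^sup>2 - n\<^sup>2) * (t\<^sup>2 - x\<^sup>2) \<le> (a * t - n * x)\<^sup>2" by (smt (verit) zero_le_power2)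
  ultimately show ?thesis by (simp add: real_le_lsqrt flip: real_sqrt_mult)
qed

text \<open>The usual derivative of the polar angle of (A, B), with the factor k of the model
  coordinates. The form with \<open>arctan\<close> requires A to be nonzero, so geodesics are later
  kept in a half space.\<close>

lemma DERIV_polar_angle:
  assumes "(A has_real_derivative k * A') (at u)" "(B has_real_derivative k * B') (at u)" "A u \<noteq> 0" "k \<noteq> 0"
  shows "((\<lambda>u. arctan (B u / A u) / k) has_real_derivative (B' * A u - B u * A') / ((A u)\<^sup>2 + (B u)\<^sup>2)) (at u)"
proof -
  have "((\<lambda>u. B u / A u) has_real_derivative (k * B' * A u - B u * (k * A')) / (A u * A u)) (at u)"
    using assms by (intro DERIV_divide)
  then have "((\<lambda>u. arctan (B u / A u) / k) has_real_derivative (inverse (1 + (B u / A u)\<^sup>2) *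
      ((k * B' * A u - B u * (k * A')) / (A u * A u))) / k) (at u)"
    by (intro DERIV_cdivide DERIV_chain2[OF DERIV_arctan])
  moreover have "1 + (B u / A u)\<^sup>2 = ((A u)\<^sup>2 + (B u)\<^sup>2) / (A u)\<^sup>2"
    using assms by (simp add: power_divide field_simps)
  moreover have "k * B' * A u - B u * (k * A') = k * (B' * A u - B u * A')" by (simp add: algebra_simps)
  ultimately show ?thesis using assms by (simp add: power2_eq_square)
qed

text \<open>Here \<open>p\<close> and \<open>q\<close> are the coefficients of the geodesic \<open>p Y + q Z\<close> between two points with inner
  product \<open>P\<close> on a quadric; the sign \<open>\<kappa>\<close> distinguishes hyperbolic from trigonometric functions.\<close>
lemma slerp_identities:
  fixes p q p' q' P Q S C \<kappa> :: real
  assumes "Q > 0" and e: "p * Q = Q * C - P * S" "q * Q = S" "p' * Q = - (P * C - \<kappa> * (Q * S))" "q' * Q = C"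
    and PQ: "P\<^sup>2 = 1 + \<kappa> * Q\<^sup>2" "C\<^sup>2 = 1 + \<kappa> * S\<^sup>2"
  shows "p\<^sup>2 + q\<^sup>2 + 2 * p * q * P = 1" "p'\<^sup>2 + q'\<^sup>2 + 2 * p' * q' * P = - \<kappa>"
    "p * p' + q * q' + (p * q' + p' * q) * P = 0" "p * q' - p' * q = 1 / Q"
proof -
  \<comment> \<open>Multiplying by Q^2 clears the denominators and leaves polynomial
    identities.\<close>
  have cancel: "x = y" if "x * Q\<^sup>2 = y * Q\<^sup>2" for x y using that \<open>Q > 0\<close> by simp
  show "p\<^sup>2 + q\<^sup>2 + 2 * p * q * P = 1" by (rule cancel) (use e PQ in algebra)
  show "p'\<^sup>2 + q'\<^sup>2 + 2 * p' * q' * P = - \<kappa>" by (rule cancel) (use e PQ in algebra)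
  show "p * p' + q * q' + (p * q' + p' * q) * P = 0" by (rule cancel) (use e PQ in algebra)
  have "(p * q' - p' * q) * Q\<^sup>2 = Q" using e PQ by algebra
  also have "\<dots> = 1 / Q * Q\<^sup>2" using \<open>Q > 0\<close> by (simp add: power2_eq_square)
  finally show "p * q' - p' * q = 1 / Q" by (rule cancel)
qed

text \<open>The map (t, x) to (-t, x) is an isometry of each model that reverses time; reversing the
  parameter as well restores the future direction.\<close>

lemma model_reversal:
  assumes c: "model_fd_causal K a b c"
  defines "\<rho> \<equiv> \<lambda>s. (- fst (c (- s)), snd (c (- s)))"
  shows "model_fd_causal K (- b) (- a) \<rho>" "model_len K (- b) (- a) \<rho> = model_len K a b c"
proof -
  obtain S where S: "finite S" "a < b" "c piecewise_C1_differentiable_on {a..b}"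
    "\<And>s. s\<in>{a<..<b} - S \<Longrightarrow> c differentiable (at s) \<and>
         model_g K (c s) (vector_derivative c (at s)) \<le> 0 \<and> fst (vector_derivative c (at s)) > 0"
    using c unfolding model_fd_causal_def by blast
  obtain S1 D where S1: "finite S1" "continuous_on {a..b} c" "continuous_on ({a..b} - S1) D"
    "\<And>s. s \<in> {a..b} - S1 \<Longrightarrow> (c has_vector_derivative D s) (at s)"
    using S(3) unfolding piecewise_C1_differentiable_on_def C1_differentiable_on_def by blast
  have der: "(\<rho> has_vector_derivative (fst v, - snd v)) (at s)"
    if "(c has_vector_derivative v) (at (- s))" for s v
  proof -
    have 1: "((\<lambda>s. c (- s)) has_vector_derivative - v) (at s)"
      using vector_diff_chain_at[of uminus "-1" s c v] that
      by (simp add: o_def has_vector_derivative_minus[OF has_vector_derivative_id, simplified])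
    then have d: "((\<lambda>s. c (- s)) has_derivative (\<lambda>x. x *\<^sub>R (- v))) (at s)"
      by (simp add: has_vector_derivative_def)
    from has_derivative_Pair[OF has_derivative_minus[OF has_derivative_fst[OF d]] has_derivative_snd[OF d]]
    show ?thesis by (simp add: \<rho>_def has_vector_derivative_def scaleR_prod_def)
  qed
  have im: "uminus ` A = {s. - s \<in> A}" for A :: "real set"
  proof (intro set_eqI iffI)
    fix s assume "s \<in> {s. - s \<in> A}"
    then show "s \<in> uminus ` A" by (metis imageI mem_Collect_eq minus_minus)
  qed auto
  have "continuous_on {-b..-a} \<rho>"
    unfolding \<rho>_def by (intro continuous_intros continuous_on_compose2[OF S1(2)]) auto
  moreover have "\<rho> C1_differentiable_on {-b..-a} - uminus ` S1"
    unfolding C1_differentiable_on_def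
  proof (intro exI[of _ "\<lambda>s. (fst (D (- s)), - snd (D (- s)))"] conjI ballI)
    show "(\<rho> has_vector_derivative (fst (D (- s)), - snd (D (- s)))) (at s)" if "s \<in> {-b..-a} - uminus ` S1" for s
      using that S1(4)[of "- s"] by (intro der) (auto simp: im)
    show "continuous_on ({-b..-a} - uminus ` S1) (\<lambda>s. (fst (D (- s)), - snd (D (- s))))"
      by (intro continuous_intros continuous_on_compose2[OF S1(3)]) (auto simp: im)
  qed
  ultimately have pc: "\<rho> piecewise_C1_differentiable_on {-b..-a}"
    unfolding piecewise_C1_differentiable_on_def using S1(1) by blast
  have vd: "\<rho> differentiable (at s) \<and> vector_derivative \<rho> (at s) =
      (fst (vector_derivative c (at (- s))), - snd (vector_derivative c (at (- s))))"
    if "c differentiable (at (- s))" for s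
    using der[of "vector_derivative c (at (- s))" s] that
    by (auto simp: vector_derivative_works[symmetric] intro: differentiableI_vector vector_derivative_at)
  have g: "model_g K (\<rho> s) (fst v, - snd v) = model_g K (c (- s)) v" for s v
    by (simp add: model_g_def \<rho>_def)
  have "\<forall>s\<in>{-b<..<-a} - uminus ` (S \<union> S1 \<union> {a, b}). \<rho> differentiable (at s) \<and>
         model_g K (\<rho> s) (vector_derivative \<rho> (at s)) \<le> 0 \<and> fst (vector_derivative \<rho> (at s)) > 0"
  proof
    fix s assume s: "s \<in> {-b<..<-a} - uminus ` (S \<union> S1 \<union> {a, b})"
    then have "- s \<in> {a<..<b} - S" by (auto simp: im)
    from S(4)[OF this] show "\<rho> differentiable (at s) \<and>
         model_g K (\<rho> s) (vector_derivative \<rho> (at s)) \<le> 0 \<and> fst (vector_derivative \<rho> (at s)) > 0"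
      using vd[of s] g[of s "vector_derivative c (at (- s))"] by simp
  qed
  moreover have "finite (uminus ` (S \<union> S1 \<union> {a, b}))" using S S1 by blast
  ultimately show "model_fd_causal K (- b) (- a) \<rho>"
    unfolding model_fd_causal_def using pc S(2) by (metis neg_less_iff_less)
  have "model_len K (- b) (- a) \<rho> =
      integral {-b..-a} (\<lambda>s. sqrt (- model_g K (c (- s)) (vector_derivative c (at (- s)))))"
    unfolding model_len_def
  proof (rule integral_spike[of "uminus ` (S \<union> S1 \<union> {a, b})"])
    show "negligible (uminus ` (S \<union> S1 \<union> {a, b}))" using S S1 by (intro negligible_finite) blast
    fix s assume "s \<in> {-b..-a} - uminus ` (S \<union> S1 \<union> {a, b})"
    then have "- s \<in> {a<..<b} - S" by (auto simp: im)
    from S(4)[OF this] show "sqrt (- model_g K (c (- s)) (vector_derivative c (at (- s)))) =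
        sqrt (- model_g K (\<rho> s) (vector_derivative \<rho> (at s)))"
      using vd[of s] g[of s "vector_derivative c (at (- s))"] by simp
  qed
  also have "\<dots> = model_len K a b c"
    unfolding model_len_def
    using Henstock_Kurzweil_Integration.integral_reflect_real[of b a "\<lambda>s. sqrt (- model_g K (c s) (vector_derivative c (at s)))"] by simp
  finally show "model_len K (- b) (- a) \<rho> = model_len K a b c" .
qed

text \<open>The explicit formulas below start on the axis x = 0, whereas the upper short side of the
  triangle ends there; reversal turns one situation into the other. As reversal is an involution,
  one inclusion gives both.\<close>

lemma tau_model_reversal: "tau_model K (t1, x1) (t2, x2) = tau_model K (- t2, x2) (- t1, x1)"
proof -
  let ?C = "\<lambda>p q. {ereal (model_len K a b c) | a b c. model_fd_causal K a b c \<and> c a = p \<and> c b = q}"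
  have sub: "?C (t1, x1) (t2, x2) \<subseteq> ?C (- t2, x2) (- t1, x1)" for t1 x1 t2 x2
  proof
    fix e assume "e \<in> ?C (t1, x1) (t2, x2)"
    then obtain a b c where *: "e = ereal (model_len K a b c)" "model_fd_causal K a b c"
      "c a = (t1, x1)" "c b = (t2, x2)" by blast
    show "e \<in> ?C (- t2, x2) (- t1, x1)"
      using model_reversal[OF *(2)] *(1,3,4)
      by (intro CollectI exI[of _ "- b"] exI[of _ "- a"] exI[of _ "\<lambda>s. (- fst (c (- s)), snd (c (- s)))"]) simp
  qed
  have "?C (t1, x1) (t2, x2) = ?C (- t2, x2) (- t1, x1)"
    using sub[of t1 x1 t2 x2] sub[of "- t2" x2 "- t1" x1] by simp
  then show ?thesis by (simp add: tau_model_def)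
qed

text \<open>The model of curvature \<open>K > 0\<close> is the hyperboloid \<open>-Z\<^sub>0\<^sup>2 + Z\<^sub>1\<^sup>2 + Z\<^sub>2\<^sup>2 = 1\<close> (rescaled by \<open>1 / sqrt K\<close>) with
  \<open>Z = (sinh kt, cosh kt cos kx, cosh kt sin kx)\<close>. The geodesic between two points is the
  normalised combination of their position vectors, and for a unit timelike vector \<open>N\<close> the function
  \<open>arsinh (- \<langle>N, Z\<rangle>) / k\<close> increases along causal curves at least as fast as the length.\<close>

lemma de_sitter_length_le:
  fixes N0 N1 N2 :: real
  assumes "K > 0" and N: "N0\<^sup>2 = 1 + N1\<^sup>2 + N2\<^sup>2" "N0 > 0"
    and c: "model_fd_causal K a b c"
  defines "\<Phi> \<equiv> \<lambda>p. arsinh (N0 * sinh (sqrt K * fst p)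
      - cosh (sqrt K * fst p) * (N1 * cos (sqrt K * snd p) + N2 * sin (sqrt K * snd p))) / sqrt K"
  shows "model_len K a b c \<le> \<Phi> (c b) - \<Phi> (c a)"
proof -
  define k where "k = sqrt K"
  have k: "k > 0" using \<open>K > 0\<close> by (simp add: k_def)
  show ?thesis
  proof (rule model_len_le[OF c])
    assume cont: "continuous_on {a..b} c"
    show "continuous_on {a..b} (\<lambda>s. \<Phi> (c s))"
      unfolding \<Phi>_def using cont k by (auto intro!: continuous_intros simp: k_def)
  next
    fix s t' x'
    assume dt: "((\<lambda>s. fst (c s)) has_real_derivative t') (at s)"
      and dx: "((\<lambda>s. snd (c s)) has_real_derivative x') (at s)"
      and le: "model_g K (c s) (t', x') \<le> 0" and t': "t' > 0"
    define t where "t = k * fst (c s)"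
    define x where "x = k * snd (c s)"
    have g: "model_g K (c s) (t', x') = - (t'\<^sup>2) + (cosh t * x')\<^sup>2"
      using \<open>K > 0\<close> by (simp add: model_g_def t_def k_def power_mult_distrib)
    have causal: "(cosh t * x')\<^sup>2 \<le> t'\<^sup>2" using le g by simp
    then have causal': "\<bar>cosh t * x'\<bar> \<le> t'" using t' by (metis abs_le_square_iff abs_of_pos)
    \<comment> \<open>\<open>n1\<close> and \<open>n2\<close> are N in the frame rotated by x. In
      the orthonormal frame of the model, \<open>y\<close> has partial derivatives \<open>n\<close>
      in time and - \<open>n2\<close> in space, and its gradient has squared length - (1 +
      y^2).\<close>
    define n1 where "n1 = N1 * cos x + N2 * sin x"
    define n2 where "n2 = N2 * cos x - N1 * sin x"
    define y where "y = N0 * sinh t - cosh t * n1"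
    define n where "n = N0 * cosh t - sinh t * n1"
    have n12: "n1\<^sup>2 + n2\<^sup>2 = N1\<^sup>2 + N2\<^sup>2"
      unfolding n1_def n2_def using sin_cos_squared_add[of x] by algebra
    have cy: "n\<^sup>2 - n2\<^sup>2 = 1 + y\<^sup>2"
      unfolding n_def y_def using n12 N(1) cosh_square_eq[of t] by algebra
    have "n > 0"
    proof -
      have "n1\<^sup>2 < N0\<^sup>2" using n12 N(1) by (smt (verit) zero_le_power2)
      then have n1: "\<bar>n1\<bar> < N0" using N(2) by (metis abs_of_pos power2_abs power2_less_imp_less less_imp_le)
      have "\<bar>sinh t\<bar> < cosh t"
      proof -
        have "(sinh t)\<^sup>2 < (cosh t)\<^sup>2" by (simp add: cosh_square_eq)
        then show ?thesis by (metis cosh_real_nonneg power2_abs power2_less_imp_less)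
      qed
      then have "\<bar>sinh t\<bar> * \<bar>n1\<bar> < cosh t * N0" using n1 by (intro mult_strict_mono') auto
      moreover have "sinh t * n1 \<le> \<bar>sinh t\<bar> * \<bar>n1\<bar>" by (metis abs_ge_self abs_mult)
      ultimately show ?thesis by (simp add: n_def mult.commute)
    qed
    have "\<bar>n2\<bar> \<le> n"
    proof -
      have "n2\<^sup>2 \<le> n\<^sup>2" using cy by (smt (verit) zero_le_power2)
      then show ?thesis using \<open>n > 0\<close> by (metis abs_le_square_iff abs_of_pos)
    qed
    from reverse_cauchy_schwarz[OF this causal']
    have steep: "sqrt (1 + y\<^sup>2) * sqrt (t'\<^sup>2 - (cosh t * x')\<^sup>2) \<le> n * t' - n2 * (cosh t * x')"
      by (simp add: cy)
    define F where "F = (\<lambda>s. N0 * sinh (k * fst (c s))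
      - cosh (k * fst (c s)) * (N1 * cos (k * snd (c s)) + N2 * sin (k * snd (c s))))"
    have dF: "(F has_real_derivative k * (n * t' - n2 * (cosh t * x'))) (at s)"
      unfolding F_def
      by (auto intro!: derivative_eq_intros dt dx simp: n_def n1_def n2_def t_def x_def algebra_simps)
    have Fs: "F s = y" by (simp add: F_def y_def n1_def t_def x_def)
    have "((\<lambda>s. arsinh (F s) / k) has_real_derivative
        (1 / sqrt ((F s)\<^sup>2 + 1) * (k * (n * t' - n2 * (cosh t * x')))) / k) (at s)"
      using dF k by (intro DERIV_cdivide DERIV_chain2[OF arsinh_real_has_field_derivative]) auto
    moreover have "(1 / sqrt ((F s)\<^sup>2 + 1) * (k * (n * t' - n2 * (cosh t * x')))) / k =
        (n * t' - n2 * (cosh t * x')) / sqrt (1 + y\<^sup>2)"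
      using k by (simp add: Fs add.commute)
    moreover have "(\<lambda>s. \<Phi> (c s)) = (\<lambda>s. arsinh (F s) / k)"
      by (simp add: \<Phi>_def F_def k_def)
    ultimately have der: "((\<lambda>s. \<Phi> (c s)) has_real_derivative (n * t' - n2 * (cosh t * x')) / sqrt (1 + y\<^sup>2)) (at s)"
      by simp
    have "0 < sqrt (1 + y\<^sup>2)" by (simp add: add_pos_nonneg)
    then have "sqrt (t'\<^sup>2 - (cosh t * x')\<^sup>2) \<le> (n * t' - n2 * (cosh t * x')) / sqrt (1 + y\<^sup>2)"
      using steep by (simp add: pos_le_divide_eq mult.commute)
    with der show "\<exists>d. ((\<lambda>s. \<Phi> (c s)) has_real_derivative d) (at s) \<and>
      sqrt (- model_g K (c s) (t', x')) \<le> d"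
      unfolding g by auto
  qed
qed

text \<open>The equation for D says that cosh (k D) is the inner product of the position vectors.
  The geodesic between them attains D, and the time function of its initial unit tangent N bounds
  every other curve. The bound on r places both points where the first spatial coordinate is
  positive, so that \<open>arctan\<close> recovers x.\<close>

lemma de_sitter_tau:
  assumes "K > 0" and "s < t" and r: "\<bar>sqrt K * r\<bar> < pi / 2" and "D > 0"
    and D: "cosh (sqrt K * D) = cosh (sqrt K * s) * cosh (sqrt K * t) * cos (sqrt K * r)
      - sinh (sqrt K * s) * sinh (sqrt K * t)"
  shows "tau_model K (s, 0) (t, r) = ereal D \<and>
    (\<exists>a b c. model_fd_causal K a b c \<and> c a = (s, 0) \<and> c b = (t, r) \<and> model_len K a b c = D)"
proof -
  define k where "k = sqrt K"
  have k: "k > 0" using \<open>K > 0\<close> by (simp add: k_def)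
  define a0 where "a0 = sinh (k * s)"
  define a1 where "a1 = cosh (k * s)"
  define b0 where "b0 = sinh (k * t)"
  define b1 where "b1 = cosh (k * t) * cos (k * r)"
  define b2 where "b2 = cosh (k * t) * sin (k * r)"
  define P where "P = cosh (k * D)"
  define Q where "Q = sinh (k * D)"
  have Q: "Q > 0" using k \<open>D > 0\<close> by (simp add: Q_def)
  have PQ: "P\<^sup>2 = 1 + Q\<^sup>2" by (simp add: P_def Q_def cosh_square_eq)
  have P1: "P \<ge> 1" by (simp add: P_def cosh_real_ge_1)
  have P: "P = a1 * b1 - a0 * b0"
    using D by (simp add: P_def a0_def a1_def b0_def b1_def k_def mult.assoc)
  have A: "a1\<^sup>2 = 1 + a0\<^sup>2" by (simp add: a0_def a1_def cosh_square_eq)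
  have B: "b1\<^sup>2 + b2\<^sup>2 = 1 + b0\<^sup>2"
    unfolding b0_def b1_def b2_def using cosh_square_eq[of "k * t"] sin_cos_squared_add[of "k * r"] by algebra
  have a1: "a1 > 0" by (simp add: a1_def)
  have cosr: "cos (k * r) > 0" using r by (intro cos_gt_zero_pi) (auto simp: k_def)
  have b1: "b1 > 0" using cosr by (simp add: b1_def)
  have ab: "a0 < b0" using \<open>s < t\<close> k by (simp add: a0_def b0_def)
  have Ple: "P \<le> cosh (k * t - k * s)"
  proof -
    have "cosh (k * s) * cosh (k * t) * cos (k * r) \<le> cosh (k * s) * cosh (k * t) * 1"
      by (intro mult_left_mono) auto
    then show ?thesis by (simp add: P a0_def a1_def b0_def b1_def cosh_diff mult.commute mult.left_commute)
  qed
  have shpos: "sinh (k * t - k * s) > 0" using \<open>s < t\<close> k by simp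
  \<comment> \<open>\<open>Pa\<close> makes N future directed, since N0 Q = b0 - P a0;
    \<open>Pb\<close> is the corresponding fact at the far end and serves the monotonicity of time
    along the geodesic.\<close>
  have Pa: "P * a0 < b0"
  proof (cases "a0 \<le> 0")
    case True
    then have "P * a0 \<le> 1 * a0" using P1 by (intro mult_right_mono_neg)
    then show ?thesis using ab by simp
  next
    case False
    have "b0 = sinh (k * t - k * s) * a1 + cosh (k * t - k * s) * a0"
      using sinh_add[of "k * t - k * s" "k * s"] by (simp add: b0_def a1_def a0_def)
    moreover have "P * a0 \<le> cosh (k * t - k * s) * a0" using Ple False by (intro mult_right_mono) auto
    moreover have "sinh (k * t - k * s) * a1 > 0" using shpos a1 by simp
    ultimately show ?thesis by simp
  qed
  have Pb: "a0 < P * b0"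
  proof (cases "b0 \<ge> 0")
    case True
    then have "1 * b0 \<le> P * b0" using P1 by (intro mult_right_mono)
    then show ?thesis using ab by simp
  next
    case False
    have "a0 = cosh (k * t - k * s) * b0 - sinh (k * t - k * s) * cosh (k * t)"
      using sinh_diff[of "k * t" "k * t - k * s"] by (simp add: b0_def a0_def algebra_simps)
    moreover have "cosh (k * t - k * s) * b0 \<le> P * b0" using Ple False by (intro mult_right_mono_neg) auto
    moreover have "sinh (k * t - k * s) * cosh (k * t) > 0" using shpos by simp
    ultimately show ?thesis by simp
  qed
  \<comment> \<open>N is the component of the end vector orthogonal to the initial vector,
    normalised: the unit tangent of the geodesic at its start. Its time function is 0 at the start
    and arsinh Q / k = D at the end.\<close>
  define N0 where "N0 = (b0 - P * a0) / Q"
  define N1 where "N1 = (b1 - P * a1) / Q"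
  define N2 where "N2 = b2 / Q"
  have N0: "N0 > 0" using Pa Q by (simp add: N0_def)
  have NQ: "N0 * Q = b0 - P * a0" "N1 * Q = b1 - P * a1" "N2 * Q = b2"
    using Q by (simp_all add: N0_def N1_def N2_def)
  have "(N0 * Q)\<^sup>2 = (1 + N1\<^sup>2 + N2\<^sup>2) * Q\<^sup>2"
  proof -
    have "(N0 * Q)\<^sup>2 = Q\<^sup>2 + (N1 * Q)\<^sup>2 + (N2 * Q)\<^sup>2"
      unfolding NQ using PQ P A B by algebra
    then show ?thesis by (simp add: algebra_simps power_mult_distrib)
  qed
  then have N: "N0\<^sup>2 = 1 + N1\<^sup>2 + N2\<^sup>2" using Q by (simp add: power_mult_distrib)
  have upper: "model_len K a b c \<le> D"
    if "model_fd_causal K a b c" "c a = (s, 0)" "c b = (t, r)" for a b c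
  proof -
    have "N0 * a0 - a1 * N1 = 0"
    proof -
      have "(N0 * a0 - a1 * N1) * Q = (N0 * Q) * a0 - a1 * (N1 * Q)" by (simp add: algebra_simps)
      also have "\<dots> = 0" unfolding NQ using P A by algebra
      finally show ?thesis using Q by simp
    qed
    moreover have "N0 * b0 - (N1 * b1 + N2 * b2) = Q"
    proof -
      have "(N0 * b0 - (N1 * b1 + N2 * b2)) * Q = (N0 * Q) * b0 - (N1 * Q) * b1 - (N2 * Q) * b2"
        by (simp add: algebra_simps)
      also have "\<dots> = Q * Q" unfolding NQ using P B PQ by algebra
      finally show ?thesis using Q by simp
    qed
    ultimately show ?thesis
      using de_sitter_length_le[OF \<open>K > 0\<close> N N0 that(1)] that(2,3) k
      by (simp add: a0_def a1_def b0_def b1_def b2_def Q_def k_def arsinh_sinh_real algebra_simps)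
  qed
  \<comment> \<open>Coefficients of the geodesic with respect to the two position vectors. Primed
    quantities are derivatives divided by k, which removes k from the algebraic identities.\<close>
  define p where "p = (\<lambda>u. sinh (k * (D - u)) / Q)"
  define q where "q = (\<lambda>u. sinh (k * u) / Q)"
  define p' where "p' = (\<lambda>u. - cosh (k * (D - u)) / Q)"
  define q' where "q' = (\<lambda>u. cosh (k * u) / Q)"
  have dp: "(p has_real_derivative k * p' u) (at u)" and dq: "(q has_real_derivative k * q' u) (at u)" for u
    unfolding p_def q_def p'_def q'_def using Q by (auto intro!: derivative_eq_intros)
  have ids: "(p u)\<^sup>2 + (q u)\<^sup>2 + 2 * p u * q u * P = 1"
    "(p' u)\<^sup>2 + (q' u)\<^sup>2 + 2 * p' u * q' u * P = -1"
    "p u * p' u + q u * q' u + (p u * q' u + p' u * q u) * P = 0"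
    "p u * q' u - p' u * q u = 1 / Q" for u
  proof -
    have e: "p u * Q = sinh (k * D - k * u)" "q u * Q = sinh (k * u)" "p' u * Q = - cosh (k * D - k * u)"
      "q' u * Q = cosh (k * u)"
      using Q by (simp_all add: p_def q_def p'_def q'_def right_diff_distrib)
    note ids = slerp_identities[OF Q, of "p u" "cosh (k * u)" P "sinh (k * u)" "q u" "p' u" "1" "q' u"]
    show "(p u)\<^sup>2 + (q u)\<^sup>2 + 2 * p u * q u * P = 1"
      "(p' u)\<^sup>2 + (q' u)\<^sup>2 + 2 * p' u * q' u * P = -1"
      "p u * p' u + q u * q' u + (p u * q' u + p' u * q u) * P = 0"
      "p u * q' u - p' u * q u = 1 / Q"
      using ids e PQ cosh_square_eq[of "k * u"] by (simp_all add: P_def Q_def sinh_diff cosh_diff)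
  qed
  define Z0 where "Z0 = (\<lambda>u. p u * a0 + q u * b0)"
  define Z1 where "Z1 = (\<lambda>u. p u * a1 + q u * b1)"
  define Z2 where "Z2 = (\<lambda>u. q u * b2)"
  define Z0' where "Z0' = (\<lambda>u. p' u * a0 + q' u * b0)"
  define Z1' where "Z1' = (\<lambda>u. p' u * a1 + q' u * b1)"
  define Z2' where "Z2' = (\<lambda>u. q' u * b2)"
  have dZ: "(Z0 has_real_derivative k * Z0' u) (at u)" "(Z1 has_real_derivative k * Z1' u) (at u)"
    "(Z2 has_real_derivative k * Z2' u) (at u)" for u
    unfolding Z0_def Z1_def Z2_def Z0'_def Z1'_def Z2'_def
    by (auto intro!: derivative_eq_intros dp dq simp: algebra_simps)
  have ZZ: "(Z1 u)\<^sup>2 + (Z2 u)\<^sup>2 = 1 + (Z0 u)\<^sup>2" "(Z1' u)\<^sup>2 + (Z2' u)\<^sup>2 = (Z0' u)\<^sup>2 - 1"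
    "Z1 u * Z1' u + Z2 u * Z2' u = Z0 u * Z0' u" for u
    unfolding Z0_def Z1_def Z2_def Z0'_def Z1'_def Z2'_def using ids[of u] P A B by algebra+
  \<comment> \<open>\<open>W\<close> is the numerator of the angular velocity; its square follows
    from the Lagrange identity and the three relations \<open>ZZ\<close>.\<close>
  define W where "W = (\<lambda>u. Z2' u * Z1 u - Z2 u * Z1' u)"
  have W2: "(W u)\<^sup>2 = (Z0' u)\<^sup>2 - 1 - (Z0 u)\<^sup>2" for u
    unfolding W_def using ZZ[of u] by algebra
  have rng: "0 \<le> p u" "0 \<le> q u" "0 < p u + q u" "0 < q' u" "q' u * Q \<le> P" "0 < - p' u" "- p' u * Q \<le> P"
    "1 \<le> q' u * Q" "1 \<le> - p' u * Q"
    if "u \<in> {0..D}" for u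
  proof -
    have u: "0 \<le> k * u" "k * u \<le> k * D" "0 \<le> k * (D - u)" "k * (D - u) \<le> k * D" using that k by auto
    show "0 \<le> p u" "0 \<le> q u" "0 < q' u" "0 < - p' u" using u Q k \<open>D > 0\<close> by (auto simp: p_def q_def p'_def q'_def)
    show "q' u * Q \<le> P" "- p' u * Q \<le> P" using u Q by (auto simp: p'_def q'_def P_def cosh_real_nonneg_le_iff)
    show "1 \<le> q' u * Q" "1 \<le> - p' u * Q" using Q by (auto simp: p'_def q'_def cosh_real_ge_1)
    have "0 < p u \<or> 0 < q u" using that k Q \<open>D > 0\<close> by (cases "u = 0") (auto simp: p_def q_def)
    then show "0 < p u + q u" using \<open>0 \<le> p u\<close> \<open>0 \<le> q u\<close> by linarith
  qed
  have Z1pos: "Z1 u > 0" if "u \<in> {0..D}" for u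
  proof -
    have "min a1 b1 * (p u + q u) \<le> Z1 u"
    proof -
      have "min a1 b1 * p u \<le> a1 * p u" "min a1 b1 * q u \<le> b1 * q u"
        by (rule mult_right_mono; use rng[OF that] in simp)+
      then show ?thesis by (simp add: Z1_def algebra_simps)
    qed
    moreover have "min a1 b1 * (p u + q u) > 0" using a1 b1 rng[OF that] by simp
    ultimately show ?thesis by simp
  qed
  \<comment> \<open>The factors q' Q and - p' Q lie between 1 and P, so each sign pattern of
    \<open>a0\<close> and \<open>b0\<close> reduces to \<open>Pa\<close>, \<open>Pb\<close> or
    \<open>a0\<close> < \<open>b0\<close>.\<close>
  have Z0'pos: "Z0' u > 0" if u: "u \<in> {0..D}" for u
  proof -
    have "0 < (q' u * Q) * b0 - (- p' u * Q) * a0"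
    proof (cases "a0 > 0")
      case True
      have "(- p' u * Q) * a0 \<le> P * a0" using rng[OF u] True by (intro mult_right_mono) auto
      moreover have "1 * b0 \<le> (q' u * Q) * b0" using rng[OF u] True ab by (intro mult_right_mono) auto
      ultimately show ?thesis using Pa by simp
    next
      case False
      then have 1: "(- p' u * Q) * a0 \<le> 1 * a0" using rng[OF u] by (intro mult_right_mono_neg) auto
      show ?thesis
      proof (cases "b0 < 0")
        case True
        have "P * b0 \<le> (q' u * Q) * b0" using rng[OF u] True by (intro mult_right_mono_neg) auto
        then show ?thesis using 1 Pb by simp
      next
        case False
        then have "1 * b0 \<le> (q' u * Q) * b0" using rng[OF u] by (intro mult_right_mono) auto
        then show ?thesis using 1 ab by simp
      qed
    qed
    then have "0 < Z0' u * Q" by (simp add: Z0'_def algebra_simps)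
    then show ?thesis using Q by (simp add: zero_less_mult_iff)
  qed
  have ends: "p 0 = 1" "q 0 = 0" "p D = 0" "q D = 1"
    using Q by (simp_all add: p_def q_def flip: Q_def)
  \<comment> \<open>The coordinates are recovered from sinh (k T) = Z0 and tan (k X) = Z2 /
    Z1.\<close>
  define T where "T = (\<lambda>u. arsinh (Z0 u) / k)"
  define X where "X = (\<lambda>u. arctan (Z2 u / Z1 u) / k)"
  define T' where "T' = (\<lambda>u. Z0' u / sqrt (1 + (Z0 u)\<^sup>2))"
  define X' where "X' = (\<lambda>u. W u / (1 + (Z0 u)\<^sup>2))"
  have dT: "(T has_real_derivative T' u) (at u)" for u
  proof -
    have "(T has_real_derivative (1 / sqrt ((Z0 u)\<^sup>2 + 1) * (k * Z0' u)) / k) (at u)"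
      unfolding T_def using k by (intro DERIV_cdivide DERIV_chain2[OF arsinh_real_has_field_derivative] dZ)
    then show ?thesis using k by (simp add: T'_def add.commute)
  qed
  have dX: "(X has_real_derivative X' u) (at u)" if u: "u \<in> {0..D}" for u
  proof -
    have "Z1 u \<noteq> 0" using Z1pos[OF u] by simp
    from DERIV_polar_angle[OF dZ(2,3) this] k show ?thesis
      by (simp add: X_def X'_def W_def ZZ(1))
  qed
  have contZ: "continuous_on {0..D} Z0" "continuous_on {0..D} Z0'" "continuous_on {0..D} W"
    unfolding Z0_def Z0'_def W_def Z1_def Z2_def Z1'_def Z2'_def p_def q_def p'_def q'_def
    using Q by (auto intro!: continuous_intros)
  have pos1: "1 + (Z0 u)\<^sup>2 > 0" for u by (simp add: add_pos_nonneg)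
  have T'X': "continuous_on {0..D} T'" "continuous_on {0..D} X'"
      unfolding T'_def X'_def using contZ pos1 by (auto intro!: continuous_intros simp: less_imp_neq[OF pos1, symmetric])
  have unit: "model_g K (T u, X u) (T' u, X' u) = -1" if "u \<in> {0..D}" for u
    proof -
      have "k * T u = arsinh (Z0 u)" using k by (simp add: T_def)
      then have "(cosh (k * T u))\<^sup>2 = 1 + (Z0 u)\<^sup>2" by (simp add: cosh_square_eq)
      moreover have "(T' u)\<^sup>2 = (Z0' u)\<^sup>2 / (1 + (Z0 u)\<^sup>2)"
        using pos1[of u] by (simp add: T'_def power_divide)
      moreover have "(1 + (Z0 u)\<^sup>2) * (X' u)\<^sup>2 = (W u)\<^sup>2 / (1 + (Z0 u)\<^sup>2)"
        using pos1[of u] by (simp add: X'_def power_divide power2_eq_square)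
      ultimately have "model_g K (T u, X u) (T' u, X' u) = ((W u)\<^sup>2 - (Z0' u)\<^sup>2) / (1 + (Z0 u)\<^sup>2)"
        using \<open>K > 0\<close> by (simp add: model_g_def k_def diff_divide_distrib)
      also have "(W u)\<^sup>2 - (Z0' u)\<^sup>2 = (-1) * (1 + (Z0 u)\<^sup>2)" by (simp add: W2)
      also have "\<dots> / (1 + (Z0 u)\<^sup>2) = -1" using pos1[of u] by (intro nonzero_mult_div_cancel_right) simp
      finally show ?thesis .
    qed
  have T'pos: "T' u > 0" if "u \<in> {0..D}" for u
      using Z0'pos[OF that] pos1[of u] by (simp add: T'_def)
  have "model_fd_causal K 0 D (\<lambda>u. (T u, X u)) \<and> model_len K 0 D (\<lambda>u. (T u, X u)) = D"
    using model_unit_curve[OF \<open>D > 0\<close> dT dX T'X' unit T'pos] by blast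
  moreover have "(T 0, X 0) = (s, 0)"
    using k Q by (simp add: T_def X_def Z0_def Z1_def Z2_def ends a0_def arsinh_sinh_real)
  moreover have "(T D, X D) = (t, r)"
  proof -
    have "b2 / b1 = tan (k * r)" by (simp add: b1_def b2_def tan_def)
    moreover have "arctan (tan (k * r)) = k * r" using r by (intro arctan_tan) (auto simp: k_def)
    ultimately show ?thesis
      using k Q by (simp add: T_def X_def Z0_def Z1_def Z2_def ends b0_def arsinh_sinh_real)
  qed
  ultimately have curve: "model_fd_causal K 0 D (\<lambda>u. (T u, X u))" "model_len K 0 D (\<lambda>u. (T u, X u)) = D"
    "(\<lambda>u. (T u, X u)) 0 = (s, 0)" "(\<lambda>u. (T u, X u)) D = (t, r)" by auto
  show ?thesis
    using tau_model_eqI[OF upper curve(1,3,4,2)] curve by blast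
qed

section \<open>The flat model\<close>

lemma minkowski_tau:
  assumes "s < t" and "D > 0" and D: "D\<^sup>2 = (t - s)\<^sup>2 - r\<^sup>2"
  shows "tau_model 0 (s, 0) (t, r) = ereal D \<and>
    (\<exists>a b c. model_fd_causal 0 a b c \<and> c a = (s, 0) \<and> c b = (t, r) \<and> model_len 0 a b c = D)"
proof -
  \<comment> \<open>The unit tangent of the straight segment, whose associated time function is
    linear.\<close>
  define N0 where "N0 = (t - s) / D"
  define N1 where "N1 = r / D"
  have ND: "N0 * D = t - s" "N1 * D = r" using \<open>D > 0\<close> by (auto simp: N0_def N1_def)
  have "(N0\<^sup>2 - N1\<^sup>2) * D\<^sup>2 = (N0 * D)\<^sup>2 - (N1 * D)\<^sup>2" by (simp add: algebra_simps power_mult_distrib)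
  also have "\<dots> = 1 * D\<^sup>2" by (simp add: ND D)
  finally have N: "N0\<^sup>2 - N1\<^sup>2 = 1" using \<open>D > 0\<close> by simp
  have N0: "N0 > 0" using assms by (simp add: N0_def)
  have "N1\<^sup>2 \<le> N0\<^sup>2" using N by simp
  then have N10: "\<bar>N1\<bar> \<le> N0" using N0 by (metis abs_le_square_iff abs_of_pos)
  have upper: "model_len 0 a b c \<le> D"
    if c: "model_fd_causal 0 a b c" and ends: "c a = (s, 0)" "c b = (t, r)" for a b c
  proof -
    have "model_len 0 a b c \<le> (N0 * fst (c b) - N1 * snd (c b)) - (N0 * fst (c a) - N1 * snd (c a))"
    proof (rule model_len_le[OF c, where \<Phi> = "\<lambda>p. N0 * fst p - N1 * snd p"])
      assume cont: "continuous_on {a..b} c"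
      show "continuous_on {a..b} (\<lambda>s. N0 * fst (c s) - N1 * snd (c s))"
        using cont by (auto intro!: continuous_intros)
    next
      fix u t' x'
      assume dt: "((\<lambda>s. fst (c s)) has_real_derivative t') (at u)"
        and dx: "((\<lambda>s. snd (c s)) has_real_derivative x') (at u)"
        and le: "model_g 0 (c u) (t', x') \<le> 0" and t': "t' > 0"
      have g: "model_g 0 (c u) (t', x') = - (t'\<^sup>2) + x'\<^sup>2"
        by (simp add: model_g_def)
      have "x'\<^sup>2 \<le> t'\<^sup>2" using le g by simp
      then have "\<bar>x'\<bar> \<le> t'" using t' by (metis abs_le_square_iff abs_of_pos)
      from reverse_cauchy_schwarz[OF N10 this]
      have "sqrt (t'\<^sup>2 - x'\<^sup>2) \<le> N0 * t' - N1 * x'" by (simp add: N)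
      moreover have "((\<lambda>s. N0 * fst (c s) - N1 * snd (c s)) has_real_derivative N0 * t' - N1 * x') (at u)"
        using dt dx by (auto intro!: derivative_eq_intros)
      ultimately show "\<exists>d. ((\<lambda>s. N0 * fst (c s) - N1 * snd (c s)) has_real_derivative d) (at u) \<and>
        sqrt (- model_g 0 (c u) (t', x')) \<le> d"
        unfolding g by auto
    qed
    also have "\<dots> = N0 * (t - s) - N1 * r" by (simp add: ends algebra_simps)
    also have "\<dots> = (N0\<^sup>2 - N1\<^sup>2) * D" by (simp add: ND[symmetric] power2_eq_square algebra_simps)
    finally show ?thesis by (simp add: N)
  qed
  have "model_fd_causal 0 0 D (\<lambda>u. (s + N0 * u, N1 * u)) \<and> model_len 0 0 D (\<lambda>u. (s + N0 * u, N1 * u)) = D"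
    by (intro conjI model_unit_curve[OF \<open>D > 0\<close>, where t' = "\<lambda>_. N0" and x' = "\<lambda>_. N1"])
      (use N N0 in \<open>auto intro!: derivative_eq_intros simp: model_g_def\<close>)
  moreover have "(s + N0 * 0, N1 * 0) = (s, 0)" "(s + N0 * D, N1 * D) = (t, r)" by (simp_all add: ND)
  ultimately have curve: "model_fd_causal 0 0 D (\<lambda>u. (s + N0 * u, N1 * u))"
    "model_len 0 0 D (\<lambda>u. (s + N0 * u, N1 * u)) = D"
    "(\<lambda>u. (s + N0 * u, N1 * u)) 0 = (s, 0)" "(\<lambda>u. (s + N0 * u, N1 * u)) D = (t, r)" by auto
  show ?thesis
    using tau_model_eqI[OF upper curve(1,3,4,2)] curve by blast
qed

section \<open>Causal curves and geodesics in negative curvature\<close>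

lemma stays_below_one:
  fixes Y :: "real \<Rightarrow> real"
  assumes "finite S" and cont: "continuous_on {a..b} Y"
    and der: "\<And>s. s \<in> {a<..<b} - S \<Longrightarrow> \<bar>Y s\<bar> < 1 \<Longrightarrow> \<exists>d\<ge>0. (Y has_real_derivative d) (at s)"
    and "Y b < 1" and s: "s \<in> {a..b}"
  shows "Y s < 1"
proof (rule ccontr)
  assume "\<not> Y s < 1"
  \<comment> \<open>The last parameter c with Y at least 1 exists by compactness. Shortly after c
    the values lie strictly between 0 and 1, where Y is nondecreasing, so Y cannot have dropped
    below 1.\<close>
  define E where "E = {a..b} \<inter> Y -` {1..}"
  have "closed E" unfolding E_def by (rule continuous_closed_preimage[OF cont]) auto
  moreover have "bounded E" unfolding E_def by (rule bounded_subset[of "{a..b}"]) auto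
  ultimately have "compact E" by (simp add: compact_eq_bounded_closed)
  moreover have "E \<noteq> {}" using s \<open>\<not> Y s < 1\<close> by (auto simp: E_def)
  ultimately obtain c where c: "c \<in> E" "\<And>u. u \<in> E \<Longrightarrow> u \<le> c"
    using compact_attains_sup[of E] by metis
  have cb: "a \<le> c" "c < b" "Y c \<ge> 1" using c(1) \<open>Y b < 1\<close> by (auto simp: E_def order_less_le)
  have after: "Y u < 1" if "c < u" "u \<le> b" for u
    using c(2)[of u] that cb by (force simp: E_def)
  have "continuous (at c within {a..b}) Y" using cont cb by (auto simp: continuous_on_eq_continuous_within)
  then obtain d where d: "d > 0" "\<And>u. u \<in> {a..b} \<Longrightarrow> dist u c < d \<Longrightarrow> dist (Y u) (Y c) < 1"
    unfolding continuous_within_eps_delta by (metis zero_less_one)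
  define c' where "c' = min (c + d / 2) b"
  have c': "c < c'" "c' \<le> b" "c' - c < d" using d cb by (auto simp: c'_def)
  have "Y c \<le> Y c'"
  proof (rule derivative_nonneg_mono[OF _ \<open>finite S\<close>, where G = Y])
    show "continuous_on {c..c'} Y" using cb c' by (intro continuous_on_subset[OF cont]) auto
    fix u assume u: "u \<in> {c<..<c'} - S"
    have "dist (Y u) (Y c) < 1" using u cb c' by (intro d) (auto simp: dist_real_def)
    moreover have "Y u < 1" using u c' by (intro after) auto
    ultimately have "\<bar>Y u\<bar> < 1" using cb(3) by (simp add: dist_real_def)
    then show "\<exists>d. (Y has_real_derivative d) (at u) \<and> 0 \<le> d" using der[of u] u cb c' by auto
  qed (use c' in simp)
  then show False using after[of c'] c' cb by simp
qed

text \<open>The function u to - Y (- u) satisfies the same hypotheses on the reflected interval, so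
  the lower bound is the upper bound for it.\<close>

lemma stays_in_unit_interval:
  fixes Y :: "real \<Rightarrow> real"
  assumes "finite S" and cont: "continuous_on {a..b} Y"
    and der: "\<And>s. s \<in> {a<..<b} - S \<Longrightarrow> \<bar>Y s\<bar> < 1 \<Longrightarrow> \<exists>d\<ge>0. (Y has_real_derivative d) (at s)"
    and "Y a > -1" "Y b < 1" and s: "s \<in> {a..b}"
  shows "\<bar>Y s\<bar> < 1"
proof -
  have "- Y (- (- s)) < 1"
  proof (rule stays_below_one[of "uminus ` S" "-b" "-a" "\<lambda>u. - Y (- u)"])
    show "continuous_on {- b..- a} (\<lambda>u. - Y (- u))"
      by (intro continuous_intros continuous_on_compose2[OF cont]) auto
    fix u assume u: "u \<in> {- b<..<- a} - uminus ` S" and Y: "\<bar>- Y (- u)\<bar> < 1"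
    have "- u \<notin> S" using u by (metis Diff_iff imageI minus_minus)
    then have "- u \<in> {a<..<b} - S" using u by auto
    then obtain d where d: "d \<ge> 0" "(Y has_real_derivative d) (at (- u))" using der[of "- u"] Y by auto
    have "((\<lambda>u. Y (- u)) has_real_derivative d * (- 1)) (at u)"
      by (rule DERIV_chain2[of Y d uminus u "-1"]) (use d in \<open>auto intro!: derivative_eq_intros\<close>)
    then have "((\<lambda>u. - Y (- u)) has_real_derivative d) (at u)" using DERIV_minus by fastforce
    then show "\<exists>d\<ge>0. ((\<lambda>u. - Y (- u)) has_real_derivative d) (at u)" using d by blast
  qed (use assms in auto)
  moreover have "Y s < 1" using stays_below_one[OF assms(1-3,5) s] .
  ultimately show ?thesis by simp
qed

text \<open>For \<open>K < 0\<close> the model is the universal cover of the quadric \<open>Z\<^sub>0\<^sup>2 + Z\<^sub>1\<^sup>2 - Z\<^sub>2\<^sup>2 = 1\<close> with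
  \<open>Z = (cosh kx cos kt, cosh kx sin kt, sinh kx)\<close>, and the time function is \<open>arcsin \<langle>N, Z\<rangle> / k\<close>.
  It only makes sense for \<open>\<bar>\<langle>N, Z\<rangle>\<bar> < 1\<close>, but a causal curve cannot leave this region and come back,
  since \<open>\<langle>N, Z\<rangle>\<close> increases along it there.\<close>

lemma anti_de_sitter_length_le:
  fixes N0 N1 N2 :: real
  assumes "K < 0" and N: "N0\<^sup>2 + N1\<^sup>2 = 1 + N2\<^sup>2"
    and c: "model_fd_causal K a b c"
    and future: "\<And>s. s \<in> {a..b} \<Longrightarrow>
      0 < N1 * cos (sqrt (- K) * fst (c s)) - N0 * sin (sqrt (- K) * fst (c s))"
  defines "y \<equiv> \<lambda>p. cosh (sqrt (- K) * snd p) * (N0 * cos (sqrt (- K) * fst p) + N1 * sin (sqrt (- K) * fst p))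
      - N2 * sinh (sqrt (- K) * snd p)"
  assumes ends: "y (c a) > -1" "y (c b) < 1"
  shows "model_len K a b c \<le> arcsin (y (c b)) / sqrt (- K) - arcsin (y (c a)) / sqrt (- K)"
proof -
  define k where "k = sqrt (- K)"
  have k: "k > 0" using \<open>K < 0\<close> by (simp add: k_def)
  obtain S where S: "finite S" "a < b" "continuous_on {a..b} c"
    "\<And>s. s \<in> {a<..<b} - S \<Longrightarrow>
      ((\<lambda>s. fst (c s)) has_real_derivative fst (vector_derivative c (at s))) (at s) \<and>
      ((\<lambda>s. snd (c s)) has_real_derivative snd (vector_derivative c (at s))) (at s) \<and>
      model_g K (c s) (vector_derivative c (at s)) \<le> 0 \<and> fst (vector_derivative c (at s)) > 0"
    using model_fd_causalD[OF c] by metis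
  define Y where "Y = (\<lambda>s. y (c s))"
  have Ycont: "continuous_on {a..b} Y"
    unfolding Y_def y_def using S(3) by (auto intro!: continuous_intros)
  have steep: "\<exists>d. (Y has_real_derivative k * d) (at s) \<and>
      sqrt (1 - (Y s)\<^sup>2) * sqrt (- model_g K (c s) (t', x')) \<le> d"
    if s: "s \<in> {a<..<b}" and Y1: "\<bar>Y s\<bar> < 1" and dt: "((\<lambda>s. fst (c s)) has_real_derivative t') (at s)"
      and dx: "((\<lambda>s. snd (c s)) has_real_derivative x') (at s)"
      and le: "model_g K (c s) (t', x') \<le> 0" and t': "t' > 0" for s t' x'
  proof -
    define t where "t = k * fst (c s)"
    define x where "x = k * snd (c s)"
    have g: "model_g K (c s) (t', x') = - ((cosh x * t')\<^sup>2) + x'\<^sup>2"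
      using \<open>K < 0\<close> by (simp add: model_g_def x_def k_def power_mult_distrib)
    have causal: "x'\<^sup>2 \<le> (cosh x * t')\<^sup>2" using le g by simp
    then have causal': "\<bar>x'\<bar> \<le> cosh x * t'" using t' by (metis abs_le_square_iff abs_of_pos cosh_real_pos mult_pos_pos)
    \<comment> \<open>\<open>cosh x * m2\<close> and \<open>n\<close> are the partial derivatives of
      the function in time and space, and the gradient has squared length - (1 - y^2). The
      assumption \<open>future\<close> is positivity of \<open>m2\<close>.\<close>
    define m1 where "m1 = N0 * cos t + N1 * sin t"
    define m2 where "m2 = N1 * cos t - N0 * sin t"
    define n where "n = sinh x * m1 - cosh x * N2"
    have m12: "m1\<^sup>2 + m2\<^sup>2 = 1 + N2\<^sup>2"
      unfolding m1_def m2_def using sin_cos_squared_add[of t] N by algebra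
    have Ys: "Y s = cosh x * m1 - N2 * sinh x"
      by (simp add: Y_def y_def m1_def t_def x_def k_def)
    have mc: "m2\<^sup>2 - (- n)\<^sup>2 = 1 - (Y s)\<^sup>2"
      unfolding n_def Ys using m12 cosh_square_eq[of x] by algebra
    have m2: "m2 > 0" using future[of s] s by (simp add: m2_def t_def k_def)
    have "(Y s)\<^sup>2 \<le> 1" using Y1 by (simp add: abs_square_le_1)
    then have "(- n)\<^sup>2 \<le> m2\<^sup>2" using mc by linarith
    then have "\<bar>- n\<bar> \<le> m2" using m2 by (metis abs_le_square_iff abs_of_pos)
    from reverse_cauchy_schwarz[OF this causal']
    have "sqrt (1 - (Y s)\<^sup>2) * sqrt ((cosh x * t')\<^sup>2 - x'\<^sup>2) \<le> m2 * (cosh x * t') + n * x'"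
      unfolding mc by simp
    moreover have "(Y has_real_derivative k * (m2 * (cosh x * t') + n * x')) (at s)"
      unfolding Y_def y_def k_def[symmetric]
      by (auto intro!: derivative_eq_intros dt dx simp: n_def m1_def m2_def t_def x_def algebra_simps)
    ultimately show ?thesis unfolding g by auto
  qed
  have inside: "\<bar>Y s\<bar> < 1" if "s \<in> {a..b}" for s
  proof (rule stays_in_unit_interval[OF S(1) Ycont _ _ _ that])
    fix s assume s: "s \<in> {a<..<b} - S" "\<bar>Y s\<bar> < 1"
    note S4 = S(4)[OF s(1)]
    obtain d where d: "(Y has_real_derivative k * d) (at s)"
      "sqrt (1 - (Y s)\<^sup>2) * sqrt (- model_g K (c s) (vector_derivative c (at s))) \<le> d"
      using steep[of s "fst (vector_derivative c (at s))" "snd (vector_derivative c (at s))"] s S4 by auto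
    have "(Y s)\<^sup>2 \<le> 1" using s(2) by (simp add: abs_square_le_1)
    then have "0 \<le> sqrt (1 - (Y s)\<^sup>2) * sqrt (- model_g K (c s) (vector_derivative c (at s)))"
      using S4 by simp
    then have "0 \<le> k * d" using d(2) k by simp
    then show "\<exists>d\<ge>0. (Y has_real_derivative d) (at s)" using d(1) by blast
  qed (use ends in \<open>auto simp: Y_def\<close>)
  show ?thesis
  proof (rule model_len_le[OF c, where \<Phi> = "\<lambda>p. arcsin (y p) / sqrt (- K)"])
    show "continuous_on {a..b} (\<lambda>s. arcsin (y (c s)) / sqrt (- K))"
      using Ycont inside k unfolding Y_def k_def
      by (intro continuous_intros) (auto simp: abs_less_iff less_imp_le)
    fix s t' x'
    assume s: "s \<in> {a<..<b}" and vel: "((\<lambda>s. fst (c s)) has_real_derivative t') (at s)"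
      "((\<lambda>s. snd (c s)) has_real_derivative x') (at s)" "model_g K (c s) (t', x') \<le> 0" "t' > 0"
    have Y1: "\<bar>Y s\<bar> < 1" using s by (intro inside) auto
    obtain d where d: "(Y has_real_derivative k * d) (at s)"
      "sqrt (1 - (Y s)\<^sup>2) * sqrt (- model_g K (c s) (t', x')) \<le> d"
      using steep[OF s Y1 vel] by blast
    have pos: "sqrt (1 - (Y s)\<^sup>2) > 0" using Y1 by (simp add: abs_square_less_1)
    have "((\<lambda>s. arcsin (Y s) / k) has_real_derivative (inverse (sqrt (1 - (Y s)\<^sup>2)) * (k * d)) / k) (at s)"
      using Y1 by (intro DERIV_cdivide DERIV_chain2[OF DERIV_arcsin d(1)]) auto
    moreover have "(inverse (sqrt (1 - (Y s)\<^sup>2)) * (k * d)) / k = d / sqrt (1 - (Y s)\<^sup>2)"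
      using k by (simp add: divide_inverse mult.commute)
    moreover have "sqrt (- model_g K (c s) (t', x')) \<le> d / sqrt (1 - (Y s)\<^sup>2)"
      using d(2) pos by (simp add: pos_le_divide_eq mult.commute)
    ultimately show "\<exists>d. ((\<lambda>s. arcsin (y (c s)) / sqrt (- K)) has_real_derivative d) (at s) \<and>
      sqrt (- model_g K (c s) (t', x')) \<le> d"
      by (auto simp: Y_def k_def)
  qed
qed

text \<open>As for positive curvature, with cos (k D) as the inner product of the position vectors.
  The bounds on s and t place both points where Z0 is positive and \<open>arctan\<close> recovers t;
  the bound on D gives P > 0 and Q < 1, which keep the time function within the range of
  \<open>arcsin\<close>.\<close>

lemma anti_de_sitter_tau:
  assumes "K < 0" and "s < t" and st: "\<bar>sqrt (- K) * s\<bar> < pi / 2" "\<bar>sqrt (- K) * t\<bar> < pi / 2"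
    and "D > 0" and Dpi: "sqrt (- K) * D < pi / 2"
    and D: "cos (sqrt (- K) * D) = cosh (sqrt (- K) * r) * cos (sqrt (- K) * t - sqrt (- K) * s)"
  shows "tau_model K (s, 0) (t, r) = ereal D \<and>
    (\<exists>a b c. model_fd_causal K a b c \<and> c a = (s, 0) \<and> c b = (t, r) \<and> model_len K a b c = D)"
proof -
  define k where "k = sqrt (- K)"
  have k: "k > 0" using \<open>K < 0\<close> by (simp add: k_def)
  define a0 where "a0 = cos (k * s)"
  define a1 where "a1 = sin (k * s)"
  define b0 where "b0 = cosh (k * r) * cos (k * t)"
  define b1 where "b1 = cosh (k * r) * sin (k * t)"
  define b2 where "b2 = sinh (k * r)"
  define P where "P = cos (k * D)"
  define Q where "Q = sin (k * D)"
  have kD: "0 < k * D" "k * D < pi / 2" using k \<open>D > 0\<close> Dpi by (auto simp: k_def)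
  have Q: "Q > 0" using kD by (auto simp: Q_def intro!: sin_gt_zero)
  have P0: "P > 0" using kD by (auto simp: P_def intro!: cos_gt_zero)
  have PQ: "P\<^sup>2 + Q\<^sup>2 = 1" by (simp add: P_def Q_def)
  have P: "P = a0 * b0 + a1 * b1"
    using D by (simp add: P_def a0_def a1_def b0_def b1_def k_def cos_diff algebra_simps)
  have A: "a0\<^sup>2 + a1\<^sup>2 = 1" by (simp add: a0_def a1_def)
  have B: "b0\<^sup>2 + b1\<^sup>2 = 1 + b2\<^sup>2"
    unfolding b0_def b1_def b2_def using cosh_square_eq[of "k * r"] sin_cos_squared_add[of "k * t"] by algebra
  have a0: "a0 > 0" using st by (auto simp: a0_def k_def intro!: cos_gt_zero_pi)
  have b0: "b0 > 0" using st by (auto simp: b0_def k_def intro!: mult_pos_pos cos_gt_zero_pi)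
  have kst: "0 < k * t - k * s" "k * t - k * s < pi" using \<open>s < t\<close> k st by (auto simp: k_def abs_less_iff)
  have w: "a0 * b1 - a1 * b0 = cosh (k * r) * sin (k * t - k * s)"
    by (simp add: a0_def a1_def b0_def b1_def sin_diff algebra_simps)
  have wpos: "a0 * b1 - a1 * b0 > 0" unfolding w using kst by (auto intro!: mult_pos_pos sin_gt_zero)
  define N0 where "N0 = (b0 - P * a0) / Q"
  define N1 where "N1 = (b1 - P * a1) / Q"
  define N2 where "N2 = b2 / Q"
  have NQ: "N0 * Q = b0 - P * a0" "N1 * Q = b1 - P * a1" "N2 * Q = b2"
    using Q by (simp_all add: N0_def N1_def N2_def)
  have "(N0\<^sup>2 + N1\<^sup>2) * Q\<^sup>2 = (1 + N2\<^sup>2) * Q\<^sup>2"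
  proof -
    have "(N0 * Q)\<^sup>2 + (N1 * Q)\<^sup>2 = Q\<^sup>2 + (N2 * Q)\<^sup>2"
      unfolding NQ using PQ P A B by algebra
    then show ?thesis by (simp add: algebra_simps power_mult_distrib)
  qed
  then have N: "N0\<^sup>2 + N1\<^sup>2 = 1 + N2\<^sup>2" using Q by simp
  have upper: "model_len K a b c \<le> D"
    if c: "model_fd_causal K a b c" and ends: "c a = (s, 0)" "c b = (t, r)" for a b c
  proof -
    have e0: "N0 * a0 + N1 * a1 = 0"
    proof -
      have "(N0 * a0 + N1 * a1) * Q = (N0 * Q) * a0 + (N1 * Q) * a1" by (simp add: algebra_simps)
      also have "\<dots> = 0" unfolding NQ using P A by algebra
      finally show ?thesis using Q by simp
    qed
    have e1: "N0 * b0 + N1 * b1 - N2 * b2 = Q"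
    proof -
      have "(N0 * b0 + N1 * b1 - N2 * b2) * Q = (N0 * Q) * b0 + (N1 * Q) * b1 - (N2 * Q) * b2"
        by (simp add: algebra_simps)
      also have "\<dots> = Q * Q" unfolding NQ using P B PQ by algebra
      finally show ?thesis using Q by simp
    qed
    have Q1: "Q < 1"
    proof -
      have "Q\<^sup>2 < 1" using PQ P0 by (smt (verit) zero_less_power)
      then show ?thesis using Q by (simp add: power_less_one_iff)
    qed
    have "model_len K a b c \<le>
      arcsin (cosh (k * snd (c b)) * (N0 * cos (k * fst (c b)) + N1 * sin (k * fst (c b))) - N2 * sinh (k * snd (c b))) / k -
      arcsin (cosh (k * snd (c a)) * (N0 * cos (k * fst (c a)) + N1 * sin (k * fst (c a))) - N2 * sinh (k * snd (c a))) / k"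
    proof (rule anti_de_sitter_length_le[OF \<open>K < 0\<close> N c, folded k_def])
      fix u assume u: "u \<in> {a..b}"
      define \<theta> where "\<theta> = k * fst (c u)"
      have \<theta>: "k * s \<le> \<theta>" "\<theta> \<le> k * t"
        using model_time_mono[OF c, of a u] model_time_mono[OF c, of u b] u ends k by (auto simp: \<theta>_def)
      \<comment> \<open>The height along the curve stays between those of its ends, and there the
        time derivative is a positive combination of two sines of angles in [0, pi).\<close>
      have "(N1 * cos \<theta> - N0 * sin \<theta>) * Q = (N1 * Q) * cos \<theta> - (N0 * Q) * sin \<theta>" by (simp add: algebra_simps)
      also have "\<dots> = cosh (k * r) * sin (k * t - \<theta>) + P * sin (\<theta> - k * s)"
        unfolding NQ by (simp add: a0_def a1_def b0_def b1_def sin_diff algebra_simps)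
      also have "\<dots> > 0"
      proof (cases "\<theta> = k * t")
        case True
        then show ?thesis using P0 kst by (auto intro!: mult_pos_pos sin_gt_zero)
      next
        case False
        have "sin (k * t - \<theta>) > 0" using False \<theta> kst by (intro sin_gt_zero) auto
        moreover have "sin (\<theta> - k * s) \<ge> 0" using \<theta> kst by (intro sin_ge_zero) auto
        ultimately show ?thesis using P0 by (intro add_pos_nonneg mult_pos_pos mult_nonneg_nonneg) auto
      qed
      finally show "0 < N1 * cos (k * fst (c u)) - N0 * sin (k * fst (c u))"
        using Q by (simp add: \<theta>_def zero_less_mult_iff)
    qed (use e0 e1 Q1 in \<open>auto simp: ends a0_def a1_def b0_def b1_def b2_def algebra_simps\<close>)
    also have "\<dots> = arcsin Q / k"
    proof -
      have "cosh (k * snd (c b)) * (N0 * cos (k * fst (c b)) + N1 * sin (k * fst (c b))) - N2 * sinh (k * snd (c b)) = Q"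
        using e1 by (simp add: ends b0_def b1_def b2_def algebra_simps)
      moreover have "cosh (k * snd (c a)) * (N0 * cos (k * fst (c a)) + N1 * sin (k * fst (c a))) - N2 * sinh (k * snd (c a)) = 0"
        using e0 by (simp add: ends a0_def a1_def)
      ultimately show ?thesis by simp
    qed
    also have "\<dots> = D" using kD k by (simp add: Q_def arcsin_sin)
    finally show ?thesis .
  qed
  define p where "p = (\<lambda>u. sin (k * (D - u)) / Q)"
  define q where "q = (\<lambda>u. sin (k * u) / Q)"
  define p' where "p' = (\<lambda>u. - cos (k * (D - u)) / Q)"
  define q' where "q' = (\<lambda>u. cos (k * u) / Q)"
  have dp: "(p has_real_derivative k * p' u) (at u)" and dq: "(q has_real_derivative k * q' u) (at u)" for u
    unfolding p_def q_def p'_def q'_def using Q by (auto intro!: derivative_eq_intros)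
  have ids: "(p u)\<^sup>2 + (q u)\<^sup>2 + 2 * p u * q u * P = 1"
    "(p' u)\<^sup>2 + (q' u)\<^sup>2 + 2 * p' u * q' u * P = 1"
    "p u * p' u + q u * q' u + (p u * q' u + p' u * q u) * P = 0"
    "p u * q' u - p' u * q u = 1 / Q" for u
  proof -
    have e: "p u * Q = sin (k * D - k * u)" "q u * Q = sin (k * u)" "p' u * Q = - cos (k * D - k * u)"
      "q' u * Q = cos (k * u)"
      using Q by (simp_all add: p_def q_def p'_def q'_def right_diff_distrib)
    note ids = slerp_identities[OF Q, of "p u" "cos (k * u)" P "sin (k * u)" "q u" "p' u" "-1" "q' u"]
    show "(p u)\<^sup>2 + (q u)\<^sup>2 + 2 * p u * q u * P = 1"
      "(p' u)\<^sup>2 + (q' u)\<^sup>2 + 2 * p' u * q' u * P = 1"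
      "p u * p' u + q u * q' u + (p u * q' u + p' u * q u) * P = 0"
      "p u * q' u - p' u * q u = 1 / Q"
      using ids e by (simp_all add: P_def Q_def sin_diff cos_diff cos_squared_eq)
  qed
  define Z0 where "Z0 = (\<lambda>u. p u * a0 + q u * b0)"
  define Z1 where "Z1 = (\<lambda>u. p u * a1 + q u * b1)"
  define Z2 where "Z2 = (\<lambda>u. q u * b2)"
  define Z0' where "Z0' = (\<lambda>u. p' u * a0 + q' u * b0)"
  define Z1' where "Z1' = (\<lambda>u. p' u * a1 + q' u * b1)"
  define Z2' where "Z2' = (\<lambda>u. q' u * b2)"
  have dZ: "(Z0 has_real_derivative k * Z0' u) (at u)" "(Z1 has_real_derivative k * Z1' u) (at u)"
    "(Z2 has_real_derivative k * Z2' u) (at u)" for u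
    unfolding Z0_def Z1_def Z2_def Z0'_def Z1'_def Z2'_def
    by (auto intro!: derivative_eq_intros dp dq simp: algebra_simps)
  have ZZ: "(Z0 u)\<^sup>2 + (Z1 u)\<^sup>2 = 1 + (Z2 u)\<^sup>2" "(Z0' u)\<^sup>2 + (Z1' u)\<^sup>2 = 1 + (Z2' u)\<^sup>2"
    "Z0 u * Z0' u + Z1 u * Z1' u = Z2 u * Z2' u" for u
    unfolding Z0_def Z1_def Z2_def Z0'_def Z1'_def Z2'_def using ids[of u] P A B by algebra+
  define W where "W = (\<lambda>u. Z1' u * Z0 u - Z1 u * Z0' u)"
  have W2: "(W u)\<^sup>2 = 1 + (Z2 u)\<^sup>2 + (Z2' u)\<^sup>2" for u
    unfolding W_def using ZZ[of u] by algebra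
  \<comment> \<open>\<open>W\<close> is the determinant of position and velocity in the (Z0, Z1)
    plane, hence the coefficient determinant 1 / Q times that of the two end vectors; time therefore
    increases all along the geodesic.\<close>
  have Wpos: "W u > 0" for u
  proof -
    have "W u = (p u * q' u - p' u * q u) * (a0 * b1 - a1 * b0)"
      unfolding W_def Z0_def Z1_def Z0'_def Z1'_def by algebra
    then show ?thesis using wpos Q by (simp add: ids(4))
  qed
  have rng: "0 \<le> p u" "0 \<le> q u" "0 < p u + q u" if "u \<in> {0..D}" for u
  proof -
    have u: "0 \<le> k * u" "k * u \<le> k * D" "0 \<le> k * (D - u)" "k * (D - u) \<le> k * D" using that k by auto
    show 1: "0 \<le> p u" "0 \<le> q u" using u Q kD by (auto simp: p_def q_def intro!: divide_nonneg_pos sin_ge_zero)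
    have "0 < p u \<or> 0 < q u"
    proof (cases "u = 0")
      case True
      then show ?thesis using Q by (simp add: p_def Q_def)
    next
      case False
      then have "0 < k * u" using that k by simp
      then show ?thesis using u kD Q by (auto simp: q_def intro!: divide_pos_pos sin_gt_zero)
    qed
    then show "0 < p u + q u" using 1 by linarith
  qed
  have Z0pos: "Z0 u > 0" if "u \<in> {0..D}" for u
  proof -
    have "min a0 b0 * (p u + q u) \<le> Z0 u"
    proof -
      have "min a0 b0 * p u \<le> a0 * p u" "min a0 b0 * q u \<le> b0 * q u"
        by (rule mult_right_mono; use rng[OF that] in simp)+
      then show ?thesis by (simp add: Z0_def algebra_simps)
    qed
    moreover have "min a0 b0 * (p u + q u) > 0" using a0 b0 rng[OF that] by simp
    ultimately show ?thesis by simp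
  qed
  have ends: "p 0 = 1" "q 0 = 0" "p D = 0" "q D = 1"
    using Q by (simp_all add: p_def q_def flip: Q_def)
  define T where "T = (\<lambda>u. arctan (Z1 u / Z0 u) / k)"
  define X where "X = (\<lambda>u. arsinh (Z2 u) / k)"
  define T' where "T' = (\<lambda>u. W u / (1 + (Z2 u)\<^sup>2))"
  define X' where "X' = (\<lambda>u. Z2' u / sqrt (1 + (Z2 u)\<^sup>2))"
  have dX: "(X has_real_derivative X' u) (at u)" for u
  proof -
    have "(X has_real_derivative (1 / sqrt ((Z2 u)\<^sup>2 + 1) * (k * Z2' u)) / k) (at u)"
      unfolding X_def using k by (intro DERIV_cdivide DERIV_chain2[OF arsinh_real_has_field_derivative] dZ)
    then show ?thesis using k by (simp add: X'_def add.commute)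
  qed
  have dT: "(T has_real_derivative T' u) (at u)" if u: "u \<in> {0..D}" for u
  proof -
    have "Z0 u \<noteq> 0" using Z0pos[OF u] by simp
    from DERIV_polar_angle[OF dZ(1,2) this] k show ?thesis
      by (simp add: T_def T'_def W_def ZZ(1))
  qed
  have contZ: "continuous_on {0..D} Z2" "continuous_on {0..D} Z2'" "continuous_on {0..D} W"
    unfolding Z0_def Z0'_def W_def Z1_def Z2_def Z1'_def Z2'_def p_def q_def p'_def q'_def
    using Q by (auto intro!: continuous_intros)
  have pos1: "1 + (Z2 u)\<^sup>2 > 0" for u by (simp add: add_pos_nonneg)
  have T'X': "continuous_on {0..D} T'" "continuous_on {0..D} X'"
      unfolding T'_def X'_def using contZ pos1 by (auto intro!: continuous_intros simp: less_imp_neq[OF pos1, symmetric])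
  have unit: "model_g K (T u, X u) (T' u, X' u) = -1" if "u \<in> {0..D}" for u
    proof -
      have "k * X u = arsinh (Z2 u)" using k by (simp add: X_def)
      then have "(cosh (k * X u))\<^sup>2 = 1 + (Z2 u)\<^sup>2" by (simp add: cosh_square_eq)
      moreover have "(X' u)\<^sup>2 = (Z2' u)\<^sup>2 / (1 + (Z2 u)\<^sup>2)"
        using pos1[of u] by (simp add: X'_def power_divide)
      moreover have "(1 + (Z2 u)\<^sup>2) * (T' u)\<^sup>2 = (W u)\<^sup>2 / (1 + (Z2 u)\<^sup>2)"
        using pos1[of u] by (simp add: T'_def power_divide power2_eq_square)
      moreover have "model_g K (T u, X u) (T' u, X' u) = (X' u)\<^sup>2 - (cosh (k * X u))\<^sup>2 * (T' u)\<^sup>2"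
        using \<open>K < 0\<close> by (simp add: model_g_def k_def)
      ultimately have "model_g K (T u, X u) (T' u, X' u) = ((Z2' u)\<^sup>2 - (W u)\<^sup>2) / (1 + (Z2 u)\<^sup>2)"
        by (simp only: diff_divide_distrib)
      also have "(Z2' u)\<^sup>2 - (W u)\<^sup>2 = (-1) * (1 + (Z2 u)\<^sup>2)" by (simp add: W2)
      also have "\<dots> / (1 + (Z2 u)\<^sup>2) = -1" using pos1[of u] by (intro nonzero_mult_div_cancel_right) simp
      finally show ?thesis .
    qed
  have T'pos: "T' u > 0" if "u \<in> {0..D}" for u
      using Wpos[of u] pos1[of u] by (simp add: T'_def)
  have "model_fd_causal K 0 D (\<lambda>u. (T u, X u)) \<and> model_len K 0 D (\<lambda>u. (T u, X u)) = D"
    using model_unit_curve[OF \<open>D > 0\<close> dT dX T'X' unit T'pos] by blast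
  moreover have "(T 0, X 0) = (s, 0)"
  proof -
    have "a1 / a0 = tan (k * s)" by (simp add: a0_def a1_def tan_def)
    moreover have "arctan (tan (k * s)) = k * s" using st by (intro arctan_tan) (auto simp: k_def)
    ultimately show ?thesis
      using k Q by (simp add: T_def X_def Z0_def Z1_def Z2_def ends)
  qed
  moreover have "(T D, X D) = (t, r)"
  proof -
    have "b1 / b0 = tan (k * t)" by (simp add: b0_def b1_def tan_def)
    moreover have "arctan (tan (k * t)) = k * t" using st by (intro arctan_tan) (auto simp: k_def)
    ultimately show ?thesis
      using k Q by (simp add: T_def X_def Z0_def Z1_def Z2_def ends b2_def arsinh_sinh_real)
  qed
  ultimately have curve: "model_fd_causal K 0 D (\<lambda>u. (T u, X u))" "model_len K 0 D (\<lambda>u. (T u, X u)) = D"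
    "(\<lambda>u. (T u, X u)) 0 = (s, 0)" "(\<lambda>u. (T u, X u)) D = (t, r)" by auto
  show ?thesis
    using tau_model_eqI[OF upper curve(1,3,4,2)] curve by blast
qed

section \<open>Comparison triangles\<close>

text \<open>The comparison triangle has vertices \<open>(0, 0)\<close>, \<open>(t, r)\<close>, \<open>(C, 0)\<close>; \<open>D\<close> is the time separation
  from the point \<open>(z, 0)\<close> on its long side to \<open>(t, r)\<close>.\<close>
definition comparison_triangle ::
  "real \<Rightarrow> real \<Rightarrow> real \<Rightarrow> real \<Rightarrow> real \<Rightarrow> real \<Rightarrow> real \<Rightarrow> real \<Rightarrow> bool" where
  "comparison_triangle K A B C z D t r \<longleftrightarrow>
     (tau_model K (0, 0) (t, r) = ereal A \<and>
      (\<exists>a b c. model_fd_causal K a b c \<and> c a = (0, 0) \<and> c b = (t, r) \<and> model_len K a b c = A)) \<and>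
     tau_model K (t, r) (C, 0) = ereal B \<and> tau_model K (0, 0) (C, 0) = ereal C \<and>
     tau_model K (0, 0) (z, 0) = ereal z \<and> tau_model K (z, 0) (t, r) = ereal D"

text \<open>The equation for F is interpolation along the long side. The modified distance to the
  apex and the function z to md (\<open>\<beta>\<close> - z) both solve y'' - K y = 1, so their
  difference solves y'' = K y and is determined by its values at 0 and C. The parameter
  \<open>\<beta>\<close> merely selects the reference solution.\<close>

lemma minkowski_comparison_triangle:
  assumes "A > 0" "B > 0" "A + B < C" "0 < z" "z < A" "F > 0"
    and F: "sn 0 C * (F - md 0 (\<beta> - z)) =
      sn 0 (C - z) * (md 0 A - md 0 \<beta>) + sn 0 z * (md 0 B - md 0 (C - \<beta>))"
  shows "\<exists>t r D. D > 0 \<and> md 0 D = F \<and> comparison_triangle 0 A B C z D t r"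
proof -
  have C: "C > 0" using assms by simp
  \<comment> \<open>Subtracting t^2 - r^2 = A^2 from (C - t)^2 - r^2 = B^2 determines t.\<close>
  define t where "t = (C\<^sup>2 + A\<^sup>2 - B\<^sup>2) / (2 * C)"
  define r where "r = sqrt (t\<^sup>2 - A\<^sup>2)"
  define D where "D = sqrt (2 * F)"
  have tC: "2 * C * t = C\<^sup>2 + A\<^sup>2 - B\<^sup>2" using C by (simp add: t_def)
  have "B\<^sup>2 < (C - A)\<^sup>2" using assms by (intro power_strict_mono) auto
  then have "2 * C * A < 2 * C * t" unfolding tC by (simp add: power2_eq_square algebra_simps)
  then have tA: "A < t" using C by simp
  have "A\<^sup>2 < C\<^sup>2" using assms by (intro power_strict_mono) auto
  moreover have "B\<^sup>2 > 0" using assms by simp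
  ultimately have "2 * C * t < 2 * C * C" unfolding tC by (simp add: power2_eq_square)
  then have tltC: "t < C" using C by simp
  have "A\<^sup>2 \<le> t\<^sup>2" using tA assms by (intro power_mono) auto
  then have r: "r\<^sup>2 = t\<^sup>2 - A\<^sup>2" by (simp add: r_def)
  have D: "D > 0" "D\<^sup>2 = 2 * F" using assms by (auto simp: D_def)
  have A: "tau_model 0 (0, 0) (t, r) = ereal A \<and>
      (\<exists>a b c. model_fd_causal 0 a b c \<and> c a = (0, 0) \<and> c b = (t, r) \<and> model_len 0 a b c = A)"
    using tA assms r by (intro minkowski_tau) auto
  have "tau_model 0 (- C, 0) (- t, r) = ereal B"
    using minkowski_tau[of "- C" "- t" B r] tltC assms tC r by (simp add: power2_eq_square algebra_simps)
  then have B: "tau_model 0 (t, r) (C, 0) = ereal B" by (simp add: tau_model_reversal[of 0 t])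
  have "C * (2 * F) = C * ((t - z)\<^sup>2 - r\<^sup>2)"
    using F unfolding r sn_def md_def by (simp add: field_simps) (use tC in algebra)
  then have "D\<^sup>2 = (t - z)\<^sup>2 - r\<^sup>2" using C D by simp
  then have "tau_model 0 (z, 0) (t, r) = ereal D"
    using minkowski_tau[of z t D r] tA assms D by simp
  moreover have "tau_model 0 (0, 0) (C, 0) = ereal C" "tau_model 0 (0, 0) (z, 0) = ereal z"
    using minkowski_tau[of 0 C C 0] minkowski_tau[of 0 z z 0] C assms by auto
  moreover have "md 0 D = F" using D by (simp add: md_def)
  ultimately show ?thesis using A B D unfolding comparison_triangle_def by blast
qed

lemma de_sitter_comparison_triangle:
  assumes "K > 0" "A > 0" "B > 0" "A + B < C" "0 < z" "z < A" "F > 0"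
    and F: "sn K C * (F - md K (\<beta> - z)) =
      sn K (C - z) * (md K A - md K \<beta>) + sn K z * (md K B - md K (C - \<beta>))"
  shows "\<exists>t r D. D > 0 \<and> md K D = F \<and> comparison_triangle K A B C z D t r"
proof -
  define k where "k = sqrt K"
  have k: "k > 0" using \<open>K > 0\<close> by (simp add: k_def)
  have C: "C > 0" using assms by simp
  have shC: "sinh (k * C) > 0" using k C by simp
  \<comment> \<open>\<open>w\<close> is the required value of sinh (k t): it solves cosh (k B) =
    cosh (k C) cosh (k A) - sinh (k C) w, the equation for the side B after inserting the one for
    the side A.\<close>
  define w where "w = (cosh (k * C) * cosh (k * A) - cosh (k * B)) / sinh (k * C)"
  have wC: "w * sinh (k * C) = cosh (k * C) * cosh (k * A) - cosh (k * B)"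
  proof -
    have "x / y * y = x" if "y > 0" for x y :: real using that by simp
    from this[OF shC] show ?thesis unfolding w_def .
  qed
  \<comment> \<open>The strict reverse triangle inequality gives A < t, so r is nonzero and the apex
    lies above (z, 0) for every z < A.\<close>
  have "k * B < k * (C - A)" using k assms by simp
  then have "cosh (k * B) < cosh (k * C - k * A)"
    using k assms by (simp add: cosh_real_nonneg_less_iff right_diff_distrib)
  then have "sinh (k * A) * sinh (k * C) < w * sinh (k * C)" unfolding wC by (simp add: cosh_diff mult.commute)
  then have wA: "sinh (k * A) < w" using shC by simp
  have "w * sinh (k * C) < sinh (k * C) * sinh (k * C)"
  proof -
    have "cosh (k * A) < cosh (k * C)" using k assms by (simp add: cosh_real_nonneg_less_iff)
    then have "cosh (k * C) * cosh (k * A) < cosh (k * C) * cosh (k * C)" by simp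
    moreover have "cosh (k * C) * cosh (k * C) = 1 + sinh (k * C) * sinh (k * C)"
      using cosh_square_eq[of "k * C"] by (simp add: power2_eq_square)
    moreover have "1 \<le> cosh (k * B)" by (rule cosh_real_ge_1)
    ultimately show ?thesis unfolding wC by linarith
  qed
  then have wltC: "w < sinh (k * C)" using shC by simp
  define t where "t = arsinh w / k"
  have kt: "sinh (k * t) = w" using k by (simp add: t_def)
  have "sinh (k * A) < sinh (k * t)" using wA kt by simp
  then have tA: "A < t" using k by simp
  have "sinh (k * t) < sinh (k * C)" using wltC kt by simp
  then have tltC: "t < C" using k by simp
  define q where "q = cosh (k * A) / cosh (k * t)"
  have "cosh (k * A) < cosh (k * t)" using k assms tA by (simp add: cosh_real_nonneg_less_iff)
  then have q: "0 < q" "q < 1" by (auto simp: q_def)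
  define r where "r = arccos q / k"
  have kr: "k * r = arccos q" using k by (simp add: r_def)
  have cosr: "cosh (k * t) * cos (k * r) = cosh (k * A)"
    using q by (simp add: kr) (simp add: q_def)
  have r: "\<bar>k * r\<bar> < pi / 2"
  proof -
    have "0 < arccos q" using arccos_less_arccos[of q 1] q by simp
    moreover have "arccos q < arccos 0" using q by (intro arccos_less_arccos) auto
    ultimately show ?thesis by (simp add: kr)
  qed
  have A: "tau_model K (0, 0) (t, r) = ereal A \<and>
      (\<exists>a b c. model_fd_causal K a b c \<and> c a = (0, 0) \<and> c b = (t, r) \<and> model_len K a b c = A)"
    using de_sitter_tau[of K 0 t r A] assms tA r cosr by (simp add: k_def)
  have "cosh (k * B) = cosh (k * C) * (cosh (k * t) * cos (k * r)) - sinh (k * C) * sinh (k * t)"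
    unfolding cosr kt using wC by (simp add: mult.commute)
  then have "tau_model K (- C, 0) (- t, r) = ereal B"
    using de_sitter_tau[of K "- C" "- t" r B] assms tltC r by (simp add: k_def mult.assoc)
  then have B: "tau_model K (t, r) (C, 0) = ereal B" by (simp add: tau_model_reversal[of K t])
  have K: "K = k\<^sup>2" using \<open>K > 0\<close> by (simp add: k_def)
  define D where "D = arcosh (1 + K * F) / k"
  have "1 + K * F > 1" using assms by simp
  then have kD: "cosh (k * D) = 1 + K * F" using k by (simp add: D_def)
  have "D \<noteq> 0" using kD \<open>1 + K * F > 1\<close> by auto
  moreover have "D \<ge> 0" using k \<open>1 + K * F > 1\<close> by (simp add: D_def)
  ultimately have D: "D > 0" by simp
  \<comment> \<open>Multiplication by k K turns \<open>md\<close> into cosh - 1 and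
    \<open>sn\<close> into sinh, after which the addition formulas apply.\<close>
  have F': "sinh (k * C) * ((1 + K * F) - cosh (k * (\<beta> - z))) =
      sinh (k * (C - z)) * (cosh (k * A) - cosh (k * \<beta>)) + sinh (k * z) * (cosh (k * B) - cosh (k * (C - \<beta>)))"
  proof -
    have m: "K * md K x = cosh (k * x) - 1" "k * sn K x = sinh (k * x)" for x
      using \<open>K > 0\<close> k by (simp_all add: md_def cs_def sn_def k_def)
    have "(k * sn K C) * (K * F - K * md K (\<beta> - z)) =
      (k * sn K (C - z)) * (K * md K A - K * md K \<beta>) + (k * sn K z) * (K * md K B - K * md K (C - \<beta>))"
      using arg_cong[OF F, of "\<lambda>x. k * K * x"] by (simp add: algebra_simps)
    then show ?thesis unfolding m by (simp add: algebra_simps)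
  qed
  have "sinh (k * C) * (1 + K * F) = sinh (k * C) * (cosh (k * z) * cosh (k * A) - sinh (k * z) * w)"
    using F' wC unfolding right_diff_distrib sinh_diff cosh_diff by algebra
  then have "1 + K * F = cosh (k * z) * (cosh (k * t) * cos (k * r)) - sinh (k * z) * sinh (k * t)"
    using shC k C by (simp add: cosr kt)
  then have "tau_model K (z, 0) (t, r) = ereal D"
    using de_sitter_tau[of K z t r D] assms tA D r kD by (simp add: k_def mult.assoc)
  moreover have "tau_model K (0, 0) (C, 0) = ereal C" "tau_model K (0, 0) (z, 0) = ereal z"
    using de_sitter_tau[of K 0 C 0 C] de_sitter_tau[of K 0 z 0 z] C assms by auto
  moreover have "md K D = F" using kD \<open>K > 0\<close> by (simp add: md_def cs_def k_def)
  ultimately show ?thesis using A B D unfolding comparison_triangle_def by blast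
qed

lemma anti_de_sitter_comparison_triangle:
  assumes "K < 0" "A > 0" "B > 0" "A + B < C" "0 < z" "z < A" "F > 0" and small: "sqrt (- K) * C < pi / 2"
    and F: "sn K C * (F - md K (\<beta> - z)) =
      sn K (C - z) * (md K A - md K \<beta>) + sn K z * (md K B - md K (C - \<beta>))"
  shows "\<exists>t r D. D > 0 \<and> sqrt (- K) * D < pi / 2 \<and> md K D = F \<and> comparison_triangle K A B C z D t r"
proof -
  define k where "k = sqrt (- K)"
  have k: "k > 0" using \<open>K < 0\<close> by (simp add: k_def)
  have C: "C > 0" using assms by simp
  have ord: "0 < k * A" "k * A < k * C" "0 < k * B" "k * B < k * C - k * A" "0 < k * z" "k * z < k * A" "k * C < pi / 2"
  proof -
    show "k * B < k * C - k * A" using k assms by (simp add: right_diff_distrib[symmetric])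
    show "k * C < pi / 2" using small by (simp add: k_def)
  qed (use k assms in auto)
  then have lt: "k * A < pi / 2" "k * B < pi / 2" "k * z < pi / 2" by linarith+
  have sC: "sin (k * C) > 0" and sA: "sin (k * A) > 0" and sz: "sin (k * z) > 0"
    using ord by (auto intro!: sin_gt_zero)
  have cC: "cos (k * C) > 0" and cA: "cos (k * A) > 0" and cz: "cos (k * z) > 0"
    using ord by (auto intro!: cos_gt_zero)
  \<comment> \<open>Here \<open>w\<close> is to be cosh (k r) sin (k t). Together with cos (k A) =
    cosh (k r) cos (k t) it determines tan (k t), and then r.\<close>
  define w where "w = (cos (k * B) - cos (k * C) * cos (k * A)) / sin (k * C)"
  have wC: "w * sin (k * C) = cos (k * B) - cos (k * C) * cos (k * A)" using sC by (simp add: w_def)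
  have "cos (k * C - k * A) < cos (k * B)" using ord by (intro cos_monotone_0_pi) auto
  then have "sin (k * A) * sin (k * C) < w * sin (k * C)" unfolding wC by (simp add: cos_diff mult.commute)
  then have wA: "sin (k * A) < w" using sC by simp
  have wpos: "w > 0" using wA sA by simp
  have wltC: "w * cos (k * C) < sin (k * C) * cos (k * A)"
  proof -
    have "(w * cos (k * C)) * sin (k * C) = cos (k * B) * cos (k * C) - (cos (k * C))\<^sup>2 * cos (k * A)"
      using wC by algebra
    also have "cos (k * B) * cos (k * C) \<le> 1 * cos (k * C)" using cC by (intro mult_right_mono) auto
    also have "1 * cos (k * C) < cos (k * A)" using ord by (simp add: cos_monotone_0_pi)
    also have "cos (k * A) - (cos (k * C))\<^sup>2 * cos (k * A) = (sin (k * C) * cos (k * A)) * sin (k * C)"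
      using sin_cos_squared_add[of "k * C"] by algebra
    finally show ?thesis using sC by (simp add: mult.commute)
  qed
  define t where "t = arctan (w / cos (k * A)) / k"
  have kt: "k * t = arctan (w / cos (k * A))" using k by (simp add: t_def)
  have tant: "tan (k * t) = w / cos (k * A)" by (simp add: kt tan_arctan)
  have ktr: "0 < k * t" "k * t < pi / 2" unfolding kt using wpos cA arctan_bounded by auto
  have ct: "cos (k * t) > 0" using ktr by (intro cos_gt_zero) auto
  have "arctan (tan (k * A)) < arctan (w / cos (k * A))"
    using wA cA by (simp add: arctan_less_iff tan_def divide_strict_right_mono)
  then have "k * A < k * t" using ord by (simp add: kt arctan_tan)
  then have tA: "A < t" using k by simp
  have "w / cos (k * A) < tan (k * C)" using wltC cA cC by (simp add: tan_def divide_simps mult.commute)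
  then have "arctan (w / cos (k * A)) < arctan (tan (k * C))" by (simp add: arctan_less_iff)
  then have "k * t < k * C" using ord by (simp add: kt arctan_tan)
  then have tltC: "t < C" using k by simp
  define q where "q = cos (k * A) / cos (k * t)"
  have "cos (k * t) < cos (k * A)" using ord ktr \<open>k * A < k * t\<close> by (intro cos_monotone_0_pi) auto
  then have q: "q > 1" using ct by (simp add: q_def)
  define r where "r = arcosh q / k"
  have chr: "cosh (k * r) = q" using k q by (simp add: r_def)
  have cA': "cosh (k * r) * cos (k * t) = cos (k * A)" using ct by (simp add: chr q_def)
  have w': "cosh (k * r) * sin (k * t) = w"
  proof -
    have "sin (k * t) = tan (k * t) * cos (k * t)" using ct by (simp add: tan_def)
    then have "cosh (k * r) * sin (k * t) = w / cos (k * A) * (cosh (k * r) * cos (k * t))" by (simp add: tant)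
    then show ?thesis using cA by (simp add: cA')
  qed
  have krcos: "cosh (k * r) * cos (k * t - x) = cos (k * A) * cos x + w * sin x" for x
    by (simp add: cos_diff distrib_left cA'[symmetric] w'[symmetric])
  have A: "tau_model K (0, 0) (t, r) = ereal A \<and>
      (\<exists>a b c. model_fd_causal K a b c \<and> c a = (0, 0) \<and> c b = (t, r) \<and> model_len K a b c = A)"
    using anti_de_sitter_tau[of K 0 t A r] assms tA ktr cA' ord lt by (simp add: k_def)
  have "cos (k * B) = cosh (k * r) * cos (k * C - k * t)"
    using krcos[of "k * C"] wC cos_minus[of "k * C - k * t"] by (simp add: mult.commute)
  then have "tau_model K (- C, 0) (- t, r) = ereal B"
    using anti_de_sitter_tau[of K "- C" "- t" B r] assms tltC ktr ord lt by (simp add: k_def)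
  then have B: "tau_model K (t, r) (C, 0) = ereal B" by (simp add: tau_model_reversal[of K t])
  have F': "sin (k * C) * ((1 + K * F) - cos (k * (\<beta> - z))) =
      sin (k * (C - z)) * (cos (k * A) - cos (k * \<beta>)) + sin (k * z) * (cos (k * B) - cos (k * (C - \<beta>)))"
  proof -
    have m: "K * md K x = cos (k * x) - 1" "k * sn K x = sin (k * x)" for x
      using \<open>K < 0\<close> k by (simp_all add: md_def cs_def sn_def k_def)
    have "(k * sn K C) * (K * F - K * md K (\<beta> - z)) =
      (k * sn K (C - z)) * (K * md K A - K * md K \<beta>) + (k * sn K z) * (K * md K B - K * md K (C - \<beta>))"
      using arg_cong[OF F, of "\<lambda>x. k * K * x"] by (simp add: algebra_simps)
    then show ?thesis unfolding m by (simp add: algebra_simps)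
  qed
  have "sin (k * C) * (1 + K * F) = sin (k * C) * (cos (k * A) * cos (k * z) + w * sin (k * z))"
    using F' wC unfolding right_diff_distrib sin_diff cos_diff by algebra
  then have F'': "1 + K * F = cos (k * A) * cos (k * z) + w * sin (k * z)" using sC by simp
  \<comment> \<open>This places k D = arccos (1 + K F) strictly between 0 and pi / 2, as the formula
    for the time separation demands.\<close>
  have F01: "0 < 1 + K * F" "1 + K * F < 1"
    using cA cz wpos sz assms by (simp add: F'' add_pos_pos) (use assms in \<open>simp add: mult_neg_pos\<close>)
  define D where "D = arccos (1 + K * F) / k"
  have kD': "k * D = arccos (1 + K * F)" using k by (simp add: D_def)
  have kD: "cos (k * D) = 1 + K * F" using F01 by (simp add: kD')
  have "0 < arccos (1 + K * F)" using arccos_less_arccos[of "1 + K * F" 1] F01 by simp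
  then have D: "D > 0" using k by (simp add: D_def)
  have "arccos (1 + K * F) < arccos 0" using F01 by (intro arccos_less_arccos) auto
  then have Dpi: "k * D < pi / 2" by (simp add: kD')
  have "tau_model K (z, 0) (t, r) = ereal D"
    using anti_de_sitter_tau[of K z t D r] assms tA D Dpi ktr ord lt krcos[of "k * z"] kD F'' by (simp add: k_def)
  moreover have "tau_model K (0, 0) (C, 0) = ereal C" "tau_model K (0, 0) (z, 0) = ereal z"
    using anti_de_sitter_tau[of K 0 C C 0] anti_de_sitter_tau[of K 0 z z 0] C assms ord lt by (auto simp: k_def)
  moreover have "md K D = F" using kD \<open>K < 0\<close> by (simp add: md_def cs_def k_def)
  ultimately show ?thesis using A B D Dpi unfolding comparison_triangle_def k_def by blast
qed

lemma comparison_triangle_exists: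
  assumes "A > 0" "B > 0" "A + B < C" "0 < z" "z < A" "F > 0" and "K < 0 \<Longrightarrow> sqrt (- K) * C < pi / 2"
    and "sn K C * (F - md K (\<beta> - z)) =
      sn K (C - z) * (md K A - md K \<beta>) + sn K z * (md K B - md K (C - \<beta>))"
  obtains t r D where "D > 0" "K < 0 \<Longrightarrow> sqrt (- K) * D < pi / 2" "md K D = F"
    "comparison_triangle K A B C z D t r"
proof -
  consider "K > 0" | "K = 0" | "K < 0" by linarith
  then show ?thesis
  proof cases
    case 1
    from de_sitter_comparison_triangle[OF 1 assms(1-6,8)] show ?thesis using 1 that by fastforce
  next
    case 2
    from minkowski_comparison_triangle[OF assms(1-6) assms(8)[unfolded 2]] show ?thesis using 2 that by fastforce
  next
    case 3
    from anti_de_sitter_comparison_triangle[OF 3 assms(1-6) assms(7)[OF 3] assms(8)] show ?thesis using that by blast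
  qed
qed

section \<open>The curvature bound\<close>

text \<open>The Caratheodory form of the derivative avoids dividing by T l - \<open>\<beta>\<close>,
  which might vanish.\<close>

lemma increment_quotient_limit:
  fixes G T :: "real \<Rightarrow> real"
  assumes G: "(G has_real_derivative d) (at \<beta>)"
    and T: "((\<lambda>l. (T l - \<beta>) / l\<^sup>2) \<longlongrightarrow> q) (at_right 0)"
  shows "((\<lambda>l. (G (T l) - G \<beta>) / l\<^sup>2) \<longlongrightarrow> d * q) (at_right 0)" "(T \<longlongrightarrow> \<beta>) (at_right 0)"
proof -
  obtain g where g: "\<And>z. G z - G \<beta> = g z * (z - \<beta>)" "isCont g \<beta>" "g \<beta> = d"
    using G unfolding CARAT_DERIV by blast
  have "((\<lambda>l. (T l - \<beta>) / l\<^sup>2 * l\<^sup>2 + \<beta>) \<longlongrightarrow> q * 0\<^sup>2 + \<beta>) (at_right 0)"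
    by (intro tendsto_intros T)
  moreover have "eventually (\<lambda>l. (T l - \<beta>) / l\<^sup>2 * l\<^sup>2 + \<beta> = T l) (at_right (0::real))"
    using eventually_at_right_less[of 0] by eventually_elim auto
  ultimately show lim: "(T \<longlongrightarrow> \<beta>) (at_right 0)"
    using Lim_transform_eventually by fastforce
  have "((\<lambda>l. g (T l) * ((T l - \<beta>) / l\<^sup>2)) \<longlongrightarrow> d * q) (at_right 0)"
    using isCont_tendsto_compose[OF g(2) lim] g(3) T by (intro tendsto_mult) auto
  then show "((\<lambda>l. (G (T l) - G \<beta>) / l\<^sup>2) \<longlongrightarrow> d * q) (at_right 0)"
    by (simp add: g(1))
qed

lemma quartic_squeeze:
  fixes T :: "real \<Rightarrow> real"
  assumes "eventually (\<lambda>l. \<beta> - q * l\<^sup>2 - C * l^4 \<le> T l \<and> T l \<le> \<beta> - q * l\<^sup>2) (at_right 0)"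
  shows "((\<lambda>l. (T l - \<beta>) / l\<^sup>2) \<longlongrightarrow> - q) (at_right 0)"
proof (rule tendsto_sandwich)
  have "((\<lambda>l. - q - C * l\<^sup>2) \<longlongrightarrow> - q - C * 0\<^sup>2) (at_right 0)" by (intro tendsto_intros)
  then show "((\<lambda>l. - q - C * l\<^sup>2) \<longlongrightarrow> - q) (at_right 0)" by simp
  show "((\<lambda>l. - q) \<longlongrightarrow> - q) (at_right (0::real))" by simp
  show "eventually (\<lambda>l. - q - C * l\<^sup>2 \<le> (T l - \<beta>) / l\<^sup>2) (at_right 0)"
    using assms eventually_at_right_less[of 0]
  proof eventually_elim
    case (elim l)
    have "(- q - C * l\<^sup>2) * l\<^sup>2 = - q * l\<^sup>2 - C * l^4" by (simp add: algebra_simps eval_nat_numeral)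
    then show ?case using elim by (simp add: pos_le_divide_eq)
  qed
  show "eventually (\<lambda>l. (T l - \<beta>) / l\<^sup>2 \<le> - q) (at_right 0)"
    using assms eventually_at_right_less[of 0]
    by eventually_elim (simp add: pos_divide_le_eq)
qed

text \<open>Both points may vary with l because the constants of the expansion are uniform. The
  strict bound, due to l > 0, later gives the strict reverse triangle inequality that the comparison
  triangle needs.\<close>

lemma tau_second_order:
  fixes f H :: "real \<Rightarrow> real" and X :: "'a::metric_space set"
  assumes "geodesic_length_space X" and "u < v" and "{u..v} \<subseteq> I"
    and "\<And>t. t \<in> {u..v} \<Longrightarrow> f t > 0" and "continuous_on {u..v} f"
    and "\<And>t. t \<in> {u..v} \<Longrightarrow> (H has_real_derivative 1 / (f t)\<^sup>2) (at t)"
    and x: "eventually (\<lambda>l. x l \<in> X \<and> x' l \<in> X \<and> dist (x l) (x' l) = l) (at_right 0)"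
  defines "T \<equiv> \<lambda>l. real_of_ereal (tau I X f (u, x l) (v, x' l))"
  shows "((\<lambda>l. (T l - (v - u)) / l\<^sup>2) \<longlongrightarrow> - (1 / (2 * (H v - H u)))) (at_right 0)"
    and "eventually (\<lambda>l. chron I X f (u, x l) (v, x' l) \<and> tau I X f (u, x l) (v, x' l) = ereal (T l) \<and>
      T l < v - u) (at_right 0)"
proof -
  obtain C l0 where l0: "l0 > 0" and e: "\<And>x x'. x \<in> X \<Longrightarrow> x' \<in> X \<Longrightarrow> dist x x' < l0 \<Longrightarrow>
      chron I X f (u, x) (v, x') \<and> (\<exists>T. tau I X f (u, x) (v, x') = ereal T \<and>
        v - u - (dist x x')\<^sup>2 / (2 * (H v - H u)) - C * (dist x x')^4 \<le> T \<and>
        T \<le> v - u - (dist x x')\<^sup>2 / (2 * (H v - H u)))"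
    by (rule tau_expansion[OF assms(1-6)]) blast+
  define q where "q = 1 / (2 * (H v - H u))"
  have q: "q > 0"
    using primitive_inverse_square_increasing[of u v f H] assms(2,4,6) by (simp add: q_def)
  have "eventually (\<lambda>l. l < l0) (at_right 0)"
    using l0 by (auto simp: eventually_at_right_field)
  then have ev: "eventually (\<lambda>l. 0 < l \<and> chron I X f (u, x l) (v, x' l) \<and> tau I X f (u, x l) (v, x' l) = ereal (T l) \<and>
      v - u - q * l\<^sup>2 - C * l^4 \<le> T l \<and> T l \<le> v - u - q * l\<^sup>2) (at_right 0)"
    using x eventually_at_right_less[of 0]
  proof eventually_elim
    case (elim l)
    then have "chron I X f (u, x l) (v, x' l) \<and> (\<exists>T. tau I X f (u, x l) (v, x' l) = ereal T \<and>
        v - u - q * l\<^sup>2 - C * l^4 \<le> T \<and> T \<le> v - u - q * l\<^sup>2)"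
      using e[of "x l" "x' l"] by (simp add: q_def)
    then show ?case using elim by (auto simp: T_def simp del: ereal_less_eq)
  qed
  have "((\<lambda>l. (T l - (v - u)) / l\<^sup>2) \<longlongrightarrow> - q) (at_right 0)"
    by (rule quartic_squeeze[where C = C]) (rule eventually_mono[OF ev], blast)
  then show "((\<lambda>l. (T l - (v - u)) / l\<^sup>2) \<longlongrightarrow> - (1 / (2 * (H v - H u)))) (at_right 0)"
    by (simp only: q_def)
  show "eventually (\<lambda>l. chron I X f (u, x l) (v, x' l) \<and> tau I X f (u, x l) (v, x' l) = ereal (T l) \<and>
      T l < v - u) (at_right 0)"
  proof (rule eventually_mono[OF ev], intro conjI)
    fix l assume l: "0 < l \<and> chron I X f (u, x l) (v, x' l) \<and> tau I X f (u, x l) (v, x' l) = ereal (T l) \<and>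
      v - u - q * l\<^sup>2 - C * l^4 \<le> T l \<and> T l \<le> v - u - q * l\<^sup>2"
    have "q * l\<^sup>2 > 0" using q l by simp
    then show "T l < v - u" using l by linarith
  qed auto
qed

text \<open>The last conjunct of \<open>timelike_curv_bound\<close>, for a fixed neighbourhood \<open>U\<close>.\<close>
definition triangle_comparison ::
  "real set \<Rightarrow> 'a::metric_space set \<Rightarrow> (real \<Rightarrow> real) \<Rightarrow> real \<Rightarrow> (ereal \<Rightarrow> ereal \<Rightarrow> bool) \<Rightarrow> (real \<times> 'a) set \<Rightarrow> bool" where
  "triangle_comparison I X f K rel U \<longleftrightarrow>
    (\<forall>x y z a1 b1 \<gamma>1 a2 b2 \<gamma>2 a3 b3 \<gamma>3 x' y' z' p q p' q'.
         x \<in> U \<and> y \<in> U \<and> z \<in> U \<and> chron I X f x y \<and> chron I X f y z \<and>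
         tau I X f x z < \<infinity> \<and> size_ok K (tau I X f x z) \<and>
         max_curve_in I X f U x y a1 b1 \<gamma>1 \<and> max_curve_in I X f U y z a2 b2 \<gamma>2 \<and>
         max_curve_in I X f U x z a3 b3 \<gamma>3 \<and>
         tau_model K x' y' = tau I X f x y \<and> tau_model K y' z' = tau I X f y z \<and>
         tau_model K x' z' = tau I X f x z \<and>
         ((p \<in> \<gamma>1 ` {a1..b1} \<and> model_corr K x' y' (tau I X f x p) p') \<or>
          (p \<in> \<gamma>2 ` {a2..b2} \<and> model_corr K y' z' (tau I X f y p) p') \<or>
          (p \<in> \<gamma>3 ` {a3..b3} \<and> model_corr K x' z' (tau I X f x p) p')) \<and>
         ((q \<in> \<gamma>1 ` {a1..b1} \<and> model_corr K x' y' (tau I X f x q) q') \<or>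
          (q \<in> \<gamma>2 ` {a2..b2} \<and> model_corr K y' z' (tau I X f y q) q') \<or>
          (q \<in> \<gamma>3 ` {a3..b3} \<and> model_corr K x' z' (tau I X f x q) q'))
         \<longrightarrow> rel (tau I X f p q) (tau_model K p' q'))"

text \<open>With h fixed, the apex approaches the long side as l tends to 0. Comparing the two time
  separations amounts to comparing their \<open>md\<close>, and on the model side this is affine in
  \<open>md (T1 l)\<close> and \<open>md (T2 l)\<close>. The coefficient of l^2 in the comparison is
  a negative multiple of \<open>E\<close>.\<close>

lemma curvature_bound_inequality:
  fixes X :: "'a::metric_space set" and f H :: "real \<Rightarrow> real" and K h :: real
  assumes geo: "geodesic_length_space X" and x0: "x0 \<in> X" "x1 \<in> X" "x0 \<noteq> x1"
    and "h > 0" and I: "{t0 - 2*h..t0 + 2*h} \<subseteq> I"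
    and fpos: "\<And>t. t \<in> {t0 - 2*h..t0 + 2*h} \<Longrightarrow> f t > 0"
    and fcont: "continuous_on {t0 - 2*h..t0 + 2*h} f"
    and H: "\<And>t. t \<in> {t0 - 2*h..t0 + 2*h} \<Longrightarrow> (H has_real_derivative 1 / (f t)\<^sup>2) (at t)"
    and small: "K < 0 \<Longrightarrow> sqrt (- K) * (4*h) < pi / 2"
    and "\<epsilon> > 0" and U: "\<And>t x. t \<in> {t0 - 2*h..t0 + 2*h} \<Longrightarrow> x \<in> X \<Longrightarrow> dist x0 x < \<epsilon> \<Longrightarrow> (t, x) \<in> U"
    and maxU: "\<forall>p\<in>U. \<forall>q\<in>U. chron I X f p q \<longrightarrow> (\<exists>a b \<gamma>. max_curve_in I X f U p q a b \<gamma>)"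
    and comp: "triangle_comparison I X f K rel U"
  defines "E \<equiv> sn K (4*h) * sn K h / (H t0 - H (t0 - h)) - sn K (3*h) * sn K (2*h) / (H t0 - H (t0 - 2*h))
      - sn K h * sn K (2*h) / (H (t0 + 2*h) - H t0)"
  shows "rel = (\<le>) \<Longrightarrow> E \<ge> 0" "rel = (\<ge>) \<Longrightarrow> E \<le> 0"
proof -
  have sub: "{u..v} \<subseteq> {t0 - 2*h..t0 + 2*h}" if "t0 - 2*h \<le> u" "v \<le> t0 + 2*h" for u v using that by auto
  have strip: "{u..v} \<subseteq> I" "\<And>t. t \<in> {u..v} \<Longrightarrow> f t > 0" "continuous_on {u..v} f"
    "\<And>t. t \<in> {u..v} \<Longrightarrow> (H has_real_derivative 1 / (f t)\<^sup>2) (at t)"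
    if "t0 - 2*h \<le> u" "v \<le> t0 + 2*h" for u v
    using sub[OF that] I fpos H continuous_on_subset[OF fcont] by blast+
  have vertical: "fd_causal I X f u v (\<lambda>t. (t, x0))" "curve_length f u v (\<lambda>t. (t, x0)) = v - u"
    "tau I X f (u, x0) (v, x0) = ereal (v - u)"
    if uv: "t0 - 2*h \<le> u" "u < v" "v \<le> t0 + 2*h" for u v
    by (rule vertical_maximal[OF uv(2) strip(1)[OF uv(1,3)] x0(1) strip(2-4)[OF uv(1,3)]], assumption+)+
  define a where "a = t0 - 2*h"
  define s where "s = t0 - h"
  define c where "c = t0 + 2*h"
  note defs = a_def s_def c_def
  obtain \<beta> :: "real \<Rightarrow> 'a" where \<beta>: "\<beta> 0 = x0" "\<beta> ` {0..1} \<subseteq> X"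
    "\<forall>s\<in>{0..1}. \<forall>t\<in>{0..1}. dist (\<beta> s) (\<beta> t) = \<bar>s - t\<bar> * dist x0 x1"
    using geo x0 unfolding geodesic_length_space_def by blast
  \<comment> \<open>The point at distance l from \<open>x0\<close> on a geodesic to
    \<open>x1\<close>.\<close>
  define z where "z = (\<lambda>l. \<beta> (l / dist x0 x1))"
  have d01: "dist x0 x1 > 0" using x0 by simp
  have z: "z l \<in> X" "dist x0 (z l) = l" if "0 < l" "l < dist x0 x1" for l
  proof -
    have m: "l / dist x0 x1 \<in> {0..1}" using that d01 by simp
    then show "z l \<in> X" using \<beta>(2) by (auto simp: z_def)
    show "dist x0 (z l) = l" using \<beta>(3) m that d01 by (force simp: z_def \<beta>(1)[symmetric] simp del: \<beta>(1))
  qed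
  define T1 where "T1 = (\<lambda>l. real_of_ereal (tau I X f (a, x0) (t0, z l)))"
  define T2 where "T2 = (\<lambda>l. real_of_ereal (tau I X f (t0, z l) (c, x0)))"
  define T3 where "T3 = (\<lambda>l. real_of_ereal (tau I X f (s, x0) (t0, z l)))"
  have evz: "eventually (\<lambda>l. 0 < l \<and> l < \<epsilon> \<and> z l \<in> X \<and> dist x0 (z l) = l) (at_right 0)"
    unfolding eventually_at_right_field using z d01 \<open>\<epsilon> > 0\<close>
    by (intro exI[of _ "min \<epsilon> (dist x0 x1)"]) auto
  have order: "t0 - 2*h \<le> a" "a < t0" "t0 \<le> t0 + 2*h" "t0 - 2*h \<le> t0" "t0 < c" "c \<le> t0 + 2*h" "t0 - 2*h \<le> s" "s < t0"
    "t0 - a = 2*h" "c - t0 = 2*h" "t0 - s = h"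
    using \<open>h > 0\<close> by (auto simp: defs)
  have down: "eventually (\<lambda>l. x0 \<in> X \<and> z l \<in> X \<and> dist x0 (z l) = l) (at_right 0)"
    using evz x0(1) by (auto elim: eventually_mono)
  have up: "eventually (\<lambda>l. z l \<in> X \<and> x0 \<in> X \<and> dist (z l) x0 = l) (at_right 0)"
    using down by (auto simp: dist_commute elim: eventually_mono)
  have e1: "((\<lambda>l. (T1 l - 2*h) / l\<^sup>2) \<longlongrightarrow> - (1 / (2 * (H t0 - H a)))) (at_right 0)"
    "eventually (\<lambda>l. chron I X f (a, x0) (t0, z l) \<and> tau I X f (a, x0) (t0, z l) = ereal (T1 l) \<and> T1 l < 2*h) (at_right 0)"
    unfolding T1_def order(9)[symmetric]
    by (rule tau_second_order[OF geo order(2) strip[OF order(1,3)] down], assumption+)+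
  have e2: "((\<lambda>l. (T2 l - 2*h) / l\<^sup>2) \<longlongrightarrow> - (1 / (2 * (H c - H t0)))) (at_right 0)"
    "eventually (\<lambda>l. chron I X f (t0, z l) (c, x0) \<and> tau I X f (t0, z l) (c, x0) = ereal (T2 l) \<and> T2 l < 2*h) (at_right 0)"
    unfolding T2_def order(10)[symmetric]
    by (rule tau_second_order[OF geo order(5) strip[OF order(4,6)] up], assumption+)+
  have e3: "((\<lambda>l. (T3 l - h) / l\<^sup>2) \<longlongrightarrow> - (1 / (2 * (H t0 - H s)))) (at_right 0)"
    "eventually (\<lambda>l. chron I X f (s, x0) (t0, z l) \<and> tau I X f (s, x0) (t0, z l) = ereal (T3 l) \<and> T3 l < h) (at_right 0)"
    unfolding T3_def order(11)[symmetric]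
    by (rule tau_second_order[OF geo order(8) strip[OF order(7,3)] down], assumption+)+
  note m1 = increment_quotient_limit[OF DERIV_md[of K] e1(1)]
  note m2 = increment_quotient_limit[OF DERIV_md[of K] e2(1)]
  note m3 = increment_quotient_limit[OF DERIV_md[of K] e3(1)]
  have k4: "sqrt (- K) * x < pi / 2" if "K < 0" "x \<le> 4*h" for x
  proof -
    have "sqrt (- K) * x \<le> sqrt (- K) * (4*h)" by (rule mult_left_mono) (use that in auto)
    then show ?thesis using small[OF that(1)] by simp
  qed
  have kpi: "sqrt (- K) * x < pi" if "K < 0" "x \<le> 4*h" for x
    using k4[OF that] pi_gt_zero by linarith
  have snpos: "sn K (4*h) > 0" using kpi \<open>h > 0\<close> by (intro sn_pos) auto
  \<comment> \<open>The modified distance in the model between the apex and the point at height h of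
    the long side. It tends to md h > 0, so a comparison triangle exists for small l.\<close>
  define F where "F = (\<lambda>l. md K h + (sn K (3*h) * (md K (T1 l) - md K (2*h))
      + sn K h * (md K (T2 l) - md K (2*h))) / sn K (4*h))"
  have Fev: "eventually (\<lambda>l. F l > 0) (at_right 0)"
  proof -
    have c1: "isCont (md K) x" for x using DERIV_md by (rule DERIV_isCont)
    have "(F \<longlongrightarrow> md K h + (sn K (3*h) * (md K (2*h) - md K (2*h))
      + sn K h * (md K (2*h) - md K (2*h))) / sn K (4*h)) (at_right 0)"
      unfolding F_def using snpos
      by (intro tendsto_intros isCont_tendsto_compose[OF c1 m1(2)] isCont_tendsto_compose[OF c1 m2(2)]) auto
    moreover have "md K h > 0"
      using md_strict_mono[of 0 h K] \<open>h > 0\<close> kpi[of h] by simp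
    ultimately show ?thesis by (simp add: order_tendstoD)
  qed
  have key: "eventually (\<lambda>l. \<exists>D. rel (ereal (T3 l)) (ereal D) \<and> D > 0 \<and> (K < 0 \<longrightarrow> sqrt (- K) * D < pi) \<and>
      md K D = F l \<and> T3 l > 0 \<and> (K < 0 \<longrightarrow> sqrt (- K) * T3 l < pi)) (at_right 0)"
  proof -
    have "eventually (\<lambda>l. T1 l > h) (at_right 0)" "eventually (\<lambda>l. T2 l > 0) (at_right 0)"
      "eventually (\<lambda>l. T3 l > 0) (at_right 0)"
      using order_tendstoD(1)[OF m1(2), of h] order_tendstoD(1)[OF m2(2), of 0] order_tendstoD(1)[OF m3(2), of 0]
        \<open>h > 0\<close> by auto
    with evz Fev e1(2) e2(2) e3(2) show ?thesis
    proof eventually_elim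
      case (elim l)
      then have x: "l < \<epsilon>" "z l \<in> X" "dist x0 (z l) = l"
        and T1: "chron I X f (a, x0) (t0, z l)" "tau I X f (a, x0) (t0, z l) = ereal (T1 l)"
        and T2: "chron I X f (t0, z l) (c, x0)" "tau I X f (t0, z l) (c, x0) = ereal (T2 l)"
        and T3: "tau I X f (s, x0) (t0, z l) = ereal (T3 l)"
        and sum: "T1 l + T2 l < 4*h" and T3h: "T3 l < h"
        by auto
      have inU: "(a, x0) \<in> U" "(t0, z l) \<in> U" "(c, x0) \<in> U"
        using x0 x \<open>h > 0\<close> \<open>\<epsilon> > 0\<close> by (auto simp: defs intro!: U)
      \<comment> \<open>The reference solution has \<open>\<beta>\<close> = 2h: for l = 0 the apex
        lies on the long side at height 2h, and md (2h - z) is the exact modified distance.\<close>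
      have eq: "sn K (4*h) * (F l - md K (2*h - h)) =
          sn K (4*h - h) * (md K (T1 l) - md K (2*h)) + sn K h * (md K (T2 l) - md K (4*h - 2*h))"
        using snpos by (simp add: F_def)
      have pos: "T1 l > 0" "T2 l > 0" "h < T1 l" "F l > 0" using elim \<open>h > 0\<close> by linarith+
      obtain t r D where D: "D > 0" "K < 0 \<Longrightarrow> sqrt (- K) * D < pi / 2" "md K D = F l"
        and tri: "comparison_triangle K (T1 l) (T2 l) (4*h) h D t r"
        by (rule comparison_triangle_exists[OF pos(1,2) sum \<open>h > 0\<close> pos(3,4) small eq]) (assumption, (rule that; blast))
      have tri': "tau_model K (0, 0) (t, r) = ereal (T1 l)" "tau_model K (t, r) (4*h, 0) = ereal (T2 l)"
        "tau_model K (0, 0) (4*h, 0) = ereal (4*h)" "tau_model K (0, 0) (h, 0) = ereal h"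
        "tau_model K (h, 0) (t, r) = ereal D"
        "\<exists>a b c. model_fd_causal K a b c \<and> c a = (0, 0) \<and> c b = (t, r) \<and> model_len K a b c = T1 l"
        using tri by (auto simp: comparison_triangle_def)
      obtain a1 b1 \<gamma>1 where \<gamma>1: "max_curve_in I X f U (a, x0) (t0, z l) a1 b1 \<gamma>1"
        using maxU inU T1(1) by blast
      obtain a2 b2 \<gamma>2 where \<gamma>2: "max_curve_in I X f U (t0, z l) (c, x0) a2 b2 \<gamma>2"
        using maxU inU T2(1) by blast
      have ac: "a < c" "t0 - 2*h \<le> a" "c \<le> t0 + 2*h" "c - a = 4*h" using \<open>h > 0\<close> by (auto simp: defs)
      have as: "a < s" "s \<le> t0 + 2*h" "s - a = h" "s < c" using \<open>h > 0\<close> by (auto simp: defs)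
      have tac: "tau I X f (a, x0) (c, x0) = ereal (4*h)" using vertical(3)[OF ac(2,1,3)] ac(4) by simp
      have tas: "tau I X f (a, x0) (s, x0) = ereal h" using vertical(3)[OF ac(2) as(1,2)] as(3) by simp
      \<comment> \<open>The long side must be the vertical segment, since the comparison point is to
        lie on it; the short sides may be any maximal curves.\<close>
      have \<gamma>3: "max_curve_in I X f U (a, x0) (c, x0) a c (\<lambda>t. (t, x0))"
        using vertical(1,2)[OF ac(2,1,3)] tac ac x0(1) \<open>\<epsilon> > 0\<close> unfolding max_curve_in_def
        by (auto intro!: U)
      have "a1 \<le> b1" "\<gamma>1 b1 = (t0, z l)"
        using \<gamma>1 by (auto simp: max_curve_in_def fd_causal_def causal_curve_def)
      then have q: "(t0, z l) \<in> \<gamma>1 ` {a1..b1}" by (metis atLeastAtMost_iff imageI order.refl)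
      have p: "(s, x0) \<in> (\<lambda>t. (t, x0)) ` {a..c}" using as by auto
      have q': "model_corr K (0, 0) (t, r) (tau I X f (a, x0) (t0, z l)) (t, r)"
      proof -
        obtain u v \<sigma> where \<sigma>: "model_fd_causal K u v \<sigma>" "\<sigma> u = (0, 0)" "\<sigma> v = (t, r)" "model_len K u v \<sigma> = T1 l"
          using tri'(6) by blast
        have "u \<le> v" using \<sigma>(1) by (simp add: model_fd_causal_def)
        then have "(t, r) \<in> \<sigma> ` {u..v}" using \<sigma>(3) by (metis atLeastAtMost_iff imageI order.refl)
        then show ?thesis unfolding model_corr_def using \<sigma> tri'(1) T1(2) by (metis (no_types, lifting))
      qed
      have p': "model_corr K (0, 0) (4*h, 0) (tau I X f (a, x0) (s, x0)) (h, 0)"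
      proof -
        have "(h, 0) \<in> (\<lambda>s. (s, 0::real)) ` {0..4*h}" using \<open>h > 0\<close> by auto
        then have "\<exists>c d \<sigma>. model_fd_causal K c d \<sigma> \<and> \<sigma> c = (0, 0) \<and> \<sigma> d = (4*h, 0) \<and>
          ereal (model_len K c d \<sigma>) = tau_model K (0, 0) (4*h, 0) \<and> (h, 0) \<in> \<sigma> ` {c..d}"
          using vertical_model_curve[of "4*h" K] \<open>h > 0\<close> tri'(3)
          by (intro exI[of _ 0] exI[of _ "4*h"] exI[of _ "\<lambda>s. (s, 0)"]) auto
        then show ?thesis using tri'(4) tas by (simp add: model_corr_def)
      qed
      have size: "size_ok K (ereal (4*h))"
      proof (cases "K < 0")
        case True
        then have "4*h < pi / sqrt (- K)" using kpi[OF True, of "4*h"] by (simp add: pos_less_divide_eq mult.commute)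
        then show ?thesis by (simp add: size_ok_def)
      qed (simp add: size_ok_def)
      \<comment> \<open>The compared points are (s, x0) on the long side and the apex, taken as the
        final point of \<open>\<gamma>1\<close>.\<close>
      have "rel (tau I X f (s, x0) (t0, z l)) (tau_model K (h, 0) (t, r))"
      proof (rule comp[unfolded triangle_comparison_def, rule_format, of "(a, x0)" "(t0, z l)" "(c, x0)" a1 b1 \<gamma>1 a2 b2 \<gamma>2 a c "\<lambda>t. (t, x0)"
            "(0, 0)" "(t, r)" "(4*h, 0)"], intro conjI)
        show "(s, x0) \<in> \<gamma>1 ` {a1..b1} \<and> model_corr K (0, 0) (t, r) (tau I X f (a, x0) (s, x0)) (h, 0) \<or>
          (s, x0) \<in> \<gamma>2 ` {a2..b2} \<and> model_corr K (t, r) (4*h, 0) (tau I X f (t0, z l) (s, x0)) (h, 0) \<or>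
          (s, x0) \<in> (\<lambda>t. (t, x0)) ` {a..c} \<and> model_corr K (0, 0) (4*h, 0) (tau I X f (a, x0) (s, x0)) (h, 0)"
          using p p' by blast
        show "(t0, z l) \<in> \<gamma>1 ` {a1..b1} \<and> model_corr K (0, 0) (t, r) (tau I X f (a, x0) (t0, z l)) (t, r) \<or>
          (t0, z l) \<in> \<gamma>2 ` {a2..b2} \<and> model_corr K (t, r) (4*h, 0) (tau I X f (t0, z l) (t0, z l)) (t, r) \<or>
          (t0, z l) \<in> (\<lambda>t. (t, x0)) ` {a..c} \<and> model_corr K (0, 0) (4*h, 0) (tau I X f (a, x0) (t0, z l)) (t, r)"
          using q q' by blast
      qed (use inU T1 T2 \<gamma>1 \<gamma>2 \<gamma>3 tac tri' size in simp_all)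
      then have "rel (ereal (T3 l)) (ereal D)" unfolding T3 tri'(5) .
      moreover have "K < 0 \<longrightarrow> sqrt (- K) * D < pi"
      proof
        assume "K < 0"
        from D(2)[OF this] show "sqrt (- K) * D < pi" using pi_gt_zero by linarith
      qed
      moreover have "K < 0 \<longrightarrow> sqrt (- K) * T3 l < pi" using kpi T3h \<open>h > 0\<close> by simp
      ultimately show ?case using D elim by blast
    qed
  qed
  define G where "G = (\<lambda>l. sn K (4*h) * (md K (T3 l) - F l))"
  \<comment> \<open>Each \<open>md\<close> increment contributes \<open>sn\<close> at the limiting
    side length times the quadratic coefficient - 1 / (2 A), which produces the factor - 1/2 in
    front of \<open>E\<close>.\<close>
  have lim: "((\<lambda>l. G l / l\<^sup>2) \<longlongrightarrow> - E / 2) (at_right 0)"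
  proof -
    have "((\<lambda>l. sn K (4*h) * ((md K (T3 l) - md K h) / l\<^sup>2) - sn K (3*h) * ((md K (T1 l) - md K (2*h)) / l\<^sup>2)
      - sn K h * ((md K (T2 l) - md K (2*h)) / l\<^sup>2)) \<longlongrightarrow>
      sn K (4*h) * (sn K h * - (1 / (2 * (H t0 - H s)))) - sn K (3*h) * (sn K (2*h) * - (1 / (2 * (H t0 - H a))))
      - sn K h * (sn K (2*h) * - (1 / (2 * (H c - H t0))))) (at_right 0)"
      by (intro tendsto_intros m1 m2 m3)
    moreover have "sn K (4*h) * (sn K h * - (1 / (2 * p))) - sn K (3*h) * (sn K (2*h) * - (1 / (2 * q)))
      - sn K h * (sn K (2*h) * - (1 / (2 * r))) =
      - (sn K (4*h) * sn K h / p - sn K (3*h) * sn K (2*h) / q - sn K h * sn K (2*h) / r) / 2" for p q r :: real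
      by (simp add: diff_divide_distrib)
    note this[of "H t0 - H s" "H t0 - H a" "H c - H t0", folded E_def[folded defs]]
    moreover have "sn K (4*h) * ((md K (T3 l) - md K h) / l\<^sup>2) - sn K (3*h) * ((md K (T1 l) - md K (2*h)) / l\<^sup>2)
      - sn K h * ((md K (T2 l) - md K (2*h)) / l\<^sup>2) = G l / l\<^sup>2" for l
    proof -
      have "x * (p - (q + n / x)) = x * (p - q) - n" if "x > 0" for x p q n :: real
        using that by (simp add: right_diff_distrib distrib_left)
      from this[OF snpos] have "G l = sn K (4*h) * (md K (T3 l) - md K h) -
          (sn K (3*h) * (md K (T1 l) - md K (2*h)) + sn K h * (md K (T2 l) - md K (2*h)))"
        unfolding G_def F_def .
      then show ?thesis by (simp add: diff_divide_distrib add_divide_distrib right_diff_distrib)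
    qed
    ultimately show ?thesis by simp
  qed
  show "E \<ge> 0" if rel: "rel = (\<le>)"
  proof -
    have "eventually (\<lambda>l. G l / l\<^sup>2 \<le> 0) (at_right 0)"
      using key eventually_at_right_less[of 0]
    proof eventually_elim
      case (elim l)
      then obtain D where D: "T3 l \<le> D" "K < 0 \<longrightarrow> sqrt (- K) * D < pi" "md K D = F l" "T3 l > 0"
        unfolding rel by auto
      have "md K (T3 l) \<le> md K D"
        using md_strict_mono[of "T3 l" D K] D by (cases "T3 l = D") auto
      then have "G l \<le> 0" using D snpos by (simp add: G_def mult_nonneg_nonpos)
      then show ?case using elim by (simp add: divide_nonpos_pos)
    qed
    from tendsto_upperbound[OF lim this] have "- E / 2 \<le> 0" by simp
    then show ?thesis by simp
  qed
  show "E \<le> 0" if rel: "rel = (\<ge>)"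
  proof -
    have "eventually (\<lambda>l. 0 \<le> G l / l\<^sup>2) (at_right 0)"
      using key eventually_at_right_less[of 0]
    proof eventually_elim
      case (elim l)
      then obtain D where D: "D \<le> T3 l" "K < 0 \<longrightarrow> sqrt (- K) * T3 l < pi" "md K D = F l" "D > 0"
        unfolding rel by auto
      have "md K D \<le> md K (T3 l)"
        using md_strict_mono[of D "T3 l" K] D by (cases "T3 l = D") auto
      then have "G l \<ge> 0" using D snpos by (simp add: G_def)
      then show ?case using elim by simp
    qed
    from tendsto_lowerbound[OF lim this] have "0 \<le> - E / 2" by simp
    then show ?thesis by simp
  qed
qed

text \<open>The inequality for \<open>E h\<close> holds for all small h > 0. Its leading term is
  cubic, with the negative factor - 4 f in front of f'' - K f; this reverses the sign of
  \<open>E\<close>.\<close>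

lemma curvature_bound_local_sign:
  fixes X :: "'a::metric_space set" and f :: "real \<Rightarrow> real"
  assumes geo: "geodesic_length_space X" and X: "x0 \<in> X" "x1 \<in> X" "x0 \<noteq> x1"
    and I: "open I" and smooth: "smooth_on I f" and fpos: "\<forall>t\<in>I. f t > 0" and t0: "t0 \<in> I"
    and curv: "timelike_curv_bound I X f K rel"
  shows "rel = (\<le>) \<Longrightarrow> deriv (deriv f) t0 - K * f t0 \<le> 0"
    and "rel = (\<ge>) \<Longrightarrow> deriv (deriv f) t0 - K * f t0 \<ge> 0"
proof -
  obtain U where U: "openin (top_of_set (I \<times> X)) U" "(t0, x0) \<in> U"
    and maxU: "\<forall>p\<in>U. \<forall>q\<in>U. chron I X f p q \<longrightarrow> (\<exists>a b \<gamma>. max_curve_in I X f U p q a b \<gamma>)"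
    and comp: "triangle_comparison I X f K rel U"
  proof -
    have "(t0, x0) \<in> I \<times> X" using t0 X by simp
    from bspec[OF curv[unfolded timelike_curv_bound_def] this, folded triangle_comparison_def] show ?thesis
      by (elim exE conjE) (rule that)
  qed
  obtain V where V: "open V" "U = (I \<times> X) \<inter> V" using U(1) by (auto simp: openin_open)
  obtain V1 V2 where V12: "open V1" "open V2" "(t0, x0) \<in> V1 \<times> V2" "V1 \<times> V2 \<subseteq> V"
    using open_prod_elim[OF V(1), of "(t0, x0)"] U(2) V(2) by auto
  obtain \<epsilon>1 where \<epsilon>1: "\<epsilon>1 > 0" "ball t0 \<epsilon>1 \<subseteq> V1" using V12 by (auto simp: open_contains_ball)
  obtain \<epsilon>2 where \<epsilon>2: "\<epsilon>2 > 0" "ball x0 \<epsilon>2 \<subseteq> V2" using V12 by (auto simp: open_contains_ball)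
  obtain \<epsilon>3 where \<epsilon>3: "\<epsilon>3 > 0" "cball t0 \<epsilon>3 \<subseteq> I" using I t0 by (auto simp: open_contains_cball)
  \<comment> \<open>The first radius keeps the strip inside U, the second keeps a closed interval
    around \<open>t0\<close> inside I, on which 1 / f^2 is continuous.\<close>
  define r where "r = min \<epsilon>1 \<epsilon>3"
  have r: "r > 0" using \<epsilon>1 \<epsilon>3 by (simp add: r_def)
  have rI: "t \<in> I" if "\<bar>t - t0\<bar> \<le> r" for t
  proof -
    have "t \<in> cball t0 \<epsilon>3" using that by (auto simp: r_def dist_real_def)
    then show ?thesis using \<epsilon>3 by blast
  qed
  have d0: "(f has_real_derivative deriv f t) (at t)" if "t \<in> I" for t
    using smooth that unfolding smooth_on_def DERIV_deriv_iff_field_differentiable by (metis funpow_0)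
  have d1: "(deriv f has_real_derivative deriv (deriv f) t) (at t)" if "t \<in> I" for t
  proof -
    have "((deriv ^^ 1) f) field_differentiable (at t)" using smooth that unfolding smooth_on_def by blast
    then show ?thesis by (simp add: DERIV_deriv_iff_field_differentiable)
  qed
  have c2: "isCont (deriv (deriv f)) t0"
  proof -
    have "((deriv ^^ 2) f) field_differentiable (at t0)" using smooth t0 unfolding smooth_on_def by blast
    then show ?thesis by (simp add: eval_nat_numeral field_differentiable_imp_continuous_at)
  qed
  have fcontI: "continuous_on S f" if "S \<subseteq> I" for S
    using d0 that by (meson DERIV_isCont continuous_at_imp_continuous_on subsetD)
  \<comment> \<open>Starting the integral at t0 - r instead of \<open>t0\<close> makes H a primitive
    on both sides of \<open>t0\<close>.\<close>
  define H where "H = (\<lambda>t. integral {t0 - r..t} (\<lambda>t. 1 / (f t)\<^sup>2))"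
  have H: "(H has_real_derivative 1 / (f t)\<^sup>2) (at t)" if "\<bar>t - t0\<bar> < r" for t
  proof -
    have sub: "{t0 - r..t0 + r} \<subseteq> I" using rI by auto
    have "f t \<noteq> 0" if "t \<in> {t0 - r..t0 + r}" for t using fpos sub that by fastforce
    then have "continuous_on {t0 - r..t0 + r} (\<lambda>t. 1 / (f t)\<^sup>2)"
      using fcontI[OF sub] by (intro continuous_on_divide continuous_on_const continuous_on_power) auto
    moreover have "t \<in> {t0 - r..t0 + r}" using that by auto
    ultimately have "(H has_real_derivative 1 / (f t)\<^sup>2) (at t within {t0 - r..t0 + r})"
      unfolding H_def by (rule integral_has_real_derivative)
    moreover have "t \<in> interior {t0 - r..t0 + r}" using that by (auto simp: interior_atLeastAtMost_real)
    ultimately show ?thesis by (metis at_within_interior)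
  qed
  define E where "E = (\<lambda>h. sn K (4*h) * sn K h / (H t0 - H (t0 - h)) - sn K (3*h) * sn K (2*h) / (H t0 - H (t0 - 2*h))
      - sn K h * sn K (2*h) / (H (t0 + 2*h) - H t0))"
  have lim: "((\<lambda>h. E h / h^3) \<longlongrightarrow> - 4 * f t0 * (deriv (deriv f) t0 - K * f t0)) (at_right 0)"
    unfolding E_def
  proof (rule interpolation_defect_limit[OF r, where ?f1.0 = "deriv f"])
    fix t assume "\<bar>t - t0\<bar> < r"
    then have "t \<in> I" by (intro rI) simp
    then show "(f has_real_derivative deriv f t) (at t)" "(deriv f has_real_derivative deriv (deriv f) t) (at t)" "f t > 0"
      using d0 d1 fpos by auto
  qed (use H c2 in auto)
  have ev: "eventually (\<lambda>h. h > 0 \<and> 2*h < r \<and> (K < 0 \<longrightarrow> sqrt (- K) * (4*h) < pi / 2)) (at_right (0::real))"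
  proof (intro eventually_conj)
    show "eventually (\<lambda>h. 0 < h) (at_right (0::real))" by (rule eventually_at_right_less)
    have "((\<lambda>h. 2*h) \<longlongrightarrow> 2 * 0) (at_right (0::real))" by (intro tendsto_intros)
    then show "eventually (\<lambda>h. 2*h < r) (at_right (0::real))" using r by (auto dest: order_tendstoD(2))
    have "((\<lambda>h. sqrt (- K) * (4*h)) \<longlongrightarrow> sqrt (- K) * (4*0)) (at_right (0::real))" by (intro tendsto_intros)
    then have "eventually (\<lambda>h. sqrt (- K) * (4*h) < pi / 2) (at_right (0::real))"
      using pi_gt_zero by (auto dest!: order_tendstoD(2)[where a = "pi / 2"])
    then show "eventually (\<lambda>h. K < 0 \<longrightarrow> sqrt (- K) * (4*h) < pi / 2) (at_right (0::real))"
      by (auto elim: eventually_mono)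
  qed
  have ineq: "(rel = (\<le>) \<longrightarrow> E h \<ge> 0) \<and> (rel = (\<ge>) \<longrightarrow> E h \<le> 0)"
    if h: "h > 0" "2*h < r" "K < 0 \<longrightarrow> sqrt (- K) * (4*h) < pi / 2" for h
  proof -
    have near: "\<bar>t - t0\<bar> < r" if "t \<in> {t0 - 2*h..t0 + 2*h}" for t using that h by auto
    have sub: "{t0 - 2*h..t0 + 2*h} \<subseteq> I" using near rI by (meson less_imp_le subsetI)
    have fp: "f t > 0" if "t \<in> {t0 - 2*h..t0 + 2*h}" for t using fpos sub that by blast
    have Hh: "(H has_real_derivative 1 / (f t)\<^sup>2) (at t)" if "t \<in> {t0 - 2*h..t0 + 2*h}" for t
      using near[OF that] by (rule H)
    have inU: "(t, x) \<in> U" if "t \<in> {t0 - 2*h..t0 + 2*h}" "x \<in> X" "dist x0 x < \<epsilon>2" for t x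
    proof -
      have "t \<in> ball t0 \<epsilon>1" using near[OF that(1)] by (auto simp: r_def dist_real_def)
      moreover have "x \<in> ball x0 \<epsilon>2" using that by simp
      ultimately have "(t, x) \<in> V" using \<epsilon>1 \<epsilon>2 V12 by blast
      then show ?thesis using V(2) sub that by blast
    qed
    show ?thesis
      unfolding E_def
      using curvature_bound_inequality[OF geo X h(1) sub fp fcontI[OF sub] Hh h(3)[rule_format] \<epsilon>2(1) inU maxU comp]
      by blast
  qed
  have f0: "f t0 > 0" using fpos t0 by blast
  show "deriv (deriv f) t0 - K * f t0 \<le> 0" if rel: "rel = (\<le>)"
  proof -
    have "eventually (\<lambda>h. 0 \<le> E h / h^3) (at_right 0)"
    proof (rule eventually_mono[OF ev])
      fix h assume "h > 0 \<and> 2*h < r \<and> (K < 0 \<longrightarrow> sqrt (- K) * (4*h) < pi / 2)"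
      then show "0 \<le> E h / h^3" using ineq[of h] rel by simp
    qed
    from tendsto_lowerbound[OF lim this] have "0 \<le> - 4 * f t0 * (deriv (deriv f) t0 - K * f t0)" by simp
    then show ?thesis using f0 by (simp add: mult_le_0_iff)
  qed
  show "deriv (deriv f) t0 - K * f t0 \<ge> 0" if rel: "rel = (\<ge>)"
  proof -
    have "eventually (\<lambda>h. E h / h^3 \<le> 0) (at_right 0)"
    proof (rule eventually_mono[OF ev])
      fix h assume "h > 0 \<and> 2*h < r \<and> (K < 0 \<longrightarrow> sqrt (- K) * (4*h) < pi / 2)"
      then show "E h / h^3 \<le> 0" using ineq[of h] rel by (simp add: divide_nonpos_pos)
    qed
    from tendsto_upperbound[OF lim this] have "- 4 * f t0 * (deriv (deriv f) t0 - K * f t0) \<le> 0" by simp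
    then show ?thesis using f0 by (simp add: zero_le_mult_iff)
  qed
qed

theorem theorem6p2:
  fixes X :: "'a::metric_space set" and I :: "real set" and f :: "real \<Rightarrow> real" and K :: real
  assumes "geodesic_length_space X"
    and "\<exists>x\<in>X. \<exists>y\<in>X. x \<noteq> y"
    and "open I" and "is_interval I" and "I \<noteq> {}"
    and "smooth_on I f" and "\<forall>t\<in>I. f t > 0"
  shows "(timelike_curv_below I X f K \<longrightarrow> (\<forall>t\<in>I. deriv (deriv f) t - K * f t \<le> 0)) \<and>
         (timelike_curv_above I X f K \<longrightarrow> (\<forall>t\<in>I. deriv (deriv f) t - K * f t \<ge> 0))"
proof -
  \<comment> \<open>Two distinct points supply the spatial direction from which the apex approaches
    the long side.\<close>
  obtain x0 x1 where "x0 \<in> X" "x1 \<in> X" "x0 \<noteq> x1" using assms(2) by blast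
  note sign = curvature_bound_local_sign[OF assms(1) this assms(3,6,7)]
  show ?thesis
    unfolding timelike_curv_below_def timelike_curv_above_def
    using sign(1)[of _ K "(\<le>)"] sign(2)[of _ K "(\<ge>)"] by blast
qed

end
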